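(* Let $M$ be one of $\mathbb{S}^d$ ($d\ge2$), $P_d(\mathbb{R})$ ($d\ge2$), $P_l(\mathbb{C})$, $P_l(\mathbb{H})$ ($l\ge2$), $P_2(\mathbb{C}\mathrm{ay})$. Let $\alpha,\beta>-1/2$, $a=1$ or $a\ge2$, $b=0$ or $b\ge1$, $j\ge1$ an integer, and $u_j(\theta)=(\sin\frac\theta2)^{aj}(\cos\frac\theta2)^{bj}$, $\theta\in(0,\pi)$. Then, for $\theta,\varphi\in(0,\pi)$, $$|j\,u_j(\theta)u_j(\varphi)T_M^{\alpha+aj,\beta+bj}(\theta,\varphi)|\le\frac{C_1}{\mu_{\alpha,\beta}(B(\theta,|\theta-\varphi|))},\qquad\theta\ne\varphi,$$ $$\big|j\,\nabla_{\theta,\varphi}\big(u_j(\theta)u_j(\varphi)T_M^{\alpha+aj,\beta+bj}(\theta,\varphi)\big)\big|\le\frac{C_2}{|\theta-\varphi|\,\mu_{\alpha,\beta}(B(\theta,|\theta-\varphi|))},\qquad\theta\ne\varphi,$$ with $C_1$ and $C_2$ independent of $j$.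
   Context: The manifolds $M$ are the sphere, the real, complex and quaternionic projective spaces, and the Cayley plane $P_2(\mathbb{C}\mathrm{ay})$ (the compact Riemannian symmetric spaces of rank one). $d\mu_{\alpha,\beta}(\theta)=(\sin\frac\theta2)^{2\alpha+1}(\cos\frac\theta2)^{2\beta+1}d\theta$ on $(0,\pi)$, and $\mu_{\alpha,\beta}(B(\theta,|\theta-\varphi|))$ is the $\mu_{\alpha,\beta}$-measure of the interval with center $\theta$ and radius $|\theta-\varphi|$ (intersected with $(0,\pi)$). $\nabla_{\theta,\varphi}$ is the gradient in the two variables $(\theta,\varphi)$. $\mathcal{P}_n^{(\alpha,\beta)}(\theta)=d_n^{\alpha,\beta}P_n^{(\alpha,\beta)}(\cos\theta)$, $n\ge0$, where $P_n^{(\alpha,\beta)}$ are the classical Jacobi polynomials (Szegő normalization) and $d_n^{\alpha,\beta}=\Big(\frac{(2n+\alpha+\beta+1)\Gamma(n+1)\Gamma(n+\alpha+\beta+1)}{\Gamma(n+\alpha+1)\Gamma(n+\beta+1)}\Big)^{1/2}$; these form an orthonormal basis of $L^2(d\mu_{\alpha,\beta})$. The Jacobi--Poisson kernel is $\mathcal{P}_t^{\alpha,\beta}(\theta,\varphi)=\sum_{n=0}^\infty e^{-t|n+\frac{\alpha+\beta+1}{2}|}\mathcal{P}_n^{(\alpha,\beta)}(\theta)\mathcal{P}_n^{(\alpha,\beta)}(\varphi)$, $t>0$. The kernel $T_M^{\alpha,\beta}$ depends on $M$ only through $\rho_M$, where $\rho_{\mathbb{S}^d}(\theta)=\frac{1}{(\sin\theta)^2}$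 and $\rho_M(\theta)=\frac{1}{(\sin\frac\theta2)^2}$ for the other four families: $$T_M^{\alpha,\beta}(\theta,\varphi)=\sqrt{\rho_M(\theta)}\int_0^\infty\mathcal{P}_t^{\alpha,\beta}(\theta,\varphi)\,dt .$$
   Formalization: For M = S^d the size estimate is stated only for b ≥ 1 and the gradient estimate only for b = 1 or b ≥ 2, because for b = 0 (both estimates) and 1 < b < 2 (gradient) the claim fails already at j = 1 as θ → π. *)

theory Defs
  imports "HOL-Analysis.Analysis"
begin

text \<open>
  The rank-one compact symmetric spaces, as the list of families with their dimension
  parameter.  The kernel depends on the space only through \<open>\<rho>\<close> below, so no geometric
  structure is carried.
\<close>
datatype rank_one_space =
    Sphere nat
  | Real_Projective nat
  | Complex_Projective nat
  | Quaternionic_Projective nat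
  | Cayley_Plane

fun admissible :: "rank_one_space \<Rightarrow> bool" where
  "admissible (Sphere d) \<longleftrightarrow> d \<ge> 2"
| "admissible (Real_Projective d) \<longleftrightarrow> d \<ge> 2"
| "admissible (Complex_Projective l) \<longleftrightarrow> l \<ge> 2"
| "admissible (Quaternionic_Projective l) \<longleftrightarrow> l \<ge> 2"
| "admissible Cayley_Plane \<longleftrightarrow> True"

text \<open>
  On the sphere \<open>sqrt (\<rho> \<theta>) = 1 / (2 sin (\<theta>/2) cos (\<theta>/2))\<close> is singular at \<open>\<pi>\<close> as well as
  at \<open>0\<close>.  For \<open>j = 1\<close> and fixed \<open>\<phi>\<close> the weighted kernel behaves like \<open>(cos (\<theta>/2)) powr (b - 1)\<close>
  as \<open>\<theta>\<close> tends to \<open>\<pi>\<close>, so it is unbounded there if \<open>b = 0\<close>, and so is its gradient if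
  \<open>b = 0\<close> or \<open>1 < b < 2\<close>.  Estimates for the sphere that are uniform up to \<open>\<pi>\<close> therefore need
  \<open>b \<ge> 1\<close> for the size and \<open>b = 1\<close> or \<open>b \<ge> 2\<close> for the gradient.
\<close>
fun rho :: "rank_one_space \<Rightarrow> real \<Rightarrow> real" where
  "rho (Sphere d) \<theta> = 1 / (sin \<theta>)\<^sup>2"
| "rho (Real_Projective d) \<theta> = 1 / (sin (\<theta> / 2))\<^sup>2"
| "rho (Complex_Projective l) \<theta> = 1 / (sin (\<theta> / 2))\<^sup>2"
| "rho (Quaternionic_Projective l) \<theta> = 1 / (sin (\<theta> / 2))\<^sup>2"
| "rho Cayley_Plane \<theta> = 1 / (sin (\<theta> / 2))\<^sup>2"

text \<open>
  Jacobi polynomials in the normalization \<open>P\<^sub>n(1) = (n + \<alpha>) gchoose n\<close>; this is formula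
  (4.3.2) in G. Szego, Orthogonal Polynomials.
\<close>
definition jacobi_P :: "nat \<Rightarrow> real \<Rightarrow> real \<Rightarrow> real \<Rightarrow> real" where
  "jacobi_P n \<alpha> \<beta> x =
     (\<Sum>s\<le>n. ((real n + \<alpha>) gchoose (n - s)) * ((real n + \<beta>) gchoose s)
              * ((x - 1) / 2) ^ s * ((x + 1) / 2) ^ (n - s))"

definition jacobi_d :: "nat \<Rightarrow> real \<Rightarrow> real \<Rightarrow> real" where
  "jacobi_d n \<alpha> \<beta> =
     sqrt ((2 * real n + \<alpha> + \<beta> + 1) * Gamma (real n + 1) * Gamma (real n + \<alpha> + \<beta> + 1)
           / (Gamma (real n + \<alpha> + 1) * Gamma (real n + \<beta> + 1)))"

definition jacobi_fun :: "nat \<Rightarrow> real \<Rightarrow> real \<Rightarrow> real \<Rightarrow> real" where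
  "jacobi_fun n \<alpha> \<beta> \<theta> = jacobi_d n \<alpha> \<beta> * jacobi_P n \<alpha> \<beta> (cos \<theta>)"

definition jacobi_measure :: "real \<Rightarrow> real \<Rightarrow> real measure" where
  "jacobi_measure \<alpha> \<beta> =
     density (restrict_space lborel {0<..<pi})
       (\<lambda>\<theta>. ennreal (sin (\<theta> / 2) powr (2 * \<alpha> + 1) * cos (\<theta> / 2) powr (2 * \<beta> + 1)))"

definition jacobi_poisson :: "real \<Rightarrow> real \<Rightarrow> real \<Rightarrow> real \<Rightarrow> real \<Rightarrow> real" where
  "jacobi_poisson \<alpha> \<beta> t \<theta> \<phi> =
     (\<Sum>n. exp (- t * \<bar>real n + (\<alpha> + \<beta> + 1) / 2\<bar>) * jacobi_fun n \<alpha> \<beta> \<theta> * jacobi_fun n \<alpha> \<beta> \<phi>)"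

definition kernel_T :: "rank_one_space \<Rightarrow> real \<Rightarrow> real \<Rightarrow> real \<Rightarrow> real \<Rightarrow> real" where
  "kernel_T M \<alpha> \<beta> \<theta> \<phi> =
     sqrt (rho M \<theta>) * (LINT t:{0<..}|lborel. jacobi_poisson \<alpha> \<beta> t \<theta> \<phi>)"

definition u_fun :: "real \<Rightarrow> real \<Rightarrow> nat \<Rightarrow> real \<Rightarrow> real" where
  "u_fun a b j \<theta> = sin (\<theta> / 2) powr (a * real j) * cos (\<theta> / 2) powr (b * real j)"

end

theory Submission
  imports Defs "HOL-Complex_Analysis.Complex_Analysis" "HOL-Real_Asymp.Real_Asymp"
    "HOL-Computational_Algebra.Polynomial"
begin

text \<open>
  Write \<open>x, x'\<close> and \<open>y, y'\<close> for the sines and cosines of the half angles, \<open>X = x x'\<close>, \<open>Y = y y'\<close>, and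
  \<open>I\<^sub>\<nu>\<close> for the modified Bessel functions.  Bailey's generating function for products of Jacobi
  polynomials shows that the integral in \<open>t\<close> of the Jacobi-Poisson kernel with parameters \<open>A, B\<close> is
  \<open>X powr (- A) * Y powr (- B)\<close> times the integral over \<open>s > 0\<close> of \<open>2 exp (- 2 s) I\<^sub>A(2 s X) I\<^sub>B(2 s Y)\<close>.
  For \<open>A = \<alpha> + a j\<close>, \<open>B = \<beta> + b j\<close> the weights \<open>u\<^sub>j(\<theta>) u\<^sub>j(\<phi>) = X powr (a j) * Y powr (b j)\<close> absorb the
  \<open>j\<close>-dependent powers, and \<open>exp (- z) I\<^sub>\<nu>(z)\<close> has bounds that are uniform in the order and gain a
  factor \<open>1 / j\<close>.  What is left is the exponential factor \<open>exp (- 2 s D)\<close> with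
  \<open>D = 1 - X - Y = 2 (sin ((\<theta> - \<phi>) / 4))\<^sup>2\<close>, and the integral in \<open>s\<close> of \<open>s powr (-1/2) * exp (- s D / 2)\<close>,
  respectively \<open>exp (- s D / 2)\<close>, is of order \<open>1 / \<bar>\<theta> - \<phi>\<bar>\<close>, respectively \<open>1 / (\<theta> - \<phi>)\<^sup>2\<close>.
\<close>

subsection \<open>Jacobi polynomials and Bailey's product formula\<close>

text \<open>The factor \<open>sqrt (rho M \<theta>)\<close> contributes 1/x, more than the measure
  of a ball allows near \<theta> = 0. The Bessel factor of order \<alpha> + \<mu>, with \<mu> = a j,
  pays for it: \<mu> times the scaled function E(z), z = s X, is at most of order z (1 + z) powr (-
  \<alpha> - 1), and the x in z cancels 1/x. Differentiating 1/x costs a second power, so z E' - E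
  has to be O(z^2) near 0. Its critical part is (\<mu> - 1) E, of size z powr \<mu>; it disappears
  for \<mu> = 1 and is small enough for \<mu> \<ge> 2, hence the alternative for a. Uniformity in j
  reflects that exp (- z) I of order \<nu> stays small until z reaches \<nu>^2, so that for large z
  a factor \<mu> or \<mu>^2 costs half a power or a full power of z. The bounds rest on Poisson's
  integral, used for orders above 1/2. Orders \<alpha> + \<mu> with \<mu> \<ge> 1 always qualify;
  the order \<beta>, which occurs for b = 0, is reached by the three-term recurrence. Sums and
  integrals may be exchanged because Bailey's expansion has nonnegative terms, unlike the Jacobi
  series itself.\<close>

text \<open>The Jacobi operator in the variable \<open>t = (1 - cos \<theta>) / 2\<close>.\<close>

definition jac_op :: "real \<Rightarrow> real \<Rightarrow> real poly \<Rightarrow> real poly" where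
  "jac_op \<alpha> \<beta> p = [:0, 1, -1:] * pderiv (pderiv p) + [:\<alpha> + 1, - (\<alpha> + \<beta> + 2):] * pderiv p"

lemma jac_op_add: "jac_op \<alpha> \<beta> (p + q) = jac_op \<alpha> \<beta> p + jac_op \<alpha> \<beta> q"
  unfolding jac_op_def pderiv_add by (simp only: algebra_simps)

lemma jac_op_smult: "jac_op \<alpha> \<beta> (smult c p) = smult c (jac_op \<alpha> \<beta> p)"
  unfolding jac_op_def pderiv_smult by (simp only: mult_smult_right smult_add_right)

lemma jac_op_sum: "jac_op \<alpha> \<beta> (\<Sum>i\<in>A. f i) = (\<Sum>i\<in>A. jac_op \<alpha> \<beta> (f i))"
proof (induction A rule: infinite_finite_induct)
  case (insert x F)
  then show ?case by (simp add: jac_op_add)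
qed (simp_all add: jac_op_def)

lemma pderiv_monomial_product:
  fixes T S :: "real poly"
  assumes "pderiv T = 1" "pderiv S = -1"
  shows "pderiv (T ^ m * S ^ k) = smult (real m) (T ^ (m - 1) * S ^ k) - smult (real k) (T ^ m * S ^ (k - 1))"
  by (simp add: pderiv_mult pderiv_power assms mult_ac)

text \<open>With w = 1 - t the operator maps \<open>t ^ m * w ^ k\<close> to three monomials of the
  same total degree, whose exponents are moved by (-1, 1), (1, -1) and (0, 0). Both eigenvalue
  equations below thereby reduce to relations between neighbouring coefficients.\<close>

lemma poly_jac_op_monomial:
  "poly (jac_op \<alpha> \<beta> ([:0, 1:] ^ m * [:1, -1:] ^ k)) t =
     real m * (real m + \<alpha>) * t ^ (m - 1) * (1 - t) ^ (k + 1)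
     + real k * (real k + \<beta>) * t ^ (m + 1) * (1 - t) ^ (k - 1)
     - (real m * (real k + \<beta> + 1) + real k * (real m + \<alpha> + 1)) * t ^ m * (1 - t) ^ k"
proof -
  define T S :: "real poly" where "T = [:0, 1:]" and "S = [:1, -1:]"
  have d: "pderiv T = 1" "pderiv S = -1"
    by (simp_all add: T_def S_def pderiv_pCons one_pCons)
  have e: "poly T t = t" "poly S t = 1 - t" by (simp_all add: T_def S_def)
  note D = pderiv_monomial_product[OF d]
  have p: "poly (jac_op \<alpha> \<beta> (T ^ m * S ^ k)) t =
     t * (1 - t) * poly (pderiv (pderiv (T ^ m * S ^ k))) t
     + (\<alpha> + 1 - (\<alpha> + \<beta> + 2) * t) * poly (pderiv (T ^ m * S ^ k)) t"
    by (simp add: jac_op_def algebra_simps)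
  have "poly (jac_op \<alpha> \<beta> (T ^ m * S ^ k)) t =
     t * (1 - t) * (real m * real (m - 1) * t ^ (m - 1 - 1) * (1 - t) ^ k
        - 2 * real m * real k * t ^ (m - 1) * (1 - t) ^ (k - 1)
        + real k * real (k - 1) * t ^ m * (1 - t) ^ (k - 1 - 1))
     + (\<alpha> + 1 - (\<alpha> + \<beta> + 2) * t) * (real m * t ^ (m - 1) * (1 - t) ^ k - real k * t ^ m * (1 - t) ^ (k - 1))"
    unfolding p D pderiv_diff pderiv_smult
    by (simp add: e algebra_simps)
  also have "\<dots> = real m * (real m + \<alpha>) * t ^ (m - 1) * (1 - t) ^ (k + 1)
     + real k * (real k + \<beta>) * t ^ (m + 1) * (1 - t) ^ (k - 1)
     - (real m * (real k + \<beta> + 1) + real k * (real m + \<alpha> + 1)) * t ^ m * (1 - t) ^ k"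
  proof -
    define w where "w = 1 - t"
    \<comment> \<open>Written in t and w the first-order coefficient is homogeneous, and the claim
      becomes an identity in t and w that no longer uses w = 1 - t.\<close>
    have lin: "\<alpha> + 1 - (\<alpha> + \<beta> + 2) * t = (\<alpha> + 1) * w - (\<beta> + 1) * t"
      by (simp add: w_def algebra_simps)
    \<comment> \<open>Subtraction truncates in \<open>m - 1 - 1\<close>: for the exponents 0 and 1
      the power may be wrong, but then its coefficient is 0.\<close>
    have m: "m = 0 \<or> m = 1 \<or> (\<exists>r. m = Suc (Suc r))"
      by (metis One_nat_def not0_implies_Suc)
    have k: "k = 0 \<or> k = 1 \<or> (\<exists>r. k = Suc (Suc r))"
      by (metis One_nat_def not0_implies_Suc)
    show ?thesis unfolding lin w_def[symmetric]
      using m k by (elim disjE exE) (simp_all add: algebra_simps)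
  qed
  finally show ?thesis unfolding T_def S_def .
qed

lemma coeff_jac_op:
  "coeff (jac_op \<alpha> \<beta> p) i =
     (real i + 1) * (real i + 1 + \<alpha>) * coeff p (Suc i)
     - real i * (real i + \<alpha> + \<beta> + 1) * coeff p i"
proof -
  have eq: "jac_op \<alpha> \<beta> p = pCons 0 (pderiv (pderiv p)) - pCons 0 (pCons 0 (pderiv (pderiv p)))
      + smult (\<alpha> + 1) (pderiv p) - smult (\<alpha> + \<beta> + 2) (pCons 0 (pderiv p))"
    by (rule poly_eqI) (simp add: jac_op_def mult_pCons_left algebra_simps coeff_pCons split: nat.splits)
  show ?thesis
    unfolding eq by (cases i rule: nat.exhaust; cases "i - 1")
      (simp_all add: coeff_pderiv algebra_simps coeff_pCons split: nat.splits)
qed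

text \<open>0 is a singular point of the equation: comparing coefficients gives a first-order
  recurrence whose factor (i + 1) (i + 1 + \<alpha>) does not vanish for \<alpha> > -1. One initial
  value therefore fixes a polynomial eigenfunction.\<close>

lemma jac_op_eigen_unique:
  assumes "\<alpha> > -1" "jac_op \<alpha> \<beta> p = smult c p" "jac_op \<alpha> \<beta> q = smult c q"
    and "poly p 0 = poly q 0"
  shows "p = q"
proof (rule poly_eqI)
  fix i show "coeff p i = coeff q i"
  proof (induction i)
    case 0
    then show ?case using assms(4) by (simp add: poly_0_coeff_0)
  next
    case (Suc i)
    have "(real i + 1) * (real i + 1 + \<alpha>) * coeff p (Suc i)
        = (real i + 1) * (real i + 1 + \<alpha>) * coeff q (Suc i)"
      using coeff_jac_op[of \<alpha> \<beta> p i] coeff_jac_op[of \<alpha> \<beta> q i] Suc assms(2,3) by simp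
    moreover have "(real i + 1) * (real i + 1 + \<alpha>) \<noteq> 0"
      using assms(1) by simp
    ultimately show ?case by simp
  qed
qed

section \<open>Jacobi polynomials as eigenfunctions of the operator\<close>

definition jac_poly :: "nat \<Rightarrow> real \<Rightarrow> real \<Rightarrow> real poly" where
  "jac_poly n \<alpha> \<beta> = (\<Sum>s\<le>n. smult ((-1) ^ s * ((real n + \<alpha>) gchoose (n - s)) * ((real n + \<beta>) gchoose s))
      ([:0, 1:] ^ s * [:1, -1:] ^ (n - s)))"

lemma poly_jac_poly: "poly (jac_poly n \<alpha> \<beta>) t = jacobi_P n \<alpha> \<beta> (1 - 2 * t)"
proof -
  have e: "(1 - 2 * t - 1) / 2 = - t" "(1 - 2 * t + 1) / 2 = 1 - t" by auto
  show ?thesis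
    unfolding jac_poly_def jacobi_P_def poly_sum e
    by (intro sum.cong refl) (simp add: power_minus[of t])
qed

text \<open>All terms have total degree n, so the operator only shifts the index s by one. The ratio
  of consecutive coefficients turns each of the two shifted sums into a diagonal one
  (\<open>S1\<close>, \<open>S2\<close>), and the three diagonal factors add up to the
  eigenvalue.\<close>

lemma jac_op_jac_poly:
  "jac_op \<alpha> \<beta> (jac_poly n \<alpha> \<beta>) = smult (- (real n * (real n + \<alpha> + \<beta> + 1))) (jac_poly n \<alpha> \<beta>)"
proof (subst poly_eq_poly_eq_iff[symmetric], rule ext)
  fix t :: real
  define a where "a s = (-1) ^ s * ((real n + \<alpha>) gchoose (n - s)) * ((real n + \<beta>) gchoose s)" for s
  define M where "M s = t ^ s * (1 - t) ^ (n - s)" for s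
  \<comment> \<open>From s to s + 1 the lower index of one binomial falls and that of the other
    rises; each change produces one of the factors.\<close>
  have rec: "a (Suc s) * (real (Suc s) * (real (Suc s) + \<alpha>)) = - (real (n - s) * (real (n - s) + \<beta>) * a s)"
    if "s < n" for s
  proof -
    obtain r where "n = Suc (s + r)" using less_imp_Suc_add[OF \<open>s < n\<close>] by blast
    then have r: "n = s + Suc r" by simp
    have 1: "real (Suc r) * ((real n + \<alpha>) gchoose Suc r) = (real n + \<alpha> - real r) * ((real n + \<alpha>) gchoose r)"
      using gbinomial_mult_1[of "real n + \<alpha>" r] by (simp add: algebra_simps)
    have 2: "real (Suc s) * ((real n + \<beta>) gchoose Suc s) = (real n + \<beta> - real s) * ((real n + \<beta>) gchoose s)"
      using gbinomial_mult_1[of "real n + \<beta>" s] by (simp add: algebra_simps)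
    have "a (Suc s) * (real (Suc s) * (real (Suc s) + \<alpha>)) =
       - ((-1) ^ s) * ((real n + \<alpha> - real r) * ((real n + \<alpha>) gchoose r)) * (real (Suc s) * ((real n + \<beta>) gchoose Suc s))"
      unfolding a_def using r by (simp add: algebra_simps)
    also have "\<dots> = - ((-1) ^ s) * (real (Suc r) * ((real n + \<alpha>) gchoose Suc r)) * ((real n + \<beta> - real s) * ((real n + \<beta>) gchoose s))"
      unfolding 1 2 by simp
    also have "\<dots> = - (real (n - s) * (real (n - s) + \<beta>) * a s)"
      unfolding a_def using r by (simp add: algebra_simps)
    finally show ?thesis .
  qed
  have S1: "(\<Sum>s\<le>n. a s * (real s * (real s + \<alpha>) * t ^ (s - 1) * (1 - t) ^ (n - s + 1)))
      = (\<Sum>s\<le>n. - (real (n - s) * (real (n - s) + \<beta>) * a s) * M s)"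
  proof -
    have "(\<Sum>s\<le>n. a s * (real s * (real s + \<alpha>) * t ^ (s - 1) * (1 - t) ^ (n - s + 1)))
       = (\<Sum>s<n. a (Suc s) * (real (Suc s) * (real (Suc s) + \<alpha>) * t ^ s * (1 - t) ^ (n - Suc s + 1)))"
      by (subst lessThan_Suc_atMost[symmetric], subst sum.lessThan_Suc_shift) simp
    also have "\<dots> = (\<Sum>s<n. - (real (n - s) * (real (n - s) + \<beta>) * a s) * M s)"
    proof (intro sum.cong refl)
      fix s assume "s \<in> {..<n}"
      then have s: "s < n" by simp
      then have "n - Suc s + 1 = n - s" by simp
      then have "a (Suc s) * (real (Suc s) * (real (Suc s) + \<alpha>) * t ^ s * (1 - t) ^ (n - Suc s + 1))
        = (a (Suc s) * (real (Suc s) * (real (Suc s) + \<alpha>))) * M s"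
        unfolding M_def by simp
      then show "a (Suc s) * (real (Suc s) * (real (Suc s) + \<alpha>) * t ^ s * (1 - t) ^ (n - Suc s + 1))
         = - (real (n - s) * (real (n - s) + \<beta>) * a s) * M s"
        by (simp only: rec[OF s])
    qed
    also have "\<dots> = (\<Sum>s\<le>n. - (real (n - s) * (real (n - s) + \<beta>) * a s) * M s)"
      by (subst lessThan_Suc_atMost[symmetric]) simp
    finally show ?thesis .
  qed
  have S2: "(\<Sum>s\<le>n. a s * (real (n - s) * (real (n - s) + \<beta>) * t ^ (s + 1) * (1 - t) ^ (n - s - 1)))
      = (\<Sum>s\<le>n. - (real s * (real s + \<alpha>) * a s) * M s)"
  proof -
    have "(\<Sum>s\<le>n. - (real s * (real s + \<alpha>) * a s) * M s)
       = (\<Sum>s<n. - (real (Suc s) * (real (Suc s) + \<alpha>) * a (Suc s)) * M (Suc s))"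
      by (subst lessThan_Suc_atMost[symmetric], subst sum.lessThan_Suc_shift) simp
    also have "\<dots> = (\<Sum>s<n. a s * (real (n - s) * (real (n - s) + \<beta>) * t ^ (s + 1) * (1 - t) ^ (n - s - 1)))"
    proof (intro sum.cong refl)
      fix s assume "s \<in> {..<n}"
      then have s: "s < n" by simp
      have "- (real (Suc s) * (real (Suc s) + \<alpha>) * a (Suc s)) * M (Suc s)
        = - (a (Suc s) * (real (Suc s) * (real (Suc s) + \<alpha>))) * M (Suc s)"
        by simp
      then show "- (real (Suc s) * (real (Suc s) + \<alpha>) * a (Suc s)) * M (Suc s)
         = a s * (real (n - s) * (real (n - s) + \<beta>) * t ^ (s + 1) * (1 - t) ^ (n - s - 1))"
        unfolding rec[OF s] M_def by simp
    qed
    also have "\<dots> = (\<Sum>s\<le>n. a s * (real (n - s) * (real (n - s) + \<beta>) * t ^ (s + 1) * (1 - t) ^ (n - s - 1)))"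
      by (subst lessThan_Suc_atMost[symmetric]) simp
    finally show ?thesis by simp
  qed
  have "poly (jac_op \<alpha> \<beta> (jac_poly n \<alpha> \<beta>)) t =
     (\<Sum>s\<le>n. a s * (real s * (real s + \<alpha>) * t ^ (s - 1) * (1 - t) ^ (n - s + 1)))
     + (\<Sum>s\<le>n. a s * (real (n - s) * (real (n - s) + \<beta>) * t ^ (s + 1) * (1 - t) ^ (n - s - 1)))
     - (\<Sum>s\<le>n. a s * ((real s * (real (n - s) + \<beta> + 1) + real (n - s) * (real s + \<alpha> + 1)) * t ^ s * (1 - t) ^ (n - s)))"
    unfolding jac_poly_def jac_op_sum jac_op_smult poly_sum poly_smult poly_jac_op_monomial
      a_def[symmetric] sum.distrib[symmetric] sum_subtractf[symmetric]
    by (intro sum.cong refl) (simp only: algebra_simps)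
  also have "\<dots> = (\<Sum>s\<le>n. - (real n * (real n + \<alpha> + \<beta> + 1)) * (a s * M s))"
    unfolding S1 S2 sum.distrib[symmetric] sum_subtractf[symmetric]
  proof (intro sum.cong refl)
    fix s assume "s \<in> {..n}"
    then obtain r where r: "n = s + r" using le_Suc_ex by auto
    show "- (real (n - s) * (real (n - s) + \<beta>) * a s) * M s + - (real s * (real s + \<alpha>) * a s) * M s
       - a s * ((real s * (real (n - s) + \<beta> + 1) + real (n - s) * (real s + \<alpha> + 1)) * t ^ s * (1 - t) ^ (n - s))
       = - (real n * (real n + \<alpha> + \<beta> + 1)) * (a s * M s)"
      unfolding M_def r by (simp add: algebra_simps)
  qed
  also have "\<dots> = poly (smult (- (real n * (real n + \<alpha> + \<beta> + 1))) (jac_poly n \<alpha> \<beta>)) t"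
    unfolding jac_poly_def poly_sum poly_smult sum_distrib_left a_def M_def
    by (simp add: mult_ac)
  finally show "poly (jac_op \<alpha> \<beta> (jac_poly n \<alpha> \<beta>)) t =
     poly (smult (- (real n * (real n + \<alpha> + \<beta> + 1))) (jac_poly n \<alpha> \<beta>)) t" .
qed

text \<open>A terminating Appell \<open>F\<^sub>4\<close> series in the arguments \<open>t \<tau>\<close> and \<open>(1 - t) (1 - \<tau>)\<close>.\<close>

definition f4_coeff :: "nat \<Rightarrow> real \<Rightarrow> real \<Rightarrow> nat \<Rightarrow> nat \<Rightarrow> real" where
  "f4_coeff n \<alpha> \<beta> m k = pochhammer (- real n) (m + k) * pochhammer (real n + \<alpha> + \<beta> + 1) (m + k)
     / (pochhammer (\<alpha> + 1) m * pochhammer (\<beta> + 1) k * fact m * fact k)"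

definition f4_poly :: "nat \<Rightarrow> real \<Rightarrow> real \<Rightarrow> real \<Rightarrow> real poly" where
  "f4_poly n \<alpha> \<beta> \<tau> = (\<Sum>m\<le>n. \<Sum>k\<le>n. smult (f4_coeff n \<alpha> \<beta> m k * \<tau> ^ m * (1 - \<tau>) ^ k)
      ([:0, 1:] ^ m * [:1, -1:] ^ k))"

lemma poly_f4_poly:
  "poly (f4_poly n \<alpha> \<beta> \<tau>) t =
     (\<Sum>m\<le>n. \<Sum>k\<le>n. f4_coeff n \<alpha> \<beta> m k * (t * \<tau>) ^ m * ((1 - t) * (1 - \<tau>)) ^ k)"
  unfolding f4_poly_def poly_sum by (intro sum.cong refl) (simp add: power_mult_distrib)

lemma f4_coeff_Suc_left:
  assumes "\<alpha> > -1"
  shows "f4_coeff n \<alpha> \<beta> (Suc m) k * (real (Suc m) * (real (Suc m) + \<alpha>))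
     = f4_coeff n \<alpha> \<beta> m k * ((real (m + k) - real n) * (real (m + k) + real n + \<alpha> + \<beta> + 1))"
proof -
  have "\<alpha> + 1 + real m \<noteq> 0" using assms by linarith
  then show ?thesis unfolding f4_coeff_def
    by (simp add: pochhammer_Suc divide_simps) (simp add: algebra_simps)
qed

lemma f4_coeff_Suc_right:
  assumes "\<beta> > -1"
  shows "f4_coeff n \<alpha> \<beta> m (Suc k) * (real (Suc k) * (real (Suc k) + \<beta>))
     = f4_coeff n \<alpha> \<beta> m k * ((real (m + k) - real n) * (real (m + k) + real n + \<alpha> + \<beta> + 1))"
proof -
  have "\<beta> + 1 + real k \<noteq> 0" using assms by linarith
  then show ?thesis unfolding f4_coeff_def
    by (simp add: pochhammer_Suc divide_simps) (simp add: algebra_simps)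
qed

lemma f4_coeff_eq_0: "m + k > n \<Longrightarrow> f4_coeff n \<alpha> \<beta> m k = 0"
  unfolding f4_coeff_def by (simp add: pochhammer_of_nat_eq_0_iff)

text \<open>The coefficient recurrences in m and in k have the same right-hand side, so lowering
  either exponent yields the same sum \<open>W\<close>. These sums enter with the factors \<tau> (1
  - t) and t (1 - \<tau>), which add up to 1 - \<xi> - \<eta>; the parts - \<xi> W and - \<eta> W
  restore the exponents, and what remains is an identity for the factor of each monomial.\<close>

lemma jac_op_f4_poly:
  assumes "\<alpha> > -1" "\<beta> > -1"
  shows "jac_op \<alpha> \<beta> (f4_poly n \<alpha> \<beta> \<tau>) = smult (- (real n * (real n + \<alpha> + \<beta> + 1))) (f4_poly n \<alpha> \<beta> \<tau>)"
proof (subst poly_eq_poly_eq_iff[symmetric], rule ext)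
  fix t :: real
  define c where "c = f4_coeff n \<alpha> \<beta>"
  define \<xi> where "\<xi> = t * \<tau>"
  define \<eta> where "\<eta> = (1 - t) * (1 - \<tau>)"
  define E where "E N = (real N - real n) * (real N + real n + \<alpha> + \<beta> + 1)" for N :: nat
  define W where "W = (\<Sum>m\<le>n. \<Sum>k\<le>n. c m k * E (m + k) * \<xi> ^ m * \<eta> ^ k)"
  \<comment> \<open>The coefficients vanish for m + k > n and \<open>E\<close> vanishes at m + k =
    n, so shifting an index leaves no boundary term at n.\<close>
  have top: "c m k * E (m + k) = 0" if "m + k \<ge> n" for m k
    using that f4_coeff_eq_0[of n m k \<alpha> \<beta>] by (cases "m + k = n") (auto simp: c_def E_def)
  have shift: "(\<Sum>i\<le>n. g i) = (\<Sum>i\<le>n. h i)"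
    if "g 0 = 0" "h n = 0" "\<And>i. i < n \<Longrightarrow> g (Suc i) = h i" for g h :: "nat \<Rightarrow> real"
  proof -
    have "(\<Sum>i\<le>n. g i) = (\<Sum>i<n. g (Suc i))"
      by (subst lessThan_Suc_atMost[symmetric], subst sum.lessThan_Suc_shift) (simp add: that)
    also have "\<dots> = (\<Sum>i<n. h i)" by (intro sum.cong) (auto simp: that)
    also have "\<dots> = (\<Sum>i\<le>n. h i)"
      by (subst lessThan_Suc_atMost[symmetric]) (simp add: that)
    finally show ?thesis .
  qed
  have A1: "(\<Sum>m\<le>n. \<Sum>k\<le>n. c m k * (real m * (real m + \<alpha>)) * \<xi> ^ (m - 1) * \<eta> ^ k) = W"
    unfolding W_def
  proof (rule shift)
    show "(\<Sum>k\<le>n. c n k * E (n + k) * \<xi> ^ n * \<eta> ^ k) = 0"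
      by (simp add: top)
    show "(\<Sum>k\<le>n. c (Suc i) k * (real (Suc i) * (real (Suc i) + \<alpha>)) * \<xi> ^ (Suc i - 1) * \<eta> ^ k)
        = (\<Sum>k\<le>n. c i k * E (i + k) * \<xi> ^ i * \<eta> ^ k)" for i
      unfolding c_def E_def f4_coeff_Suc_left[OF assms(1)] by simp
  qed simp
  have A2: "(\<Sum>m\<le>n. \<Sum>k\<le>n. c m k * (real k * (real k + \<beta>)) * \<xi> ^ m * \<eta> ^ (k - 1)) = W"
    unfolding W_def
  proof (rule sum.cong[OF refl], rule shift)
    show "c m n * E (m + n) * \<xi> ^ m * \<eta> ^ n = 0" for m
      by (simp add: top)
    show "c m (Suc i) * (real (Suc i) * (real (Suc i) + \<beta>)) * \<xi> ^ m * \<eta> ^ (Suc i - 1)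
        = c m i * E (m + i) * \<xi> ^ m * \<eta> ^ i" for i m
      unfolding c_def E_def f4_coeff_Suc_right[OF assms(2)] by simp
  qed simp
  have "poly (jac_op \<alpha> \<beta> (f4_poly n \<alpha> \<beta> \<tau>)) t =
      (\<Sum>m\<le>n. \<Sum>k\<le>n. (\<tau> * (1 - t)) * (c m k * (real m * (real m + \<alpha>)) * \<xi> ^ (m - 1) * \<eta> ^ k)
       + (t * (1 - \<tau>)) * (c m k * (real k * (real k + \<beta>)) * \<xi> ^ m * \<eta> ^ (k - 1))
       - (real m * (real k + \<beta> + 1) + real k * (real m + \<alpha> + 1)) * (c m k * \<xi> ^ m * \<eta> ^ k))"
    unfolding f4_poly_def jac_op_sum jac_op_smult poly_sum poly_smult poly_jac_op_monomial c_def[symmetric]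
  proof (intro sum.cong refl)
    fix m k :: nat
    have 1: "real m * (\<tau> ^ m * t ^ (m - 1) * (1 - t) ^ (k + 1) * (1 - \<tau>) ^ k)
        = real m * (\<tau> * (1 - t) * \<xi> ^ (m - 1) * \<eta> ^ k)"
      by (cases m) (simp_all add: \<xi>_def \<eta>_def power_mult_distrib)
    have 2: "real k * (\<tau> ^ m * t ^ (m + 1) * (1 - t) ^ (k - 1) * (1 - \<tau>) ^ k)
        = real k * (t * (1 - \<tau>) * \<xi> ^ m * \<eta> ^ (k - 1))"
      by (cases k) (simp_all add: \<xi>_def \<eta>_def power_mult_distrib)
    have "c m k * \<tau> ^ m * (1 - \<tau>) ^ k *
       (real m * (real m + \<alpha>) * t ^ (m - 1) * (1 - t) ^ (k + 1) + real k * (real k + \<beta>) * t ^ (m + 1) * (1 - t) ^ (k - 1)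
        - (real m * (real k + \<beta> + 1) + real k * (real m + \<alpha> + 1)) * t ^ m * (1 - t) ^ k)
      = c m k * (real m + \<alpha>) * (real m * (\<tau> ^ m * t ^ (m - 1) * (1 - t) ^ (k + 1) * (1 - \<tau>) ^ k))
       + c m k * (real k + \<beta>) * (real k * (\<tau> ^ m * t ^ (m + 1) * (1 - t) ^ (k - 1) * (1 - \<tau>) ^ k))
       - (real m * (real k + \<beta> + 1) + real k * (real m + \<alpha> + 1)) * (c m k * \<xi> ^ m * \<eta> ^ k)"
      by (simp add: \<xi>_def \<eta>_def power_mult_distrib) (simp only: algebra_simps)
    then show "c m k * \<tau> ^ m * (1 - \<tau>) ^ k *
       (real m * (real m + \<alpha>) * t ^ (m - 1) * (1 - t) ^ (k + 1) + real k * (real k + \<beta>) * t ^ (m + 1) * (1 - t) ^ (k - 1)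
        - (real m * (real k + \<beta> + 1) + real k * (real m + \<alpha> + 1)) * t ^ m * (1 - t) ^ k)
      = (\<tau> * (1 - t)) * (c m k * (real m * (real m + \<alpha>)) * \<xi> ^ (m - 1) * \<eta> ^ k)
       + (t * (1 - \<tau>)) * (c m k * (real k * (real k + \<beta>)) * \<xi> ^ m * \<eta> ^ (k - 1))
       - (real m * (real k + \<beta> + 1) + real k * (real m + \<alpha> + 1)) * (c m k * \<xi> ^ m * \<eta> ^ k)"
      unfolding 1 2 by (simp only: algebra_simps)
  qed
  also have "\<dots> = (\<tau> * (1 - t)) * W + (t * (1 - \<tau>)) * W
      - (\<Sum>m\<le>n. \<Sum>k\<le>n. (real m * (real k + \<beta> + 1) + real k * (real m + \<alpha> + 1)) * (c m k * \<xi> ^ m * \<eta> ^ k))"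
    unfolding sum.distrib sum_subtractf
    apply (subst A1[symmetric])
    apply (subst A2[symmetric])
    by (simp only: sum_distrib_left)
  also have "(\<tau> * (1 - t)) * W + (t * (1 - \<tau>)) * W = W - \<xi> * W - \<eta> * W"
    by (simp add: \<xi>_def \<eta>_def algebra_simps)
  also have "\<xi> * W = (\<Sum>m\<le>n. \<Sum>k\<le>n. c m k * (real m * (real m + \<alpha>)) * \<xi> ^ m * \<eta> ^ k)"
    unfolding A1[symmetric] sum_distrib_left
  proof (intro sum.cong refl)
    fix m k
    show "\<xi> * (c m k * (real m * (real m + \<alpha>)) * \<xi> ^ (m - 1) * \<eta> ^ k)
       = c m k * (real m * (real m + \<alpha>)) * \<xi> ^ m * \<eta> ^ k"
      by (cases m) simp_all
  qed
  also have "\<eta> * W = (\<Sum>m\<le>n. \<Sum>k\<le>n. c m k * (real k * (real k + \<beta>)) * \<xi> ^ m * \<eta> ^ k)"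
    unfolding A2[symmetric] sum_distrib_left
  proof (intro sum.cong refl)
    fix m k
    show "\<eta> * (c m k * (real k * (real k + \<beta>)) * \<xi> ^ m * \<eta> ^ (k - 1))
       = c m k * (real k * (real k + \<beta>)) * \<xi> ^ m * \<eta> ^ k"
      by (cases k) simp_all
  qed
  also have "W - (\<Sum>m\<le>n. \<Sum>k\<le>n. c m k * (real m * (real m + \<alpha>)) * \<xi> ^ m * \<eta> ^ k)
      - (\<Sum>m\<le>n. \<Sum>k\<le>n. c m k * (real k * (real k + \<beta>)) * \<xi> ^ m * \<eta> ^ k)
      - (\<Sum>m\<le>n. \<Sum>k\<le>n. (real m * (real k + \<beta> + 1) + real k * (real m + \<alpha> + 1)) * (c m k * \<xi> ^ m * \<eta> ^ k))
     = (\<Sum>m\<le>n. \<Sum>k\<le>n. - (real n * (real n + \<alpha> + \<beta> + 1)) * (c m k * \<xi> ^ m * \<eta> ^ k))"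
    unfolding W_def sum_subtractf[symmetric] E_def
    by (intro sum.cong refl) (simp add: algebra_simps)
  also have "\<dots> = poly (smult (- (real n * (real n + \<alpha> + \<beta> + 1))) (f4_poly n \<alpha> \<beta> \<tau>)) t"
    unfolding poly_smult poly_f4_poly c_def \<xi>_def \<eta>_def by (simp add: sum_distrib_left mult_ac)
  finally show "poly (jac_op \<alpha> \<beta> (f4_poly n \<alpha> \<beta> \<tau>)) t = \<dots>" .
qed

lemma poly_jac_poly_0: "poly (jac_poly n \<alpha> \<beta>) 0 = (real n + \<alpha>) gchoose n"
proof -
  have "poly (jac_poly n \<alpha> \<beta>) 0 = (\<Sum>s\<le>n. if s = 0 then (real n + \<alpha>) gchoose n else 0)"
    unfolding jac_poly_def poly_sum by (intro sum.cong refl) (auto simp: power_0_left)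
  then show ?thesis by simp
qed

lemma poly_jac_poly_1: "poly (jac_poly n \<alpha> \<beta>) 1 = (-1) ^ n * ((real n + \<beta>) gchoose n)"
proof -
  have "poly (jac_poly n \<alpha> \<beta>) 1 = (\<Sum>s\<le>n. if s = n then (-1) ^ n * ((real n + \<beta>) gchoose n) else 0)"
    unfolding jac_poly_def poly_sum by (intro sum.cong refl) (auto simp: power_0_left)
  then show ?thesis by simp
qed

lemma gbinomial_shift_pos:
  assumes "a > -1"
  shows "(real n + a) gchoose n > 0"
proof -
  have "(real n + a) gchoose n = pochhammer (a + 1) n / fact n"
    by (simp add: gbinomial_pochhammer' add.commute)
  then show ?thesis using assms by (simp add: pochhammer_pos)
qed

text \<open>Bailey's product formula: as functions of \<open>t\<close> both sides are eigenfunctions of the Jacobi operator, and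
  the right-hand side is symmetric in \<open>t\<close> and \<open>\<tau>\<close>.\<close>

lemma jacobi_product_formula:
  assumes "\<alpha> > -1" "\<beta> > -1"
  shows "poly (jac_poly n \<alpha> \<beta>) t * poly (jac_poly n \<alpha> \<beta>) \<tau> =
    ((real n + \<alpha>) gchoose n) * ((-1) ^ n * ((real n + \<beta>) gchoose n)) * poly (f4_poly n \<alpha> \<beta> \<tau>) t"
proof -
  define P where "P = jac_poly n \<alpha> \<beta>"
  define g where "g \<tau> = poly (f4_poly n \<alpha> \<beta> \<tau>) 0" for \<tau>
  define p0 where "p0 = (real n + \<alpha>) gchoose n"
  have p0: "p0 > 0" unfolding p0_def by (rule gbinomial_shift_pos) fact
  have sym: "poly (f4_poly n \<alpha> \<beta> \<tau>) t = poly (f4_poly n \<alpha> \<beta> t) \<tau>" for t \<tau>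
    unfolding poly_f4_poly by (simp add: mult.commute)
  \<comment> \<open>In t both \<open>f4_poly\<close> and \<open>P\<close> are eigenfunctions with
    the same eigenvalue; cross-multiplying by their values at 0 makes them agree there.\<close>
  have F: "p0 * poly (f4_poly n \<alpha> \<beta> \<tau>) t = g \<tau> * poly P t" for t \<tau>
  proof -
    have "smult p0 (f4_poly n \<alpha> \<beta> \<tau>) = smult (g \<tau>) P"
      by (rule jac_op_eigen_unique[OF assms(1), where \<beta> = \<beta> and c = "- (real n * (real n + \<alpha> + \<beta> + 1))"])
         (simp_all add: jac_op_smult jac_op_f4_poly[OF assms] jac_op_jac_poly P_def
           poly_jac_poly_0 g_def p0_def smult_smult mult.commute)
    then show ?thesis by (metis poly_smult)
  qed
  \<comment> \<open>At t = 0, \<tau> = 1 both arguments of the series vanish and only its constant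
    term is left.\<close>
  have g1: "g 1 = 1"
  proof -
    have "g 1 = (\<Sum>m\<le>n. \<Sum>k\<le>n. if m = 0 \<and> k = 0 then 1 else 0)"
      unfolding g_def poly_f4_poly
      by (intro sum.cong refl) (auto simp: power_0_left f4_coeff_def)
    also have "\<dots> = (\<Sum>m\<le>n. if m = 0 then 1 else 0)"
      by (intro sum.cong refl) auto
    also have "\<dots> = 1" by simp
    finally show ?thesis .
  qed
  \<comment> \<open>The unknown factor \<open>g\<close> is found from \<open>F\<close> at (\<tau>,
    1) and at (1, \<tau>), which symmetry equates.\<close>
  have "g \<tau> * poly P 1 = poly P \<tau>" for \<tau>
    using F[of \<tau> 1] F[of 1 \<tau>] sym[of 1 \<tau>] g1 by simp
  then have "poly P t * poly P \<tau> = poly P 1 * (p0 * poly (f4_poly n \<alpha> \<beta> \<tau>) t)"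
    unfolding F by (metis mult.commute mult.left_commute)
  then show ?thesis unfolding P_def p0_def poly_jac_poly_1 by (simp add: mult_ac)
qed

text \<open>Sonin's method: \<open>P\<^sup>2 + t (1 - t) P'\<^sup>2 / (n (n + \<alpha> + \<beta> + 1))\<close> first decreases and then
  increases on \<open>[0, 1]\<close>.\<close>

lemma abs_jac_poly_le:
  assumes "\<alpha> > -1/2" "\<beta> > -1/2" and t: "0 \<le> t" "t \<le> 1"
  shows "\<bar>poly (jac_poly n \<alpha> \<beta>) t\<bar> \<le> max ((real n + \<alpha>) gchoose n) ((real n + \<beta>) gchoose n)"
proof (cases "n = 0")
  case True
  then show ?thesis by (simp add: jac_poly_def)
next
  case False
  define P where "P = jac_poly n \<alpha> \<beta>"
  define L where "L = \<alpha> + \<beta> + 1"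
  define \<kappa> where "\<kappa> = real n * (real n + L)"
  have L: "L > 0" unfolding L_def using assms by simp
  have \<kappa>: "\<kappa> > 0" unfolding \<kappa>_def using False L by simp
  define S where "S x = (poly P x)\<^sup>2 + x * (1 - x) * (poly (pderiv P) x)\<^sup>2 / \<kappa>" for x
  have ode: "x * (1 - x) * poly (pderiv (pderiv P)) x = - (\<alpha> + 1 - (L + 1) * x) * poly (pderiv P) x - \<kappa> * poly P x" for x
  proof -
    have "poly (jac_op \<alpha> \<beta> P) x = poly (smult (- \<kappa>) P) x"
      unfolding P_def jac_op_jac_poly \<kappa>_def L_def by (simp add: add.assoc)
    then show ?thesis by (simp add: jac_op_def L_def algebra_simps)
  qed
  have deriv: "(S has_real_derivative (poly (pderiv P) x)\<^sup>2 / \<kappa> * (2 * L * x - (2 * \<alpha> + 1))) (at x)" for x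
  proof -
    have "(S has_real_derivative 2 * poly P x * poly (pderiv P) x + ((1 - 2 * x) * (poly (pderiv P) x)\<^sup>2
        + 2 * poly (pderiv P) x * (x * (1 - x) * poly (pderiv (pderiv P)) x)) / \<kappa>) (at x)"
      unfolding S_def using \<kappa>
      by (auto intro!: derivative_eq_intros simp: algebra_simps power2_eq_square add_divide_distrib diff_divide_distrib)
    also have "2 * poly P x * poly (pderiv P) x + ((1 - 2 * x) * (poly (pderiv P) x)\<^sup>2
        + 2 * poly (pderiv P) x * (x * (1 - x) * poly (pderiv (pderiv P)) x)) / \<kappa>
        = (poly (pderiv P) x)\<^sup>2 / \<kappa> * (2 * L * x - (2 * \<alpha> + 1))"
      unfolding ode using \<kappa> by (simp add: field_simps power2_eq_square)
    finally show ?thesis .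
  qed
  \<comment> \<open>The derivative of \<open>S\<close> is a nonnegative factor times x - x0, so the
    value at t is dominated by the value at the endpoint on its side of x0.\<close>
  define x0 where "x0 = (2 * \<alpha> + 1) / (2 * L)"
  have sgn: "2 * L * x - (2 * \<alpha> + 1) = 2 * L * (x - x0)" for x
    unfolding x0_def using L by (simp add: field_simps)
  have end0: "S 0 = ((real n + \<alpha>) gchoose n)\<^sup>2" unfolding S_def P_def by (simp add: poly_jac_poly_0)
  have end1: "S 1 = ((real n + \<beta>) gchoose n)\<^sup>2" unfolding S_def P_def
    by (simp add: poly_jac_poly_1 power_mult_distrib power_mult[symmetric])
  have pos: "(real n + \<alpha>) gchoose n > 0" "(real n + \<beta>) gchoose n > 0"
    using gbinomial_shift_pos assms by auto
  have "S t \<le> S 0 \<or> S t \<le> S 1"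
  proof (cases "t \<le> x0")
    case True
    have "S 0 \<ge> S t"
    proof (rule DERIV_nonpos_imp_nonincreasing[OF t(1)])
      fix x assume x: "0 \<le> x" "x \<le> t"
      show "\<exists>y. (S has_real_derivative y) (at x) \<and> y \<le> 0"
        by (intro exI conjI, rule deriv, unfold sgn)
           (use x True \<kappa> L in \<open>intro mult_nonneg_nonpos; simp add: mult_nonneg_nonpos\<close>)
    qed
    then show ?thesis by simp
  next
    case False
    have "S t \<le> S 1"
    proof (rule DERIV_nonneg_imp_nondecreasing[OF t(2)])
      fix x assume x: "t \<le> x" "x \<le> 1"
      show "\<exists>y. (S has_real_derivative y) (at x) \<and> y \<ge> 0"
        by (intro exI conjI, rule deriv, unfold sgn)
           (use x False \<kappa> L in \<open>intro mult_nonneg_nonneg; simp\<close>)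
    qed
    then show ?thesis by simp
  qed
  moreover have "(poly P t)\<^sup>2 \<le> S t" unfolding S_def using t \<kappa> by simp
  ultimately have "(poly P t)\<^sup>2 \<le> ((real n + \<alpha>) gchoose n)\<^sup>2 \<or> (poly P t)\<^sup>2 \<le> ((real n + \<beta>) gchoose n)\<^sup>2"
    unfolding end0 end1 by linarith
  then show ?thesis using pos unfolding P_def
    by (metis abs_le_square_iff abs_of_pos le_max_iff_disj)
qed

subsection \<open>The generating function of products of Jacobi functions\<close>

definition bes_coeff :: "real \<Rightarrow> nat \<Rightarrow> real" where
  "bes_coeff \<nu> m = 1 / (fact m * Gamma (\<nu> + real m + 1))"

text \<open>The part of total degree N in the product of two Bessel series, with arguments \<xi> and
  \<eta>. The terms of the Appell series with m + k = N combine to the same sum.\<close>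

definition bes_conv :: "real \<Rightarrow> real \<Rightarrow> real \<Rightarrow> real \<Rightarrow> nat \<Rightarrow> real" where
  "bes_conv \<alpha> \<beta> \<xi> \<eta> N = (\<Sum>m\<le>N. bes_coeff \<alpha> m * \<xi> ^ m * (bes_coeff \<beta> (N - m) * \<eta> ^ (N - m)))"

lemma bes_coeff_pos: "\<nu> > -1 \<Longrightarrow> bes_coeff \<nu> m > 0"
  unfolding bes_coeff_def by (simp add: Gamma_real_pos)

lemma gbinomial_shift_Gamma:
  assumes "a > -1"
  shows "(real n + a) gchoose n = Gamma (a + 1 + real n) / (Gamma (a + 1) * fact n)"
proof -
  have "a + 1 \<notin> \<int>\<^sub>\<le>\<^sub>0" using assms by (auto elim!: nonpos_Ints_cases)
  then show ?thesis
    by (simp add: gbinomial_pochhammer' add.commute pochhammer_Gamma)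
qed

lemma Gamma_plus1_pos: "(z::real) > 0 \<Longrightarrow> Gamma (z + 1) = z * Gamma z"
  by (rule Gamma_plus1) (auto elim!: nonpos_Ints_cases)

lemma pochhammer_Gamma_real: "(z::real) > 0 \<Longrightarrow> pochhammer z n = Gamma (z + real n) / Gamma z"
proof -
  assume z: "z > 0"
  then have "z \<notin> \<int>\<^sub>\<le>\<^sub>0" by (auto elim!: nonpos_Ints_cases)
  then show ?thesis using pochhammer_Gamma[of z n] Gamma_real_pos[OF z] by simp
qed

text \<open>The constant in front of Bailey's formula for the normalized functions. The Gamma values
  at n + \<alpha> + 1 and n + \<beta> + 1 of the normalization cancel against those of the endpoint
  values, so that n enters the result only through \<alpha> + \<beta>.\<close>

lemma jacobi_d_square_gbinomial:
  assumes "\<alpha> > -1/2" "\<beta> > -1/2"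
  shows "(jacobi_d n \<alpha> \<beta>)\<^sup>2 * (((real n + \<alpha>) gchoose n) * ((real n + \<beta>) gchoose n)) =
    (2 * real n + \<alpha> + \<beta> + 1) * Gamma (real n + \<alpha> + \<beta> + 1) / (fact n * Gamma (\<alpha> + 1) * Gamma (\<beta> + 1))"
proof -
  have g: "Gamma (real n + \<alpha> + 1) > 0" "Gamma (real n + \<beta> + 1) > 0" "Gamma (real n + \<alpha> + \<beta> + 1) > 0"
    "Gamma (\<alpha> + 1) > 0" "Gamma (\<beta> + 1) > 0" "2 * real n + \<alpha> + \<beta> + 1 > 0"
    using assms by (auto intro!: Gamma_real_pos simp: add.assoc)
  have f: "Gamma (real n + 1) = fact n" using Gamma_fact[of n, where 'a = real] by (simp add: add.commute)
  have d: "(jacobi_d n \<alpha> \<beta>)\<^sup>2 = (2 * real n + \<alpha> + \<beta> + 1) * fact n * Gamma (real n + \<alpha> + \<beta> + 1)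
           / (Gamma (real n + \<alpha> + 1) * Gamma (real n + \<beta> + 1))"
    unfolding jacobi_d_def f using g by (intro real_sqrt_pow2 divide_nonneg_nonneg mult_nonneg_nonneg) auto
  have e: "\<alpha> + 1 + real n = real n + \<alpha> + 1" "\<beta> + 1 + real n = real n + \<beta> + 1" by simp_all
  have a: "\<alpha> > -1" "\<beta> > -1" using assms by simp_all
  have *: "s * f * G / (A * B) * (A / (a * f) * (B / (b * f))) = s * G / (f * a * b)"
    if "f \<noteq> 0" "A \<noteq> 0" "B \<noteq> 0" "a \<noteq> 0" "b \<noteq> 0" for s f G A B a b :: real
    using that by (simp add: divide_simps)
  show ?thesis
    unfolding d gbinomial_shift_Gamma[OF a(1)] gbinomial_shift_Gamma[OF a(2)] e
    by (rule *) (use g in auto)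
qed

lemma jacobi_fun_jac_poly:
  "jacobi_fun n \<alpha> \<beta> \<theta> = jacobi_d n \<alpha> \<beta> * poly (jac_poly n \<alpha> \<beta>) ((sin (\<theta> / 2))\<^sup>2)"
proof -
  have "cos \<theta> = 1 - 2 * (sin (\<theta> / 2))\<^sup>2" using cos_double_sin[of "\<theta> / 2"] by simp
  then show ?thesis unfolding jacobi_fun_def poly_jac_poly by simp
qed

text \<open>The coefficient of r^n in the generating function, ordered by the total degree N in
  \<xi> and \<eta>. The factor beside \<open>bes_conv\<close> is, up to a Gamma value depending on
  N, a coefficient of (1 - r) r^N (1 + r) powr (- q).\<close>

definition poisson_coeff :: "real \<Rightarrow> real \<Rightarrow> real \<Rightarrow> real \<Rightarrow> nat \<Rightarrow> real" where
  "poisson_coeff \<alpha> \<beta> \<xi> \<eta> n = (\<Sum>N\<le>n. bes_conv \<alpha> \<beta> \<xi> \<eta> N *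
     ((-1) ^ (n - N) * (2 * real n + \<alpha> + \<beta> + 1) * Gamma (real n + real N + \<alpha> + \<beta> + 1) / fact (n - N)))"

text \<open>Bailey's formula regrouped along m + k = N. The Pochhammer symbols in \<alpha> + 1 and
  \<beta> + 1 merge with the normalization into the Bessel coefficients, and those in - n and n +
  \<alpha> + \<beta> + 1 depend on N only.\<close>

lemma jacobi_fun_product:
  assumes "\<alpha> > -1/2" "\<beta> > -1/2"
  shows "jacobi_fun n \<alpha> \<beta> \<theta> * jacobi_fun n \<alpha> \<beta> \<phi> =
     poisson_coeff \<alpha> \<beta> ((sin (\<theta> / 2) * sin (\<phi> / 2))\<^sup>2) ((cos (\<theta> / 2) * cos (\<phi> / 2))\<^sup>2) n"
proof -
  define t \<tau> where "t = (sin (\<theta> / 2))\<^sup>2" and "\<tau> = (sin (\<phi> / 2))\<^sup>2"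
  define \<xi> \<eta> where "\<xi> = t * \<tau>" and "\<eta> = (1 - t) * (1 - \<tau>)"
  define L where "L = \<alpha> + \<beta> + 1"
  have L: "L > 0" unfolding L_def using assms by simp
  have c: "1 - t = (cos (\<theta> / 2))\<^sup>2" "1 - \<tau> = (cos (\<phi> / 2))\<^sup>2"
    by (simp_all add: t_def \<tau>_def cos_squared_eq)
  have \<xi>\<eta>: "(sin (\<theta> / 2) * sin (\<phi> / 2))\<^sup>2 = \<xi>" "(cos (\<theta> / 2) * cos (\<phi> / 2))\<^sup>2 = \<eta>"
    unfolding \<xi>_def \<eta>_def c by (simp_all add: t_def \<tau>_def power_mult_distrib)
  define K where "K = (2 * real n + L) * Gamma (real n + L) / (fact n * Gamma (\<alpha> + 1) * Gamma (\<beta> + 1))"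
  have "jacobi_fun n \<alpha> \<beta> \<theta> * jacobi_fun n \<alpha> \<beta> \<phi> =
     (jacobi_d n \<alpha> \<beta>)\<^sup>2 * (poly (jac_poly n \<alpha> \<beta>) t * poly (jac_poly n \<alpha> \<beta>) \<tau>)"
    by (simp add: jacobi_fun_jac_poly t_def \<tau>_def power2_eq_square)
  also have "\<dots> = (jacobi_d n \<alpha> \<beta>)\<^sup>2 * (((real n + \<alpha>) gchoose n) * ((real n + \<beta>) gchoose n)) * ((-1) ^ n * poly (f4_poly n \<alpha> \<beta> \<tau>) t)"
    using assms by (subst jacobi_product_formula) (simp_all add: mult_ac)
  also have "\<dots> = K * ((-1) ^ n * poly (f4_poly n \<alpha> \<beta> \<tau>) t)"
    unfolding jacobi_d_square_gbinomial[OF assms] K_def L_def by (simp add: add.assoc)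
  also have "poly (f4_poly n \<alpha> \<beta> \<tau>) t = (\<Sum>N\<le>n. \<Sum>m\<le>N. f4_coeff n \<alpha> \<beta> m (N - m) * \<xi> ^ m * \<eta> ^ (N - m))"
  proof -
    have "poly (f4_poly n \<alpha> \<beta> \<tau>) t = (\<Sum>(m,k)\<in>{..n} \<times> {..n}. f4_coeff n \<alpha> \<beta> m k * \<xi> ^ m * \<eta> ^ k)"
      unfolding poly_f4_poly \<xi>_def \<eta>_def by (rule sum.cartesian_product)
    \<comment> \<open>Outside the triangle the coefficients vanish, which makes the summation along
      m + k = N possible.\<close>
    also have "\<dots> = (\<Sum>(m,k)\<in>{(m,k). m + k \<le> n}. f4_coeff n \<alpha> \<beta> m k * \<xi> ^ m * \<eta> ^ k)"
      by (rule sum.mono_neutral_right) (auto simp: not_le intro!: f4_coeff_eq_0 intro: ccontr)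
    finally show ?thesis by (simp add: sum.triangle_reindex_eq)
  qed
  also have "K * ((-1) ^ n * (\<Sum>N\<le>n. \<Sum>m\<le>N. f4_coeff n \<alpha> \<beta> m (N - m) * \<xi> ^ m * \<eta> ^ (N - m)))
     = (\<Sum>N\<le>n. \<Sum>m\<le>N. K * (-1) ^ n * f4_coeff n \<alpha> \<beta> m (N - m) * (\<xi> ^ m * \<eta> ^ (N - m)))"
    by (simp add: sum_distrib_left mult_ac)
  also have "\<dots> = (\<Sum>N\<le>n. \<Sum>m\<le>N. bes_coeff \<alpha> m * \<xi> ^ m * (bes_coeff \<beta> (N - m) * \<eta> ^ (N - m)) *
     ((-1) ^ (n - N) * (2 * real n + L) * Gamma (real n + real N + L) / fact (n - N)))"
  proof (intro sum.cong refl)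
    fix N m assume "N \<in> {..n}" "m \<in> {..N}"
    then obtain k l where N: "N = m + k" and n: "n = N + l"
      by (metis atMost_iff le_Suc_ex)
    have g: "Gamma (\<alpha> + 1) > 0" "Gamma (\<beta> + 1) > 0" "Gamma (\<alpha> + real m + 1) > 0" "Gamma (\<beta> + real k + 1) > 0"
      "Gamma (real n + L) > 0"
      using assms L by (auto intro!: Gamma_real_pos)
    have p: "pochhammer (\<alpha> + 1) m = Gamma (\<alpha> + real m + 1) / Gamma (\<alpha> + 1)"
      "pochhammer (\<beta> + 1) k = Gamma (\<beta> + real k + 1) / Gamma (\<beta> + 1)"
      "pochhammer (real n + L) N = Gamma (real n + real N + L) / Gamma (real n + L)"
      using pochhammer_Gamma_real[of "\<alpha> + 1" m] pochhammer_Gamma_real[of "\<beta> + 1" k]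
        pochhammer_Gamma_real[of "real n + L" N] assms L by (simp_all add: add_ac)
    have q: "pochhammer (- real n) N = (-1) ^ N * fact n / fact l"
    proof -
      have "real (n choose N) = (-1) ^ N * pochhammer (- real n) N / fact N"
        by (simp add: binomial_gbinomial gbinomial_pochhammer)
      moreover have "real (n choose N) = fact n / (fact N * fact l)"
        using binomial_fact[of N n, where 'a = real] n by simp
      ultimately have "(-1) ^ N * ((-1) ^ N * pochhammer (- real n) N) = (-1) ^ N * (fact n / fact l)"
        by (simp add: field_simps)
      then show ?thesis by (simp add: mult.assoc[symmetric] power_mult_distrib[symmetric])
    qed
    have s: "(-1::real) ^ n * (-1) ^ N = (-1) ^ l"
      unfolding n by (simp add: power_add power_mult_distrib[symmetric])
    have "K * (-1) ^ n * f4_coeff n \<alpha> \<beta> m (N - m) = K * ((-1) ^ n * (-1) ^ N) * (fact n / fact l)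
       * pochhammer (real n + L) N / (pochhammer (\<alpha> + 1) m * pochhammer (\<beta> + 1) k * fact m * fact k)"
      unfolding f4_coeff_def using q unfolding N by (simp add: L_def add_ac)
    also have "\<dots> = bes_coeff \<alpha> m * bes_coeff \<beta> k * ((-1) ^ l * (2 * real n + L) * Gamma (real n + real N + L) / fact l)"
      unfolding s p K_def bes_coeff_def using g by (simp add: field_simps)
    finally show "K * (-1) ^ n * f4_coeff n \<alpha> \<beta> m (N - m) * (\<xi> ^ m * \<eta> ^ (N - m)) =
       bes_coeff \<alpha> m * \<xi> ^ m * (bes_coeff \<beta> (N - m) * \<eta> ^ (N - m)) *
     ((-1) ^ (n - N) * (2 * real n + L) * Gamma (real n + real N + L) / fact (n - N))"
      unfolding N n by (simp add: mult_ac)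
  qed
  also have "\<dots> = poisson_coeff \<alpha> \<beta> \<xi> \<eta> n"
    unfolding poisson_coeff_def bes_conv_def sum_distrib_right L_def by (simp add: add_ac)
  finally show ?thesis unfolding \<xi>\<eta> .
qed

text \<open>Up to the constant, the majorant has the coefficients of cosh (2 sqrt w), which is the
  case \<nu> = -1/2. The ratio of consecutive coefficients is 1 / ((m + 1) (\<nu> + m + 1)) and
  decreases in \<nu>.\<close>

lemma bes_coeff_le:
  assumes "\<nu> > -1/2"
  shows "bes_coeff \<nu> m \<le> 4 ^ m / (fact (2 * m) * Gamma (\<nu> + 1))"
proof (induction m)
  case 0
  then show ?case by (simp add: bes_coeff_def)
next
  case (Suc m)
  have pos: "\<nu> + real m + 1 > 0" using assms by simp
  have G: "Gamma (\<nu> + real (Suc m) + 1) = (\<nu> + real m + 1) * Gamma (\<nu> + real m + 1)"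
    using Gamma_plus1_pos[OF pos] by (simp add: add_ac)
  have g: "Gamma (\<nu> + 1) > 0" using assms by (simp add: Gamma_real_pos)
  have "bes_coeff \<nu> (Suc m) = bes_coeff \<nu> m * (1 / ((real m + 1) * (\<nu> + real m + 1)))"
    unfolding bes_coeff_def G by (simp add: add_ac)
  also have "\<dots> \<le> (4 ^ m / (fact (2 * m) * Gamma (\<nu> + 1))) * (1 / ((real m + 1) * (real m + 1/2)))"
    using assms g by (intro mult_mono Suc divide_left_mono mult_left_mono mult_pos_pos divide_nonneg_nonneg) auto
  also have "\<dots> = 4 ^ Suc m / (fact (2 * Suc m) * Gamma (\<nu> + 1))"
    using g by (simp add: divide_simps) (simp add: algebra_simps)
  finally show ?case .
qed

lemma bes_conv_nonneg:
  assumes "\<alpha> > -1" "\<beta> > -1" "0 \<le> \<xi>" "0 \<le> \<eta>"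
  shows "bes_conv \<alpha> \<beta> \<xi> \<eta> N \<ge> 0"
  unfolding bes_conv_def using assms bes_coeff_pos[of \<alpha>] bes_coeff_pos[of \<beta>]
  by (intro sum_nonneg mult_nonneg_nonneg) (auto intro: less_imp_le)

text \<open>With the cosh majorants the convolution consists of the terms with even exponents in the
  binomial expansion of (X + Y)^(2 N), and for X, Y \<ge> 0 these are at most the whole
  expansion.\<close>

lemma bes_conv_le:
  assumes "\<alpha> > -1/2" "\<beta> > -1/2" "0 \<le> X" "0 \<le> Y"
  shows "bes_conv \<alpha> \<beta> (X\<^sup>2) (Y\<^sup>2) N
    \<le> (4 * (X + Y)\<^sup>2) ^ N / fact (2 * N) / (Gamma (\<alpha> + 1) * Gamma (\<beta> + 1))"
proof -
  have g: "Gamma (\<alpha> + 1) > 0" "Gamma (\<beta> + 1) > 0" using assms by (auto simp: Gamma_real_pos)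
  define K where "K = Gamma (\<alpha> + 1) * Gamma (\<beta> + 1)"
  have "bes_conv \<alpha> \<beta> (X\<^sup>2) (Y\<^sup>2) N \<le> (\<Sum>m\<le>N. (4 ^ m / (fact (2 * m) * Gamma (\<alpha> + 1))) * (X\<^sup>2) ^ m
     * ((4 ^ (N - m) / (fact (2 * (N - m)) * Gamma (\<beta> + 1))) * (Y\<^sup>2) ^ (N - m)))"
    unfolding bes_conv_def using assms g bes_coeff_pos[of \<alpha>] bes_coeff_pos[of \<beta>]
    by (intro sum_mono mult_mono bes_coeff_le mult_nonneg_nonneg) (auto intro: less_imp_le)
  also have "\<dots> = (4 ^ N / fact (2 * N) / K) * (\<Sum>m\<le>N. real (2 * N choose (2 * m)) * X ^ (2 * m) * Y ^ (2 * N - 2 * m))"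
    unfolding sum_distrib_left
  proof (intro sum.cong refl)
    fix m assume "m \<in> {..N}"
    then obtain k where N: "N = m + k" using le_Suc_ex by auto
    have "real (2 * N choose (2 * m)) = fact (2 * N) / (fact (2 * m) * fact (2 * k))"
      using binomial_fact[of "2 * m" "2 * N", where 'a = real] N by simp
    then show "(4 ^ m / (fact (2 * m) * Gamma (\<alpha> + 1))) * (X\<^sup>2) ^ m
     * ((4 ^ (N - m) / (fact (2 * (N - m)) * Gamma (\<beta> + 1))) * (Y\<^sup>2) ^ (N - m))
     = 4 ^ N / fact (2 * N) / K * (real (2 * N choose (2 * m)) * X ^ (2 * m) * Y ^ (2 * N - 2 * m))"
      unfolding N K_def by (simp add: power_mult[symmetric] power_add diff_mult_distrib2[symmetric] mult_ac)
  qed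
  also have "\<dots> \<le> (4 ^ N / fact (2 * N) / K) * (X + Y) ^ (2 * N)"
  proof (rule mult_left_mono)
  have "(\<Sum>m\<le>N. real (2 * N choose (2 * m)) * X ^ (2 * m) * Y ^ (2 * N - 2 * m))
     = (\<Sum>i\<in>(\<lambda>m. 2 * m) ` {..N}. real (2 * N choose i) * X ^ i * Y ^ (2 * N - i))"
    by (subst sum.reindex) (auto simp: inj_on_def)
  also have "\<dots> \<le> (\<Sum>i\<le>2 * N. real (2 * N choose i) * X ^ i * Y ^ (2 * N - i))"
    using assms by (intro sum_mono2) auto
  also have "\<dots> = (X + Y) ^ (2 * N)"
    by (simp add: binomial_ring)
  finally show "(\<Sum>m\<le>N. real (2 * N choose (2 * m)) * X ^ (2 * m) * Y ^ (2 * N - 2 * m)) \<le> (X + Y) ^ (2 * N)" .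
  qed (use g in \<open>simp add: K_def\<close>)
  finally show ?thesis
    unfolding K_def by (simp add: power_mult power_mult_distrib)
qed

lemma summable_Gamma_fact_power:
  fixes L x :: real
  assumes "L > 0" "0 \<le> x" "x < 1"
  shows "summable (\<lambda>N. Gamma (2 * real N + L + 1) / fact (2 * N) * x ^ N)"
proof -
  define h where "h N = Gamma (2 * real N + L + 1) / fact (2 * N)" for N
  have pos: "h N > 0" for N unfolding h_def using assms by (intro divide_pos_pos Gamma_real_pos) auto
  have "norm (h N) / norm (h (Suc N)) = (2 * real N + 1) * (2 * real N + 2) / ((2 * real N + L + 1) * (2 * real N + L + 2))" for N
  proof -
    have p: "2 * real N + L + 1 > 0" "2 * real N + L + 2 > 0" using assms by auto
    have "Gamma (2 * real (Suc N) + L + 1) = (2 * real N + L + 2) * Gamma (2 * real N + L + 1 + 1)"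
      using Gamma_plus1_pos[OF p(2)] by (simp add: add_ac)
    also have "Gamma (2 * real N + L + 1 + 1) = (2 * real N + L + 1) * Gamma (2 * real N + L + 1)"
      by (rule Gamma_plus1_pos) (rule p)
    finally have G: "Gamma (2 * real (Suc N) + L + 1) = (2 * real N + L + 2) * ((2 * real N + L + 1) * Gamma (2 * real N + L + 1))" .
    have F: "fact (2 * Suc N) = (2 * real N + 1) * (2 * real N + 2) * fact (2 * N)"
      by (simp add: algebra_simps)
    have g: "Gamma (2 * real N + L + 1) > 0" using p by (simp add: Gamma_real_pos)
    have "norm (h N) / norm (h (Suc N)) = h N / h (Suc N)" using pos by (simp add: less_imp_le)
    also have "\<dots> = (2 * real N + 1) * (2 * real N + 2) / ((2 * real N + L + 1) * (2 * real N + L + 2))"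
    proof -
      have *: "G / F / (b * (a * G) / (c * d * F)) = c * d / (a * b)"
        if "G \<noteq> 0" "F \<noteq> 0" for G F a b c d :: real
        using that by (simp add: divide_simps)
      show ?thesis unfolding h_def G F by (rule *) (use g in auto)
    qed
    finally show ?thesis .
  qed
  moreover have "(\<lambda>N. (2 * real N + 1) * (2 * real N + 2) / ((2 * real N + L + 1) * (2 * real N + L + 2))) \<longlonglongrightarrow> 1"
    by real_asymp
  ultimately have "conv_radius h = 1"
    by (intro conv_radius_ratio_limit_nonzero[of _ 1]) auto
  then show ?thesis
    using summable_in_conv_radius[of x h] assms unfolding h_def by (simp add: one_ereal_def)
qed

text \<open>Once (1 - r) (1 + r) powr (- (\<alpha> + \<beta> + 2)) is split off, these are the
  coefficients of the generating function in powers of r / (1 + r)^2. They are nonnegative, whereas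
  the powers of r come with both signs.\<close>

definition gen_coeff :: "real \<Rightarrow> real \<Rightarrow> real \<Rightarrow> real \<Rightarrow> nat \<Rightarrow> real" where
  "gen_coeff \<alpha> \<beta> \<xi> \<eta> N = Gamma (2 * real N + (\<alpha> + \<beta> + 1) + 1) * bes_conv \<alpha> \<beta> \<xi> \<eta> N"

lemma gen_coeff_nonneg:
  assumes "\<alpha> > -1/2" "\<beta> > -1/2" "0 \<le> \<xi>" "0 \<le> \<eta>"
  shows "gen_coeff \<alpha> \<beta> \<xi> \<eta> N \<ge> 0"
  unfolding gen_coeff_def using assms
  by (intro mult_nonneg_nonneg bes_conv_nonneg less_imp_le[OF Gamma_real_pos]) auto

text \<open>The series in z converges up to 1 / (4 (X + Y)^2). Off the diagonal X + Y < 1, so this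
  exceeds 1/4, the largest value of z = r / (1 + r)^2 for r in (0, 1].\<close>

lemma summable_gen_coeff:
  assumes "\<alpha> > -1/2" "\<beta> > -1/2" "0 \<le> X" "0 \<le> Y" "0 \<le> z" "4 * (X + Y)\<^sup>2 * z < 1"
  shows "summable (\<lambda>N. gen_coeff \<alpha> \<beta> (X\<^sup>2) (Y\<^sup>2) N * z ^ N)"
proof (rule summable_comparison_test)
  define L where "L = \<alpha> + \<beta> + 1"
  have L: "L > 0" unfolding L_def using assms by simp
  have g: "Gamma (\<alpha> + 1) > 0" "Gamma (\<beta> + 1) > 0" using assms by (auto simp: Gamma_real_pos)
  show "summable (\<lambda>N. Gamma (2 * real N + L + 1) / fact (2 * N) * (4 * (X + Y)\<^sup>2 * z) ^ N / (Gamma (\<alpha> + 1) * Gamma (\<beta> + 1)))"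
    using assms by (intro summable_divide summable_Gamma_fact_power L) auto
  show "\<exists>N0. \<forall>N\<ge>N0. norm (gen_coeff \<alpha> \<beta> (X\<^sup>2) (Y\<^sup>2) N * z ^ N) \<le>
     Gamma (2 * real N + L + 1) / fact (2 * N) * (4 * (X + Y)\<^sup>2 * z) ^ N / (Gamma (\<alpha> + 1) * Gamma (\<beta> + 1))"
  proof (intro exI[of _ 0] allI impI)
    fix N :: nat
    have G: "Gamma (2 * real N + L + 1) > 0" using L by (intro Gamma_real_pos) auto
    have "norm (gen_coeff \<alpha> \<beta> (X\<^sup>2) (Y\<^sup>2) N * z ^ N) = gen_coeff \<alpha> \<beta> (X\<^sup>2) (Y\<^sup>2) N * z ^ N"
      using gen_coeff_nonneg[OF assms(1,2), of "X\<^sup>2" "Y\<^sup>2" N] assms by simp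
    also have "\<dots> \<le> Gamma (2 * real N + L + 1) * ((4 * (X + Y)\<^sup>2) ^ N / fact (2 * N) / (Gamma (\<alpha> + 1) * Gamma (\<beta> + 1))) * z ^ N"
      unfolding gen_coeff_def L_def[symmetric] using assms G
      by (intro mult_right_mono mult_left_mono bes_conv_le) auto
    also have "\<dots> = Gamma (2 * real N + L + 1) / fact (2 * N) * (4 * (X + Y)\<^sup>2 * z) ^ N / (Gamma (\<alpha> + 1) * Gamma (\<beta> + 1))"
      by (simp add: power_mult_distrib)
    finally show "norm (gen_coeff \<alpha> \<beta> (X\<^sup>2) (Y\<^sup>2) N * z ^ N) \<le> \<dots>" .
  qed
qed

section \<open>The generating function as a formal power series\<close>

lemma fps_mult_compose_nth:
  fixes P a b :: "'a::comm_ring_1 fps"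
  assumes "b $ 0 = 0"
  shows "(P * (a oo b)) $ n = (\<Sum>N\<le>n. a $ N * (P * b ^ N) $ n)"
proof -
  \<comment> \<open>\<open>b ^ N\<close> starts in degree N, so terms beyond n do not reach the
    coefficients up to n and one finite range of N serves them all.\<close>
  have ext: "(a oo b) $ j = (\<Sum>N\<le>n. a $ N * (b ^ N) $ j)" if "j \<le> n" for j
    unfolding fps_compose_nth
    by (rule sum.mono_neutral_left) (use that startsby_zero_power_prefix[OF assms] in auto)
  have "(P * (a oo b)) $ n = (\<Sum>i=0..n. P $ i * (\<Sum>N\<le>n. a $ N * (b ^ N) $ (n - i)))"
    unfolding fps_mult_nth by (intro sum.cong refl) (simp add: ext)
  also have "\<dots> = (\<Sum>N\<le>n. a $ N * (P * b ^ N) $ n)"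
    unfolding fps_mult_nth sum_distrib_left by (subst sum.swap) (simp add: mult_ac)
  finally show ?thesis .
qed

text \<open>The N-th term X^N (1 + X)^(- 2 N) merges with (1 + X)^(- p) into a single binomial
  series with exponent - q, q = 2 N + \<alpha> + \<beta> + 2. The factor 1 - X subtracts
  neighbouring coefficients, and (q + r) + (r + 1) is exactly the factor 2 n + \<alpha> + \<beta> +
  1 of the normalization. Complex coefficients prepare for analytic continuation.\<close>

lemma gen_fps_nth:
  fixes \<alpha> \<beta> \<xi> \<eta> :: real
  assumes "\<alpha> > -1/2" "\<beta> > -1/2"
  defines "p \<equiv> complex_of_real (\<alpha> + \<beta> + 2)"
  shows "((1 - fps_X) * fps_binomial (- p) *
     (Abs_fps (\<lambda>N. complex_of_real (gen_coeff \<alpha> \<beta> \<xi> \<eta> N)) oo (fps_X * fps_binomial (- 2)))) $ n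
     = of_real (poisson_coeff \<alpha> \<beta> \<xi> \<eta> n)"
proof -
  define L where "L = \<alpha> + \<beta> + 1"
  have L: "L > 0" unfolding L_def using assms by simp
  have B: "((1 - fps_X) * fps_binomial (- p) * (fps_X * fps_binomial (- 2)) ^ N) $ n =
      of_real ((-1) ^ (n - N) * (2 * real n + L) * Gamma (real n + real N + L) / fact (n - N) / Gamma (2 * real N + L + 1))"
    if "N \<le> n" for N
  proof -
    define q where "q = 2 * real N + L + 1"
    obtain l where n: "n = N + l" using \<open>N \<le> n\<close> le_Suc_ex by blast
    have "(1 - fps_X) * fps_binomial (- p) * (fps_X * fps_binomial (- 2)) ^ N
      = fps_X ^ N * ((1 - fps_X) * (fps_binomial (- p) * fps_binomial (of_nat N * (- 2))))"
      by (simp add: power_mult_distrib fps_binomial_power mult_ac)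
    also have "fps_binomial (- p) * fps_binomial (of_nat N * (- 2)) = fps_binomial (- complex_of_real q)"
      unfolding fps_binomial_add_mult[symmetric] by (simp add: p_def q_def L_def algebra_simps)
    also have "(fps_X ^ N * ((1 - fps_X) * fps_binomial (- complex_of_real q))) $ n = ((1 - fps_X) * fps_binomial (- complex_of_real q)) $ l"
      by (simp add: fps_X_power_mult_nth n)
    also have "\<dots> = (- complex_of_real q gchoose l) - (if l = 0 then 0 else (- complex_of_real q gchoose (l - 1)))"
      by (simp add: left_diff_distrib)
    also have "\<dots> = of_real ((-1) ^ l * (2 * real n + L) * Gamma (real n + real N + L) / fact l / Gamma q)"
    proof -
      have c: "(- complex_of_real q gchoose k) = of_real ((-1) ^ k * pochhammer q k / fact k)" for k
        by (simp add: gbinomial_pochhammer pochhammer_of_real)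
      have g: "Gamma q > 0" using L unfolding q_def by (intro Gamma_real_pos) auto
      have pg: "pochhammer q k = Gamma (q + real k) / Gamma q" for k
        using pochhammer_Gamma_real[of q k] L by (simp add: q_def)
      show ?thesis
      proof (cases l)
        case 0
        have "Gamma (2 * real N + L + 1) = (2 * real N + L) * Gamma (2 * real N + L)"
          using L by (intro Gamma_plus1_pos) auto
        then have "(2 * real n + L) * Gamma (real n + real N + L) = Gamma q"
          unfolding n 0 q_def by simp
        then show ?thesis using g 0 by simp
      next
        case (Suc r)
        have e: "q + real l = q + real r + 1" "real n + real N + L = q + real r"
          unfolding Suc n q_def by simp_all
        have pos: "q + real r > 0" using L unfolding q_def by simp
        have "Gamma (q + real l) = (q + real r) * Gamma (q + real r)"
          unfolding e by (rule Gamma_plus1_pos[OF pos])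
        then have "(-1) ^ l * pochhammer q l / fact l - (-1) ^ r * pochhammer q r / fact r
          = (-1) ^ l * ((q + real r) + (real r + 1)) * Gamma (q + real r) / fact l / Gamma q"
        proof -
          have *: "- s * (a * G / g) / (b * f) - s * (G / g) / f = - s * (a + b) * G / (b * f) / g"
            if "b \<noteq> 0" "f \<noteq> 0" "g \<noteq> 0" for s a b f g G :: real
            using that by (simp add: divide_simps) (simp add: algebra_simps)
          have m1: "(-1) ^ l = - ((-1::real) ^ r)" and fl: "fact l = (real r + 1) * fact r"
            unfolding Suc by (simp_all add: algebra_simps)
          show ?thesis if "Gamma (q + real l) = (q + real r) * Gamma (q + real r)"
            unfolding pg m1 fl that by (rule *) (use g in auto)
        qed
        also have "(q + real r) + (real r + 1) = 2 * real n + L"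
          unfolding q_def n Suc by simp
        finally have "(-1) ^ l * pochhammer q l / fact l - (-1) ^ r * pochhammer q r / fact r
          = (-1) ^ l * (2 * real n + L) * Gamma (real n + real N + L) / fact l / Gamma q"
          unfolding e(2) .
        moreover have "(- complex_of_real q gchoose l) - (if l = 0 then 0 else (- complex_of_real q gchoose (l - 1)))
          = of_real ((-1) ^ l * pochhammer q l / fact l - (-1) ^ r * pochhammer q r / fact r)"
          using c[of l] c[of r] by (simp add: Suc)
        ultimately show ?thesis by (simp only:)
      qed
    qed
    finally show ?thesis unfolding n q_def by simp
  qed
  have "((1 - fps_X) * fps_binomial (- p) *
     (Abs_fps (\<lambda>N. complex_of_real (gen_coeff \<alpha> \<beta> \<xi> \<eta> N)) oo (fps_X * fps_binomial (- 2)))) $ n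
    = (\<Sum>N\<le>n. of_real (gen_coeff \<alpha> \<beta> \<xi> \<eta> N) *
       of_real ((-1) ^ (n - N) * (2 * real n + L) * Gamma (real n + real N + L) / fact (n - N) / Gamma (2 * real N + L + 1)))"
    by (subst fps_mult_compose_nth) (auto intro!: sum.cong simp: B)
  also have "\<dots> = of_real (poisson_coeff \<alpha> \<beta> \<xi> \<eta> n)"
    unfolding poisson_coeff_def of_real_sum of_real_mult[symmetric]
  proof (intro sum.cong refl arg_cong[where f = of_real])
    fix N
    have "Gamma (2 * real N + L + 1) > 0" using L by (intro Gamma_real_pos) auto
    then show "gen_coeff \<alpha> \<beta> \<xi> \<eta> N * ((-1) ^ (n - N) * (2 * real n + L) * Gamma (real n + real N + L) / fact (n - N) / Gamma (2 * real N + L + 1))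
      = bes_conv \<alpha> \<beta> \<xi> \<eta> N * ((-1) ^ (n - N) * (2 * real n + \<alpha> + \<beta> + 1) * Gamma (real n + real N + \<alpha> + \<beta> + 1) / fact (n - N))"
      unfolding gen_coeff_def L_def[symmetric] by (simp add: L_def add.assoc)
  qed
  finally show ?thesis .
qed

section \<open>Convergence of the Jacobi series in the unit disc\<close>

lemma jacobi_d_square:
  assumes "\<alpha> > -1/2" "\<beta> > -1/2"
  shows "(jacobi_d n \<alpha> \<beta>)\<^sup>2 = (2 * real n + \<alpha> + \<beta> + 1) * Gamma (real n + 1) * Gamma (real n + \<alpha> + \<beta> + 1)
           / (Gamma (real n + \<alpha> + 1) * Gamma (real n + \<beta> + 1))"
    and "(jacobi_d n \<alpha> \<beta>)\<^sup>2 > 0"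
proof -
  have g: "Gamma (real n + \<alpha> + 1) > 0" "Gamma (real n + \<beta> + 1) > 0" "Gamma (real n + \<alpha> + \<beta> + 1) > 0"
    "2 * real n + \<alpha> + \<beta> + 1 > 0" "Gamma (real n + 1) > 0"
    using assms by (auto intro!: Gamma_real_pos simp: add.assoc)
  show *: "(jacobi_d n \<alpha> \<beta>)\<^sup>2 = (2 * real n + \<alpha> + \<beta> + 1) * Gamma (real n + 1) * Gamma (real n + \<alpha> + \<beta> + 1)
           / (Gamma (real n + \<alpha> + 1) * Gamma (real n + \<beta> + 1))"
    unfolding jacobi_d_def using g by (intro real_sqrt_pow2 divide_nonneg_nonneg mult_nonneg_nonneg) auto
  show "(jacobi_d n \<alpha> \<beta>)\<^sup>2 > 0"
    unfolding * using g by (intro divide_pos_pos mult_pos_pos) auto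
qed

lemma jacobi_d_square_Suc:
  assumes "\<alpha> > -1/2" "\<beta> > -1/2"
  shows "(jacobi_d (Suc n) \<alpha> \<beta>)\<^sup>2 = (jacobi_d n \<alpha> \<beta>)\<^sup>2 *
    ((2 * real n + \<alpha> + \<beta> + 3) * (real n + 1) * (real n + \<alpha> + \<beta> + 1)
      / ((2 * real n + \<alpha> + \<beta> + 1) * (real n + \<alpha> + 1) * (real n + \<beta> + 1)))"
proof -
  have p: "real n + 1 > 0" "real n + \<alpha> + \<beta> + 1 > 0" "real n + \<alpha> + 1 > 0" "real n + \<beta> + 1 > 0" "2 * real n + \<alpha> + \<beta> + 1 > 0"
    using assms by auto
  have e: "real (Suc n) + 1 = real n + 1 + 1" "real (Suc n) + \<alpha> + 1 = real n + \<alpha> + 1 + 1"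
    "real (Suc n) + \<beta> + 1 = real n + \<beta> + 1 + 1" "real (Suc n) + \<alpha> + \<beta> + 1 = real n + \<alpha> + \<beta> + 1 + 1"
    "2 * real (Suc n) + \<alpha> + \<beta> + 1 = 2 * real n + \<alpha> + \<beta> + 3" by auto
  have g: "Gamma (real n + \<alpha> + 1) \<noteq> 0" "Gamma (real n + \<beta> + 1) \<noteq> 0"
    using p by (auto simp: Gamma_real_pos less_imp_neq[symmetric])
  have *: "s' * (a * A) * (l * G) / ((u * U) * (v * V)) = s * A * G / (U * V) * (s' * a * l / (s * u * v))"
    if "s \<noteq> 0" for s s' a A l G u U v V :: real
    using that by (simp add: divide_simps)
  show ?thesis
    unfolding jacobi_d_square(1)[OF assms] e Gamma_plus1_pos[OF p(1)] Gamma_plus1_pos[OF p(2)]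
      Gamma_plus1_pos[OF p(3)] Gamma_plus1_pos[OF p(4)]
    by (rule *) (use p in auto)
qed

lemma gbinomial_shift_Suc:
  assumes "a > -1"
  shows "(real (Suc n) + a) gchoose (Suc n) = ((real n + a) gchoose n) * ((real n + a + 1) / (real n + 1))"
proof -
  have "Gamma (a + 1 + real n + 1) = (a + 1 + real n) * Gamma (a + 1 + real n)"
    using assms by (intro Gamma_plus1_pos) auto
  then show ?thesis
    unfolding gbinomial_shift_Gamma[OF assms] by (simp add: add_ac mult_ac)
qed

text \<open>Normalization and endpoint values are both products of Gamma quotients in n, so the
  ratio of consecutive coefficients is rational in n and tends to 1.\<close>

lemma summable_jacobi_endpoint_power:
  assumes ab: "\<alpha> > -1/2" "\<beta> > -1/2" and r: "0 \<le> r" "r < 1" and \<gamma>: "\<gamma> = \<alpha> \<or> \<gamma> = \<beta>"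
  shows "summable (\<lambda>n. (jacobi_d n \<alpha> \<beta>)\<^sup>2 * ((real n + \<gamma>) gchoose n)\<^sup>2 * r ^ n)"
proof -
  define h where "h n = (jacobi_d n \<alpha> \<beta>)\<^sup>2 * ((real n + \<gamma>) gchoose n)\<^sup>2" for n
  have \<gamma>1: "\<gamma> > -1" using ab \<gamma> by auto
  have pos: "h n > 0" for n
    unfolding h_def by (intro mult_pos_pos zero_less_power jacobi_d_square(2)[OF ab] gbinomial_shift_pos[OF \<gamma>1])
  have ratio: "norm (h n) / norm (h (Suc n)) = (2 * real n + \<alpha> + \<beta> + 1) * (real n + \<alpha> + 1) * (real n + \<beta> + 1) * (real n + 1)\<^sup>2
      / ((2 * real n + \<alpha> + \<beta> + 3) * (real n + 1) * (real n + \<alpha> + \<beta> + 1) * (real n + \<gamma> + 1)\<^sup>2)" for n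
  proof -
    have hS: "h (Suc n) = h n * ((2 * real n + \<alpha> + \<beta> + 3) * (real n + 1) * (real n + \<alpha> + \<beta> + 1)
      / ((2 * real n + \<alpha> + \<beta> + 1) * (real n + \<alpha> + 1) * (real n + \<beta> + 1)) * ((real n + \<gamma> + 1) / (real n + 1))\<^sup>2)"
      unfolding h_def jacobi_d_square_Suc[OF ab] gbinomial_shift_Suc[OF \<gamma>1] by (simp only: power_mult_distrib mult_ac)
    have "norm (h n) / norm (h (Suc n)) = h n / h (Suc n)" using pos[of n] pos[of "Suc n"] by simp
    then show ?thesis
      using pos[of n] unfolding hS by (simp add: power_divide)
  qed
  have "(\<lambda>n. (2 * real n + \<alpha> + \<beta> + 1) * (real n + \<alpha> + 1) * (real n + \<beta> + 1) * (real n + 1)\<^sup>2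
      / ((2 * real n + \<alpha> + \<beta> + 3) * (real n + 1) * (real n + \<alpha> + \<beta> + 1) * (real n + \<gamma> + 1)\<^sup>2)) \<longlonglongrightarrow> 1"
    by real_asymp
  then have "(\<lambda>n. norm (h n) / norm (h (Suc n))) \<longlonglongrightarrow> 1" unfolding ratio .
  then have "conv_radius h = 1"
    by (intro conv_radius_ratio_limit_nonzero[of _ 1]) auto
  then show ?thesis
    using summable_in_conv_radius[of r h] r unfolding h_def by (simp add: one_ereal_def)
qed

text \<open>By \<open>abs_jac_poly_le\<close> the endpoint values dominate. The result makes the
  left-hand side of the generating function holomorphic in the whole unit disc, which the
  continuation requires.\<close>

lemma summable_jacobi_fun_product:
  assumes ab: "\<alpha> > -1/2" "\<beta> > -1/2" and r: "0 \<le> r" "r < 1"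
  shows "summable (\<lambda>n. jacobi_fun n \<alpha> \<beta> \<theta> * jacobi_fun n \<alpha> \<beta> \<phi> * r ^ n)"
proof (rule summable_comparison_test)
  show "summable (\<lambda>n. (jacobi_d n \<alpha> \<beta>)\<^sup>2 * ((real n + \<alpha>) gchoose n)\<^sup>2 * r ^ n
      + (jacobi_d n \<alpha> \<beta>)\<^sup>2 * ((real n + \<beta>) gchoose n)\<^sup>2 * r ^ n)"
    using assms by (intro summable_add summable_jacobi_endpoint_power) auto
  show "\<exists>N. \<forall>n\<ge>N. norm (jacobi_fun n \<alpha> \<beta> \<theta> * jacobi_fun n \<alpha> \<beta> \<phi> * r ^ n) \<le>
     (jacobi_d n \<alpha> \<beta>)\<^sup>2 * ((real n + \<alpha>) gchoose n)\<^sup>2 * r ^ n + (jacobi_d n \<alpha> \<beta>)\<^sup>2 * ((real n + \<beta>) gchoose n)\<^sup>2 * r ^ n"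
  proof (intro exI[of _ 0] allI impI)
    fix n :: nat
    define A where "A = (real n + \<alpha>) gchoose n"
    define B where "B = (real n + \<beta>) gchoose n"
    have pos: "A > 0" "B > 0" unfolding A_def B_def using gbinomial_shift_pos ab by auto
    have le: "\<bar>poly (jac_poly n \<alpha> \<beta>) ((sin (x / 2))\<^sup>2)\<bar> \<le> max A B" for x
      unfolding A_def B_def using ab by (intro abs_jac_poly_le) (auto simp: power_le_one_iff abs_square_le_1)
    have "\<bar>poly (jac_poly n \<alpha> \<beta>) ((sin (\<theta> / 2))\<^sup>2)\<bar> * \<bar>poly (jac_poly n \<alpha> \<beta>) ((sin (\<phi> / 2))\<^sup>2)\<bar> \<le> max A B * max A B"
      by (intro mult_mono le) (use pos in auto)
    also have "\<dots> \<le> A\<^sup>2 + B\<^sup>2" by (auto simp: max_def power2_eq_square)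
    finally have "(jacobi_d n \<alpha> \<beta>)\<^sup>2 * (\<bar>poly (jac_poly n \<alpha> \<beta>) ((sin (\<theta> / 2))\<^sup>2)\<bar> * \<bar>poly (jac_poly n \<alpha> \<beta>) ((sin (\<phi> / 2))\<^sup>2)\<bar>) * r ^ n
      \<le> (jacobi_d n \<alpha> \<beta>)\<^sup>2 * (A\<^sup>2 + B\<^sup>2) * r ^ n"
      using r by (intro mult_right_mono mult_left_mono) auto
    moreover have "norm (jacobi_fun n \<alpha> \<beta> \<theta> * jacobi_fun n \<alpha> \<beta> \<phi> * r ^ n) =
      (jacobi_d n \<alpha> \<beta>)\<^sup>2 * (\<bar>poly (jac_poly n \<alpha> \<beta>) ((sin (\<theta> / 2))\<^sup>2)\<bar> * \<bar>poly (jac_poly n \<alpha> \<beta>) ((sin (\<phi> / 2))\<^sup>2)\<bar>) * r ^ n"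
      unfolding jacobi_fun_jac_poly using r by (simp add: abs_mult power2_eq_square)
    ultimately show "norm (jacobi_fun n \<alpha> \<beta> \<theta> * jacobi_fun n \<alpha> \<beta> \<phi> * r ^ n) \<le>
     (jacobi_d n \<alpha> \<beta>)\<^sup>2 * ((real n + \<alpha>) gchoose n)\<^sup>2 * r ^ n + (jacobi_d n \<alpha> \<beta>)\<^sup>2 * ((real n + \<beta>) gchoose n)\<^sup>2 * r ^ n"
      unfolding A_def B_def by (simp add: algebra_simps)
  qed
qed

text \<open>The identity holds for formal power series in \<open>r\<close>, hence near \<open>0\<close>; both sides are holomorphic on a
  star-shaped domain that contains the interval \<open>(0, 1)\<close>.\<close>

lemma jacobi_generating_sums:
  fixes \<theta> \<phi> :: real
  assumes ab: "\<alpha> > -1/2" "\<beta> > -1/2" and r: "0 < r" "r < 1"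
  defines "X \<equiv> sin (\<theta> / 2) * sin (\<phi> / 2)" and "Y \<equiv> cos (\<theta> / 2) * cos (\<phi> / 2)"
  assumes X: "X > 0" and Y: "Y > 0" and XY: "X + Y < 1"
  shows "(\<lambda>n. jacobi_fun n \<alpha> \<beta> \<theta> * jacobi_fun n \<alpha> \<beta> \<phi> * r ^ n) sums
    ((1 - r) * (1 + r) powr (- (\<alpha> + \<beta> + 2)) * (\<Sum>N. gen_coeff \<alpha> \<beta> (X\<^sup>2) (Y\<^sup>2) N * (r / (1 + r)\<^sup>2) ^ N))"
proof -
  define a where "a n = jacobi_fun n \<alpha> \<beta> \<theta> * jacobi_fun n \<alpha> \<beta> \<phi>" for n
  define gc where "gc = gen_coeff \<alpha> \<beta> (X\<^sup>2) (Y\<^sup>2)"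
  define A where "A = Abs_fps (\<lambda>n. complex_of_real (a n))"
  define G where "G = Abs_fps (\<lambda>n. complex_of_real (gc n))"
  define p where "p = complex_of_real (\<alpha> + \<beta> + 2)"
  define R where "R = 1 / (4 * (X + Y)\<^sup>2)"
  \<comment> \<open>1/4 is the value of r / (1 + r)^2 at r = 1; the strict inequality keeps the
    whole interval (0, 1) inside the domain \<open>S\<close>.\<close>
  have R: "R > 1/4"
  proof -
    have "(X + Y)\<^sup>2 < 1" using X Y XY by (simp add: power_less_one_iff)
    moreover have "(X + Y)\<^sup>2 > 0" using X Y by simp
    ultimately show ?thesis unfolding R_def by (simp add: pos_less_divide_eq)
  qed
  have radA: "fps_conv_radius A \<ge> 1"
    unfolding fps_conv_radius_def
  proof (rule conv_radius_geI_ex)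
    fix x :: real assume x: "0 < x" "ereal x < 1"
    then have "summable (\<lambda>n. a n * x ^ n)"
      unfolding a_def using ab by (intro summable_jacobi_fun_product) auto
    then have "summable (\<lambda>n. complex_of_real (a n * x ^ n))" by (rule summable_of_real)
    then show "\<exists>z. norm z = x \<and> summable (\<lambda>n. fps_nth A n * z ^ n)"
      using x by (intro exI[of _ "of_real x"]) (simp add: A_def)
  qed
  have radG: "fps_conv_radius G \<ge> ereal R"
    unfolding fps_conv_radius_def
  proof (rule conv_radius_geI_ex)
    fix x :: real assume x: "0 < x" "ereal x < ereal R"
    moreover have "4 * (X + Y)\<^sup>2 > 0" using X Y by simp
    ultimately have "4 * (X + Y)\<^sup>2 * x < 1" unfolding R_def by (simp add: pos_less_divide_eq mult.commute)
    then have "summable (\<lambda>n. gc n * x ^ n)"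
      unfolding gc_def using ab X Y x by (intro summable_gen_coeff) auto
    then have "summable (\<lambda>n. complex_of_real (gc n * x ^ n))" by (rule summable_of_real)
    then show "\<exists>z. norm z = x \<and> summable (\<lambda>n. fps_nth G n * z ^ n)"
      using x by (intro exI[of _ "of_real x"]) (simp add: G_def)
  qed
  have radA0: "fps_conv_radius A > 0" using radA by (rule less_le_trans[rotated]) simp
  have radG0: "fps_conv_radius G > 0" using radG R by (intro less_le_trans[OF _ radG]) simp
  \<comment> \<open>Both sides make sense on \<open>S\<close>: the left one in the unit disc, the
    right one where the argument of \<open>G\<close> stays below \<open>R\<close>.\<close>
  define S :: "complex set" where "S = {z. norm z < 1 \<and> norm (z / (1 + z)\<^sup>2) < R}"
  define g where "g z = (1 - z) * (1 + z) powr (- p) * eval_fps G (z * (1 + z) powr (- 2))" for z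
  have Re1: "Re (1 + z) > 0" if "norm z < 1" for z
    using abs_Re_le_cmod[of z] that by simp
  have nz: "1 + z \<noteq> 0" if "norm z < 1" for z :: complex
    using Re1[OF that] by (metis less_irrefl zero_complex.simps(1))
  \<comment> \<open>The principal power gives \<open>g\<close> an expansion built from binomial
    series; the quotient is more convenient for holomorphy and for the shape of
    \<open>S\<close>.\<close>
  have pw: "z * (1 + z) powr (- 2) = z / (1 + z)\<^sup>2" if "norm z < 1" for z :: complex
    using nz[OF that] by (simp add: powr_minus divide_inverse)
  have gA: "g has_fps_expansion A"
  proof -
    have 1: "(eval_fps G \<circ> (\<lambda>z. z * (1 + z) powr (- 2))) has_fps_expansion (G oo (fps_X * fps_binomial (- 2)))"
      by (intro has_fps_expansion_compose eval_fps_has_fps_expansion radG0 fps_expansion_intros) simp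
    have "(\<lambda>z. (1 - z) * (1 + z) powr (- p) * (eval_fps G \<circ> (\<lambda>z. z * (1 + z) powr (- 2))) z)
       has_fps_expansion ((1 - fps_X) * fps_binomial (- p) * (G oo (fps_X * fps_binomial (- 2))))"
      by (intro fps_expansion_intros 1)
    moreover have "(1 - fps_X) * fps_binomial (- p) * (G oo (fps_X * fps_binomial (- 2))) = A"
    proof (rule fps_ext)
      fix n
      show "((1 - fps_X) * fps_binomial (- p) * (G oo (fps_X * fps_binomial (- 2)))) $ n = A $ n"
        using gen_fps_nth[OF ab, of "X\<^sup>2" "Y\<^sup>2" n] jacobi_fun_product[OF ab, of n \<theta> \<phi>]
        by (simp add: G_def gc_def p_def A_def a_def X_def Y_def del: of_real_mult of_real_add)
    qed
    ultimately show ?thesis by (simp add: g_def[abs_def] o_def)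
  qed
  have zero: "(\<lambda>z. eval_fps A z - g z) has_fps_expansion 0"
    using has_fps_expansion_diff[OF eval_fps_has_fps_expansion[OF radA0] gA] by simp
  have inA: "ereal (norm z) < fps_conv_radius A" if "norm z < 1" for z :: complex
    using radA that by (intro less_le_trans[OF _ radA]) (simp add: one_ereal_def)
  have inG: "ereal x < fps_conv_radius G" if "x < R" for x
    using that by (intro less_le_trans[OF _ radG]) simp
  have openS: "open S"
  proof -
    have "S = ball 0 1 \<inter> (\<lambda>z. norm (z / (1 + z)\<^sup>2)) -` {..<R}" unfolding S_def by auto
    moreover have "continuous_on (ball 0 1) (\<lambda>z::complex. norm (z / (1 + z)\<^sup>2))"
      by (intro continuous_on_norm continuous_on_divide continuous_on_power continuous_on_add
          continuous_on_const continuous_on_id ballI) (use nz in auto)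
    then have "open (ball 0 1 \<inter> (\<lambda>z::complex. norm (z / (1 + z)\<^sup>2)) -` {..<R})"
      by (rule continuous_open_preimage) auto
    ultimately show ?thesis by simp
  qed
  have "eval_fps A (of_real r) - g (of_real r) = 0"
  proof (rule has_fps_expansion_0_analytic_continuation[OF zero _ openS])
    show "(\<lambda>z. eval_fps A z - g z) holomorphic_on S"
    proof (intro holomorphic_on_diff)
      show "eval_fps A holomorphic_on S"
        by (intro holomorphic_on_eval_fps) (auto simp: S_def in_eball_iff intro: inA)
      have "(\<lambda>z. (1 - z) * (1 + z) powr (- p) * (eval_fps G \<circ> (\<lambda>z. z / (1 + z)\<^sup>2)) z) holomorphic_on S"
      proof (intro holomorphic_intros)
        show "(eval_fps G \<circ> (\<lambda>z. z / (1 + z)\<^sup>2)) holomorphic_on S"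
        proof (rule holomorphic_on_compose_gen[where t = "eball 0 (fps_conv_radius G)"])
          show "(\<lambda>z. z / (1 + z)\<^sup>2) holomorphic_on S"
            by (intro holomorphic_intros) (use nz in \<open>auto simp: S_def\<close>)
          show "eval_fps G holomorphic_on eball 0 (fps_conv_radius G)"
            by (intro holomorphic_on_eval_fps) auto
          show "(\<lambda>z. z / (1 + z)\<^sup>2) ` S \<subseteq> eball 0 (fps_conv_radius G)"
            by (auto simp: S_def in_eball_iff intro!: inG)
        qed
        show "1 + z \<notin> \<real>\<^sub>\<le>\<^sub>0" if "z \<in> S" for z
          using Re1[of z] that by (auto simp: S_def complex_nonpos_Reals_iff)
      qed
      then show "g holomorphic_on S"
        by (rule holomorphic_transform) (auto simp: g_def S_def pw)
    qed
    show "connected S"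
    proof (rule starlike_imp_connected)
      show "starlike S"
        unfolding starlike_def
      proof (intro bexI ballI subsetI)
        show "0 \<in> S" using R by (simp add: S_def)
        fix z w assume z: "z \<in> S" and "w \<in> closed_segment 0 z"
        then obtain s where s: "0 \<le> s" "s \<le> 1" "w = of_real s * z"
          unfolding closed_segment_def by (auto simp: scaleR_conv_of_real)
        have nz1: "norm z < 1" using z by (simp add: S_def)
        have nw: "norm w < 1"
          using s nz1 mult_le_one[of s "norm z"] mult_left_le_one_le[of "norm z" s] by (simp add: norm_mult)
        have "norm (w / (1 + w)\<^sup>2) \<le> norm (z / (1 + z)\<^sup>2)"
        proof -
          \<comment> \<open>For w = s z with 0 \<le> s \<le> 1 and |z| < 1 the difference factors
            into two nonnegative terms. Hence |w / (1 + w)^2| does not increase as z is moved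
            towards 0, and \<open>S\<close> is star-shaped.\<close>
          have key: "s * (norm (1 + z))\<^sup>2 \<le> (norm (1 + w))\<^sup>2"
          proof -
            have "(norm (1 + w))\<^sup>2 - s * (norm (1 + z))\<^sup>2 = (1 - s) * (1 - s * (norm z)\<^sup>2)"
              unfolding s(3) cmod_power2 by (simp add: power2_eq_square algebra_simps)
            moreover have "(norm z)\<^sup>2 \<le> 1" using nz1 by (simp add: power_le_one)
            then have "s * (norm z)\<^sup>2 \<le> 1" using s by (intro mult_le_one) auto
            moreover have "(1 - s) * (1 - s * (norm z)\<^sup>2) \<ge> 0"
              using s \<open>s * (norm z)\<^sup>2 \<le> 1\<close> by (intro mult_nonneg_nonneg) auto
            ultimately show ?thesis by linarith
          qed
          have p: "norm (1 + z) > 0" "norm (1 + w) > 0" using nz[OF nz1] nz[OF nw] by auto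
          have "norm (w / (1 + w)\<^sup>2) = s * norm z / (norm (1 + w))\<^sup>2"
            using s by (simp add: norm_divide norm_mult norm_power)
          also have "\<dots> \<le> norm z / (norm (1 + z))\<^sup>2"
          proof -
            have "s * norm z * (norm (1 + z))\<^sup>2 \<le> norm z * (norm (1 + w))\<^sup>2"
              using mult_left_mono[OF key, of "norm z"] by (simp add: mult_ac)
            then have "s * norm z * (norm (1 + z))\<^sup>2 / ((norm (1 + z))\<^sup>2 * (norm (1 + w))\<^sup>2)
               \<le> norm z * (norm (1 + w))\<^sup>2 / ((norm (1 + z))\<^sup>2 * (norm (1 + w))\<^sup>2)"
              by (intro divide_right_mono) auto
            then show ?thesis using p by simp
          qed
          finally show ?thesis by (simp add: norm_divide norm_power)
        qed
        then show "w \<in> S" using z nw by (simp add: S_def)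
      qed
    qed
    show "0 \<in> S" using R by (simp add: S_def)
    show "complex_of_real r \<in> S"
    proof -
      have "4 * r \<le> (1 + r)\<^sup>2" using sum_squares_bound[of 1 r] by (simp add: power2_eq_square algebra_simps)
      then have "r / (1 + r)\<^sup>2 \<le> 1/4" using r by (simp add: pos_divide_le_eq)
      moreover have "norm (complex_of_real r / (1 + of_real r)\<^sup>2) = r / (1 + r)\<^sup>2"
      proof -
        have "complex_of_real r / (1 + of_real r)\<^sup>2 = of_real (r / (1 + r)\<^sup>2)" by simp
        then show ?thesis using r by (simp only: norm_of_real) simp
      qed
      ultimately have "norm (complex_of_real r / (1 + of_real r)\<^sup>2) < R" using R by linarith
      then show ?thesis using r by (simp add: S_def)
    qed
  qed
  then have eq: "eval_fps A (of_real r) = g (of_real r)" by simp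
  have r1: "norm (complex_of_real r) < 1" using r by simp
  have z: "4 * (X + Y)\<^sup>2 * (r / (1 + r)\<^sup>2) < 1"
  proof -
    have "4 * r \<le> (1 + r)\<^sup>2" using sum_squares_bound[of 1 r] by (simp add: power2_eq_square algebra_simps)
    then have "r / (1 + r)\<^sup>2 \<le> 1/4" using r by (simp add: pos_divide_le_eq)
    then have "4 * (X + Y)\<^sup>2 * (r / (1 + r)\<^sup>2) \<le> 4 * (X + Y)\<^sup>2 * (1/4)" by (intro mult_left_mono) auto
    also have "\<dots> < 1" using X Y XY by (simp add: power_less_one_iff)
    finally show ?thesis .
  qed
  have sumg: "(\<lambda>N. gc N * (r / (1 + r)\<^sup>2) ^ N) sums (\<Sum>N. gc N * (r / (1 + r)\<^sup>2) ^ N)"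
    unfolding gc_def using ab X Y r z by (intro summable_sums summable_gen_coeff) auto
  have "eval_fps G (of_real r / (1 + of_real r)\<^sup>2) = of_real (\<Sum>N. gc N * (r / (1 + r)\<^sup>2) ^ N)"
  proof -
    have "(\<lambda>N. of_real (gc N * (r / (1 + r)\<^sup>2) ^ N)) sums (of_real (\<Sum>N. gc N * (r / (1 + r)\<^sup>2) ^ N) :: complex)"
      using sumg by (simp only: sums_of_real_iff)
    then show ?thesis unfolding eval_fps_def G_def by (simp add: sums_iff)
  qed
  moreover have "(1 + complex_of_real r) powr (- p) = of_real ((1 + r) powr (- (\<alpha> + \<beta> + 2)))"
    using powr_of_real[of "1 + r" "- (\<alpha> + \<beta> + 2)"] r by (simp add: p_def)
  ultimately have "g (of_real r) = of_real ((1 - r) * (1 + r) powr (- (\<alpha> + \<beta> + 2)) * (\<Sum>N. gc N * (r / (1 + r)\<^sup>2) ^ N))"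
    unfolding g_def pw[OF r1] by simp
  moreover have "(\<lambda>n. fps_nth A n * of_real r ^ n) sums eval_fps A (of_real r)"
    using r1 by (intro sums_eval_fps inA)
  ultimately have "(\<lambda>n. complex_of_real (a n * r ^ n)) sums
     of_real ((1 - r) * (1 + r) powr (- (\<alpha> + \<beta> + 2)) * (\<Sum>N. gc N * (r / (1 + r)\<^sup>2) ^ N))"
    using eq by (simp add: A_def)
  then show ?thesis unfolding a_def gc_def by (simp only: sums_of_real_iff)
qed

subsection \<open>Modified Bessel functions and the integrated Poisson kernel\<close>

text \<open>Thus \<open>bes \<nu> (z\<^sup>2) = z powr (- \<nu>) * I\<^sub>\<nu>(2 z)\<close>.\<close>

definition bes :: "real \<Rightarrow> real \<Rightarrow> real" where
  "bes \<nu> w = (\<Sum>m. bes_coeff \<nu> m * w ^ m)"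

section \<open>Calculus of the scaled Bessel series\<close>

lemma bes_coeff_Suc:
  assumes "\<nu> > -1"
  shows "real (Suc m) * bes_coeff \<nu> (Suc m) = bes_coeff (\<nu> + 1) m"
    and "bes_coeff \<nu> m = (\<nu> + real m + 1) * bes_coeff (\<nu> + 1) m"
proof -
  show "real (Suc m) * bes_coeff \<nu> (Suc m) = bes_coeff (\<nu> + 1) m"
    unfolding bes_coeff_def by (simp add: add_ac)
  have p: "\<nu> + real m + 1 > 0" using assms by simp
  have "Gamma (\<nu> + 1 + real m + 1) = (\<nu> + real m + 1) * Gamma (\<nu> + real m + 1)"
    using Gamma_plus1_pos[OF p] by (simp add: add_ac)
  then show "bes_coeff \<nu> m = (\<nu> + real m + 1) * bes_coeff (\<nu> + 1) m"
    unfolding bes_coeff_def using p by simp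
qed

lemma summable_bes:
  assumes "\<nu> > -1"
  shows "summable (\<lambda>m. bes_coeff \<nu> m * w ^ m)"
proof -
  have ratio: "norm (bes_coeff \<nu> m) / norm (bes_coeff \<nu> (Suc m)) = (real m + 1) * (\<nu> + real m + 1)" for m
  proof -
    have p: "bes_coeff \<nu> m > 0" "bes_coeff \<nu> (Suc m) > 0" using bes_coeff_pos[OF assms] by auto
    have "bes_coeff \<nu> m = (\<nu> + real m + 1) * (real (Suc m) * bes_coeff \<nu> (Suc m))"
      using bes_coeff_Suc[OF assms, of m] by simp
    then show ?thesis using p by simp
  qed
  have "filterlim (\<lambda>m. (real m + 1) * (\<nu> + real m + 1)) at_top sequentially"
    by real_asymp
  then have "(\<lambda>m. ereal (norm (bes_coeff \<nu> m) / norm (bes_coeff \<nu> (Suc m)))) \<longlonglongrightarrow> \<infinity>"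
    unfolding ratio by (simp add: tendsto_PInfty_eq_at_top)
  then have "conv_radius (bes_coeff \<nu>) = \<infinity>"
    by (intro conv_radius_ratio_limit_ereal_nonzero) auto
  then show ?thesis by (intro summable_in_conv_radius) auto
qed

lemma DERIV_bes [derivative_intros]:
  assumes "\<nu> > -1" "(f has_real_derivative f') (at x within A)"
  shows "((\<lambda>x. bes \<nu> (f x)) has_real_derivative (bes (\<nu> + 1) (f x) * f')) (at x within A)"
proof (rule DERIV_chain2[OF _ assms(2)])
  have "diffs (bes_coeff \<nu>) = bes_coeff (\<nu> + 1)"
    using bes_coeff_Suc(1)[OF assms(1)] by (auto simp: diffs_def fun_eq_iff)
  moreover have "((\<lambda>w. \<Sum>m. bes_coeff \<nu> m * w ^ m) has_real_derivative (\<Sum>m. diffs (bes_coeff \<nu>) m * f x ^ m)) (at (f x))"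
    by (intro termdiffs_strong_converges_everywhere summable_bes assms)
  ultimately show "(bes \<nu> has_real_derivative bes (\<nu> + 1) (f x)) (at (f x))"
    unfolding bes_def[abs_def] by simp
qed

lemma continuous_on_bes [continuous_intros]:
  assumes "\<nu> > -1" "continuous_on A f"
  shows "continuous_on A (\<lambda>x. bes \<nu> (f x))"
proof -
  have "continuous_on UNIV (bes \<nu>)"
    using DERIV_bes[OF assms(1) DERIV_ident] by (intro DERIV_continuous_on) auto
  then show ?thesis using continuous_on_compose2[OF _ assms(2)] by blast
qed

lemma borel_measurable_bes [measurable]: "\<nu> > -1 \<Longrightarrow> bes \<nu> \<in> borel_measurable borel"
  using continuous_on_bes[of \<nu> UNIV "\<lambda>x. x"] by (simp add: borel_measurable_continuous_onI continuous_on_id)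

text \<open>The relation I_\<nu> - I_(\<nu> + 2) = ((\<nu> + 1) / z) I_(\<nu> + 1) at the argument 2
  z, with w = z^2. It trades a small order for the two next ones.\<close>

lemma bes_recurrence:
  assumes "\<nu> > -1"
  shows "bes \<nu> w = (\<nu> + 1) * bes (\<nu> + 1) w + w * bes (\<nu> + 2) w"
proof -
  have s1: "(\<lambda>m. bes_coeff (\<nu> + 1) m * w ^ m) sums bes (\<nu> + 1) w"
    and s2: "(\<lambda>m. bes_coeff (\<nu> + 2) m * w ^ m) sums bes (\<nu> + 2) w"
    unfolding bes_def using assms by (auto intro!: summable_sums summable_bes)
  have "(\<lambda>m. w * (bes_coeff (\<nu> + 2) m * w ^ m)) sums (w * bes (\<nu> + 2) w)"
    by (intro sums_mult s2)
  moreover have "w * (bes_coeff (\<nu> + 2) m * w ^ m) = real (Suc m) * bes_coeff (\<nu> + 1) (Suc m) * w ^ Suc m" for m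
    using bes_coeff_Suc(1)[of "\<nu> + 1" m] assms by (simp add: add_ac)
  ultimately have "(\<lambda>m. real (Suc m) * bes_coeff (\<nu> + 1) (Suc m) * w ^ Suc m) sums (w * bes (\<nu> + 2) w)"
    by simp
  then have "(\<lambda>m. real m * bes_coeff (\<nu> + 1) m * w ^ m) sums (w * bes (\<nu> + 2) w)"
    by (subst (asm) sums_Suc_iff) simp
  from sums_add[OF sums_mult[OF s1, of "\<nu> + 1"] this]
  have "(\<lambda>m. bes_coeff \<nu> m * w ^ m) sums ((\<nu> + 1) * bes (\<nu> + 1) w + w * bes (\<nu> + 2) w)"
    using bes_coeff_Suc(2)[OF assms] by (simp add: algebra_simps)
  then show ?thesis unfolding bes_def by (simp add: sums_iff)
qed

lemma bes_pos:
  assumes "\<nu> > -1" "w \<ge> 0"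
  shows "bes \<nu> w > 0"
proof -
  have "bes_coeff \<nu> 0 > 0" using bes_coeff_pos[OF assms(1)] .
  then show ?thesis unfolding bes_def
    using suminf_pos2[OF summable_bes[OF assms(1)], of w 0] bes_coeff_pos[OF assms(1)] assms(2)
    by (simp add: less_imp_le)
qed

lemma bes_product_sums:
  assumes "\<alpha> > -1" "\<beta> > -1"
  shows "(\<lambda>N. bes_conv \<alpha> \<beta> \<xi> \<eta> N) sums (bes \<alpha> \<xi> * bes \<beta> \<eta>)"
proof -
  have "summable (\<lambda>m. norm (bes_coeff \<nu> m * w ^ m))" if "\<nu> > -1" for \<nu> w
    using summable_bes[OF that, of "\<bar>w\<bar>"] bes_coeff_pos[OF that] by (simp add: abs_mult power_abs less_imp_le)
  then show ?thesis
    unfolding bes_conv_def bes_def using assms by (intro Cauchy_product_sums) auto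
qed

section \<open>Integrals over the half line and termwise integration\<close>

lemma nn_integral_exp_powr:
  fixes a q :: real
  assumes a: "a > 0" and q: "q > 0"
  shows "(\<integral>\<^sup>+s. ennreal (exp (- a * s) * s powr (q - 1)) * indicator {0..} s \<partial>lborel)
     = ennreal (a powr (- q) * Gamma q)"
proof -
  define J where "J = (\<integral>\<^sup>+s. ennreal (exp (- a * s) * s powr (q - 1)) * indicator {0..} s \<partial>lborel)"
  define f where "f s = ennreal (s powr (q - 1) / exp s) * indicator {0..} s" for s :: real
  have f: "(\<integral>\<^sup>+s. f s \<partial>lborel) = ennreal (Gamma q)"
    unfolding f_def using nn_integral_has_integral_lebesgue'[OF _ Gamma_integral_real[OF q]] by simp
  have "(\<integral>\<^sup>+s. f s \<partial>lborel) = ennreal \<bar>a\<bar> * (\<integral>\<^sup>+s. f (0 + a * s) \<partial>lborel)"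
    using a by (intro nn_integral_real_affine) (simp_all add: f_def)
  also have "(\<integral>\<^sup>+s. f (0 + a * s) \<partial>lborel) = (\<integral>\<^sup>+s. ennreal (a powr q / a) * (ennreal (exp (- a * s) * s powr (q - 1)) * indicator {0..} s) \<partial>lborel)"
  proof (intro nn_integral_cong)
    fix s :: real
    have "(a * s) powr (q - 1) / exp (a * s) = (a powr q / a) * (exp (- a * s) * s powr (q - 1))" if "s \<ge> 0"
      using that a by (simp add: powr_mult powr_diff exp_minus field_simps)
    then show "f (0 + a * s) = ennreal (a powr q / a) * (ennreal (exp (- a * s) * s powr (q - 1)) * indicator {0..} s)"
      unfolding f_def using a by (auto simp: indicator_def ennreal_mult[symmetric] zero_le_mult_iff)
  qed
  also have "\<dots> = ennreal (a powr q / a) * J"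
    unfolding J_def by (rule nn_integral_cmult) simp
  also have "ennreal \<bar>a\<bar> * (ennreal (a powr q / a) * J) = ennreal (a powr q) * J"
  proof -
    have "ennreal \<bar>a\<bar> * ennreal (a powr q / a) = ennreal (a powr q)"
      using a by (subst ennreal_mult[symmetric]) auto
    then show ?thesis by (simp only: mult.assoc[symmetric])
  qed
  finally have "ennreal (Gamma q) = ennreal (a powr q) * J" unfolding f .
  then have "ennreal (a powr (- q)) * ennreal (Gamma q) = ennreal (a powr (- q)) * (ennreal (a powr q) * J)"
    by simp
  also have "\<dots> = J"
    using a by (simp add: mult.assoc[symmetric] ennreal_mult[symmetric] powr_minus)
  finally show ?thesis
    using Gamma_real_pos[OF q] unfolding J_def by (simp add: ennreal_mult[symmetric])
qed

text \<open>The difference of the exponentials is twice the derivative of their sum, so there is an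
  elementary primitive \<open>F\<close>; it vanishes at infinity, and the sum equals 2 at t =
  0.\<close>

lemma nn_integral_sinh_cosh:
  fixes q :: real
  assumes q: "q > 0"
  shows "(\<integral>\<^sup>+t. ennreal ((exp (t/2) - exp (- t/2)) * (exp (t/2) + exp (- t/2)) powr (- (q + 1))) * indicator {0..} t \<partial>lborel)
     = ennreal (2 / q * 2 powr (- q))"
proof -
  define F where "F t = - (2 / q) * (exp (t/2) + exp (- t/2)) powr (- q)" for t :: real
  have "(\<integral>\<^sup>+t. ennreal ((exp (t/2) - exp (- t/2)) * (exp (t/2) + exp (- t/2)) powr (- (q + 1))) * indicator {0..} t \<partial>lborel)
     = ennreal (0 - F 0)"
  proof (rule nn_integral_FTC_atLeast)
    fix t :: real assume t: "0 \<le> t"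
    have p: "exp (t/2) + exp (- t/2) > 0" by (simp add: add_pos_pos)
    show "(F has_real_derivative (exp (t/2) - exp (- t/2)) * (exp (t/2) + exp (- t/2)) powr (- (q + 1))) (at t)"
    proof -
      have "((\<lambda>t. exp (t/2) + exp (- t/2)) has_real_derivative (exp (t/2) - exp (- t/2)) / 2) (at t)"
        by (auto intro!: derivative_eq_intros)
      from DERIV_cmult[OF DERIV_fun_powr[OF this p, of "- q"], of "- (2 / q)"]
      show ?thesis unfolding F_def using q by (simp add: mult_ac)
    qed
    show "0 \<le> (exp (t/2) - exp (- t/2)) * (exp (t/2) + exp (- t/2)) powr (- (q + 1))"
      using t by (intro mult_nonneg_nonneg) auto
  next
    show "(F \<longlongrightarrow> 0) at_top"
    proof -
      have "filterlim (\<lambda>t::real. exp (t/2) + exp (- t/2)) at_top at_top" by real_asymp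
      then have "((\<lambda>t. (exp (t/2) + exp (- t/2)) powr (- q)) \<longlongrightarrow> 0) at_top"
        using q by (intro tendsto_neg_powr) auto
      from tendsto_mult_left[OF this, of "- (2/q)"] show ?thesis unfolding F_def by simp
    qed
  qed simp
  also have "0 - F 0 = 2 / q * 2 powr (- q)" unfolding F_def by simp
  finally show ?thesis .
qed

text \<open>With r = exp (- t) and V = 2 cosh (t / 2), r / (1 + r)^2 equals V powr (- 2), and the
  factor exp (- t L / 2) coming from the shifted frequencies, L = \<alpha> + \<beta> + 1,
  symmetrizes the rest. Each term becomes an integrand of
  \<open>nn_integral_sinh_cosh\<close>.\<close>

lemma jacobi_poisson_sums:
  fixes \<theta> \<phi> :: real
  assumes ab: "\<alpha> > -1/2" "\<beta> > -1/2" and t: "t > 0"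
  defines "X \<equiv> sin (\<theta> / 2) * sin (\<phi> / 2)" and "Y \<equiv> cos (\<theta> / 2) * cos (\<phi> / 2)"
  assumes X: "X > 0" and Y: "Y > 0" and XY: "X + Y < 1"
  shows "(\<lambda>N. gen_coeff \<alpha> \<beta> (X\<^sup>2) (Y\<^sup>2) N * ((exp (t/2) - exp (- t/2)) *
      (exp (t/2) + exp (- t/2)) powr (- (2 * real N + \<alpha> + \<beta> + 1 + 1)))) sums jacobi_poisson \<alpha> \<beta> t \<theta> \<phi>"
proof -
  define L where "L = \<alpha> + \<beta> + 1"
  have L: "L > 0" unfolding L_def using ab by simp
  define r where "r = exp (- t)"
  have r: "0 < r" "r < 1" unfolding r_def using t by auto
  define V where "V = exp (t/2) + exp (- t/2)"
  have V: "V > 0" unfolding V_def by (simp add: add_pos_pos)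
  have r1: "1 + r = V * exp (- t/2)" "1 - r = (exp (t/2) - exp (- t/2)) * exp (- t/2)"
    unfolding V_def r_def by (simp_all add: distrib_right left_diff_distrib mult_exp_exp)
  have "exp (- t * \<bar>real n + (\<alpha> + \<beta> + 1) / 2\<bar>) = exp (- t * L / 2) * r ^ n" for n
  proof -
    have "\<bar>real n + (\<alpha> + \<beta> + 1) / 2\<bar> = real n + L / 2" using L unfolding L_def by simp
    then have "exp (- t * \<bar>real n + (\<alpha> + \<beta> + 1) / 2\<bar>) = exp (- t * L / 2 + real n * (- t))"
      by (simp add: algebra_simps)
    then show ?thesis unfolding r_def exp_of_nat_mult[symmetric] exp_add[symmetric] .
  qed
  then have "jacobi_poisson \<alpha> \<beta> t \<theta> \<phi> = (\<Sum>n. exp (- t * L / 2) * (jacobi_fun n \<alpha> \<beta> \<theta> * jacobi_fun n \<alpha> \<beta> \<phi> * r ^ n))"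
    unfolding jacobi_poisson_def by (simp add: mult_ac)
  also have "\<dots> = exp (- t * L / 2) * ((1 - r) * (1 + r) powr (- (\<alpha> + \<beta> + 2)) * (\<Sum>N. gen_coeff \<alpha> \<beta> (X\<^sup>2) (Y\<^sup>2) N * (r / (1 + r)\<^sup>2) ^ N))"
    using sums_mult[OF jacobi_generating_sums[OF ab r X[unfolded X_def] Y[unfolded Y_def] XY[unfolded X_def Y_def]], of "exp (- t * L / 2)"]
    unfolding X_def Y_def by (simp add: sums_iff)
  finally have P: "jacobi_poisson \<alpha> \<beta> t \<theta> \<phi> = (exp (- t * L / 2) * (1 - r) * (1 + r) powr (- (\<alpha> + \<beta> + 2))) * (\<Sum>N. gen_coeff \<alpha> \<beta> (X\<^sup>2) (Y\<^sup>2) N * (r / (1 + r)\<^sup>2) ^ N)"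
    by simp
  have "4 * r \<le> (1 + r)\<^sup>2" using sum_squares_bound[of 1 r] by (simp add: power2_eq_square algebra_simps)
  then have "r / (1 + r)\<^sup>2 \<le> 1/4" using r by (simp add: pos_divide_le_eq)
  then have "4 * (X + Y)\<^sup>2 * (r / (1 + r)\<^sup>2) \<le> 4 * (X + Y)\<^sup>2 * (1/4)" by (intro mult_left_mono) auto
  also have "\<dots> < 1" using X Y XY by (simp add: power_less_one_iff)
  finally have z: "4 * (X + Y)\<^sup>2 * (r / (1 + r)\<^sup>2) < 1" .
  have "(\<lambda>N. gen_coeff \<alpha> \<beta> (X\<^sup>2) (Y\<^sup>2) N * (r / (1 + r)\<^sup>2) ^ N) sums (\<Sum>N. gen_coeff \<alpha> \<beta> (X\<^sup>2) (Y\<^sup>2) N * (r / (1 + r)\<^sup>2) ^ N)"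
    using ab X Y r z by (intro summable_sums summable_gen_coeff) auto
  from sums_mult[OF this, of "exp (- t * L / 2) * (1 - r) * (1 + r) powr (- (\<alpha> + \<beta> + 2))"]
  have "(\<lambda>N. exp (- t * L / 2) * (1 - r) * (1 + r) powr (- (\<alpha> + \<beta> + 2)) * (gen_coeff \<alpha> \<beta> (X\<^sup>2) (Y\<^sup>2) N * (r / (1 + r)\<^sup>2) ^ N))
     sums jacobi_poisson \<alpha> \<beta> t \<theta> \<phi>" unfolding P .
  then have "(\<lambda>N. gen_coeff \<alpha> \<beta> (X\<^sup>2) (Y\<^sup>2) N * (exp (- t * L / 2) * (1 - r) * (1 + r) powr (- (\<alpha> + \<beta> + 2)) * (r / (1 + r)\<^sup>2) ^ N))
     sums jacobi_poisson \<alpha> \<beta> t \<theta> \<phi>" by (simp only: mult_ac)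
  moreover have "exp (- t * L / 2) * (1 - r) * (1 + r) powr (- (\<alpha> + \<beta> + 2)) * (r / (1 + r)\<^sup>2) ^ N
     = (exp (t/2) - exp (- t/2)) * V powr (- (2 * real N + \<alpha> + \<beta> + 1 + 1))" for N
  proof -
    have "r / (1 + r)\<^sup>2 = V powr (- 2)"
    proof -
      have "(exp (- t/2))\<^sup>2 = r" unfolding r_def by (simp add: power2_eq_square mult_exp_exp)
      then have "r / (1 + r)\<^sup>2 = r / (V\<^sup>2 * r)" unfolding r1(1) power_mult_distrib by simp
      then show ?thesis using V r by (simp add: powr_minus divide_inverse)
    qed
    then have 1: "(r / (1 + r)\<^sup>2) ^ N = V powr (- 2 * real N)"
    proof -
      have "(V powr (- 2)) ^ N = (V powr (- 2)) powr real N" using V by (simp add: powr_realpow)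
      then show ?thesis using \<open>r / (1 + r)\<^sup>2 = V powr (- 2)\<close> by (simp add: powr_powr)
    qed
    have 2: "(1 + r) powr (- (\<alpha> + \<beta> + 2)) = V powr (- (L + 1)) * exp (t/2 * (L + 1))"
    proof -
      have "(exp (- t/2)) powr (- (L + 1)) = exp (t/2 * (L + 1))"
        by (simp add: powr_def field_simps)
      moreover have "- (\<alpha> + \<beta> + 2) = - (L + 1)" by (simp add: L_def)
      ultimately show ?thesis unfolding r1(1) using V by (simp only: powr_mult less_imp_le exp_ge_zero)
    qed
    have "exp (- t * L / 2) * (1 - r) * (1 + r) powr (- (\<alpha> + \<beta> + 2)) * (r / (1 + r)\<^sup>2) ^ N
      = (exp (- t * L / 2) * exp (- t/2) * exp (t/2 * (L + 1))) * (exp (t/2) - exp (- t/2)) * (V powr (- (L + 1)) * V powr (- 2 * real N))"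
      unfolding 1 2 r1(2) by (simp only: mult_ac)
    also have "exp (- t * L / 2) * exp (- t/2) * exp (t/2 * (L + 1)) = 1"
    proof -
      have "- t * L / 2 + - t/2 + t/2 * (L + 1) = 0" by (simp add: field_simps)
      then show ?thesis unfolding exp_add[symmetric] by simp
    qed
    also have "V powr (- (L + 1)) * V powr (- 2 * real N) = V powr (- (2 * real N + \<alpha> + \<beta> + 1 + 1))"
      unfolding powr_add[symmetric] by (simp add: L_def algebra_simps)
    finally show ?thesis by simp
  qed
  ultimately show ?thesis unfolding V_def by simp
qed

lemma bes_conv_scale: "bes_conv \<alpha> \<beta> (s * \<xi>) (s * \<eta>) N = s ^ N * bes_conv \<alpha> \<beta> \<xi> \<eta> N"
  unfolding bes_conv_def sum_distrib_left
proof (intro sum.cong refl)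
  fix m assume "m \<in> {..N}"
  then have "s ^ N = s ^ m * s ^ (N - m)" by (simp flip: power_add)
  then show "bes_coeff \<alpha> m * (s * \<xi>) ^ m * (bes_coeff \<beta> (N - m) * (s * \<eta>) ^ (N - m)) =
    s ^ N * (bes_coeff \<alpha> m * \<xi> ^ m * (bes_coeff \<beta> (N - m) * \<eta> ^ (N - m)))"
    by (simp add: power_mult_distrib mult_ac)
qed

text \<open>For nonnegative terms sum and integral commute in the extended half line, whether or not
  the result is finite. It serves for the expansion in t as well as for the one in s.\<close>

lemma nn_integral_sums_cmult:
  fixes f :: "nat \<Rightarrow> real \<Rightarrow> real"
  assumes [measurable]: "\<And>N. f N \<in> borel_measurable borel"
    and nn: "\<And>N s. s \<in> A \<Longrightarrow> 0 \<le> f N s" "\<And>N. 0 \<le> c N"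
    and sm: "\<And>s. s \<in> A \<Longrightarrow> (\<lambda>N. c N * f N s) sums F s"
    and I: "\<And>N. (\<integral>\<^sup>+s. ennreal (f N s) * indicator A s \<partial>lborel) = ennreal (d N)" "\<And>N. 0 \<le> d N"
    and A [measurable]: "A \<in> sets borel"
  shows "(\<integral>\<^sup>+s. ennreal (F s) * indicator A s \<partial>lborel) = (\<Sum>N. ennreal (c N * d N))"
proof -
  have "(\<integral>\<^sup>+s. ennreal (F s) * indicator A s \<partial>lborel)
      = (\<integral>\<^sup>+s. (\<Sum>N. ennreal (c N) * (ennreal (f N s) * indicator A s)) \<partial>lborel)"
  proof (intro nn_integral_cong)
    fix s
    show "ennreal (F s) * indicator A s = (\<Sum>N. ennreal (c N) * (ennreal (f N s) * indicator A s))"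
    proof (cases "s \<in> A")
      case True
      have "(\<Sum>N. ennreal (c N * f N s)) = ennreal (F s)"
        using sm[OF True] nn True by (subst suminf_ennreal_eq) auto
      then show ?thesis using True nn by (simp add: ennreal_mult)
    qed simp
  qed
  also have "\<dots> = (\<Sum>N. ennreal (c N) * ennreal (d N))"
    by (subst nn_integral_suminf) (auto simp: nn_integral_cmult I)
  finally show ?thesis using nn I by (simp add: ennreal_mult)
qed

text \<open>Integrating Bailey's series termwise in \<open>t\<close>, and expanding the right-hand side with
  \<open>\<integral> exp (- 2 s) s powr (q - 1) = 2 powr (- q) * Gamma q\<close>, gives the same series of positive terms.\<close>

lemma integral_jacobi_poisson:
  fixes \<theta> \<phi> :: real
  assumes ab: "\<alpha> > -1/2" "\<beta> > -1/2"
  defines "X \<equiv> sin (\<theta> / 2) * sin (\<phi> / 2)" and "Y \<equiv> cos (\<theta> / 2) * cos (\<phi> / 2)"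
  assumes X: "X > 0" and Y: "Y > 0" and XY: "X + Y < 1"
  shows "(LINT t:{0<..}|lborel. jacobi_poisson \<alpha> \<beta> t \<theta> \<phi>) =
     (LINT s:{0<..}|lborel. 2 * exp (- 2 * s) * s powr (\<alpha> + \<beta>) * (bes \<alpha> ((s * X)\<^sup>2) * bes \<beta> ((s * Y)\<^sup>2)))"
proof -
  define L where "L = \<alpha> + \<beta> + 1"
  have L: "L > 0" unfolding L_def using ab by simp
  have ab1: "\<alpha> > -1" "\<beta> > -1" using ab by auto
  define k where "k s = 2 * exp (- 2 * s) * s powr (\<alpha> + \<beta>) * (bes \<alpha> ((s * X)\<^sup>2) * bes \<beta> ((s * Y)\<^sup>2))" for s
  define P where "P t = jacobi_poisson \<alpha> \<beta> t \<theta> \<phi>" for t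
  have [measurable]: "bes \<alpha> \<in> borel_measurable borel" "bes \<beta> \<in> borel_measurable borel"
    using ab1 by measurable
  have km [measurable]: "k \<in> borel_measurable borel" unfolding k_def by measurable
  have Pm [measurable]: "P \<in> borel_measurable borel" unfolding P_def jacobi_poisson_def by measurable
  have AE0: "AE s in lborel. s \<noteq> (0::real)" by (rule AE_lborel_singleton)
  define c where "c N = bes_conv \<alpha> \<beta> (X\<^sup>2) (Y\<^sup>2) N" for N
  have c: "c N \<ge> 0" for N unfolding c_def using ab1 by (intro bes_conv_nonneg) auto
  define q where "q N = 2 * real N + L" for N :: nat
  have q: "q N > 0" for N unfolding q_def using L by simp
  define g where "g N = gen_coeff \<alpha> \<beta> (X\<^sup>2) (Y\<^sup>2) N" for N
  have g: "g N \<ge> 0" for N unfolding g_def using ab by (intro gen_coeff_nonneg) auto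
  have null: "(\<integral>\<^sup>+s. ennreal (f s) * indicator {0<..} s \<partial>lborel) = (\<integral>\<^sup>+s. ennreal (f s) * indicator {0..} s \<partial>lborel)"
    for f :: "real \<Rightarrow> real"
    by (intro nn_integral_cong_AE) (use AE0 in eventually_elim, auto simp: indicator_def)
  have I1: "(\<integral>\<^sup>+t. ennreal (P t) * indicator {0<..} t \<partial>lborel) = (\<Sum>N. ennreal (g N * (2 / q N * 2 powr (- q N))))"
  proof (rule nn_integral_sums_cmult)
    show "(\<lambda>N. g N * ((exp (t/2) - exp (- t/2)) * (exp (t/2) + exp (- t/2)) powr (- (q N + 1)))) sums P t"
      if "t \<in> {0<..}" for t
      using jacobi_poisson_sums[OF ab _ X[unfolded X_def] Y[unfolded Y_def] XY[unfolded X_def Y_def], of t] that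
      unfolding P_def g_def X_def Y_def q_def L_def by (simp add: add_ac)
    show "(\<integral>\<^sup>+t. ennreal ((exp (t/2) - exp (- t/2)) * (exp (t/2) + exp (- t/2)) powr (- (q N + 1))) * indicator {0<..} t \<partial>lborel)
     = ennreal (2 / q N * 2 powr (- q N))" for N
      unfolding null by (rule nn_integral_sinh_cosh[OF q])
    show "0 \<le> 2 / q N * 2 powr (- q N)" for N using q[of N] by simp
  qed (use g in auto)
  have I2: "(\<integral>\<^sup>+s. ennreal (k s) * indicator {0<..} s \<partial>lborel) = (\<Sum>N. ennreal ((2 * c N) * (2 powr (- q N) * Gamma (q N))))"
  proof (rule nn_integral_sums_cmult)
    show "(\<lambda>N. (2 * c N) * (exp (- 2 * s) * s powr (q N - 1))) sums k s" if "s \<in> {0<..}" for s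
    proof -
      have s: "s > 0" using that by simp
      have "(\<lambda>N. 2 * exp (- 2 * s) * s powr (\<alpha> + \<beta>) * bes_conv \<alpha> \<beta> ((s * X)\<^sup>2) ((s * Y)\<^sup>2) N) sums k s"
        unfolding k_def by (intro sums_mult bes_product_sums ab1)
      moreover have "2 * exp (- 2 * s) * s powr (\<alpha> + \<beta>) * bes_conv \<alpha> \<beta> ((s * X)\<^sup>2) ((s * Y)\<^sup>2) N
         = (2 * c N) * (exp (- 2 * s) * s powr (q N - 1))" for N
      proof -
        have "s powr (q N - 1) = s powr (\<alpha> + \<beta>) * (s\<^sup>2) ^ N"
        proof -
          have "(s\<^sup>2) ^ N = s powr real (2 * N)"
            unfolding powr_realpow[OF s] by (simp add: power_mult)
          moreover have "q N - 1 = (\<alpha> + \<beta>) + real (2 * N)" by (simp add: q_def L_def)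
          ultimately show ?thesis by (simp only: powr_add)
        qed
        then show ?thesis
          unfolding power_mult_distrib bes_conv_scale c_def by simp
      qed
      ultimately show ?thesis by (simp only:)
    qed
    show "(\<integral>\<^sup>+s. ennreal (exp (- 2 * s) * s powr (q N - 1)) * indicator {0<..} s \<partial>lborel)
     = ennreal (2 powr (- q N) * Gamma (q N))" for N
      unfolding null by (rule nn_integral_exp_powr) (use q in auto)
    show "0 \<le> 2 powr (- q N) * Gamma (q N)" for N using Gamma_real_pos[OF q[of N]] by simp
  qed (use c in auto)
  \<comment> \<open>The t-integral supplies 1 / q, which lowers Gamma (q + 1) in
    \<open>gen_coeff\<close> to the Gamma (q) of the s-integral.\<close>
  have "g N * (2 / q N * 2 powr (- q N)) = (2 * c N) * (2 powr (- q N) * Gamma (q N))" for N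
  proof -
    have "g N = q N * Gamma (q N) * c N"
      unfolding g_def gen_coeff_def c_def L_def[symmetric] q_def[symmetric] Gamma_plus1_pos[OF q] by simp
    then show ?thesis using q[of N] by simp
  qed
  then have eq: "(\<integral>\<^sup>+t. ennreal (P t) * indicator {0<..} t \<partial>lborel) = (\<integral>\<^sup>+s. ennreal (k s) * indicator {0<..} s \<partial>lborel)"
    unfolding I1 I2 by simp
  have P0: "P t \<ge> 0" if "t > 0" for t
  proof -
    have "(\<lambda>N. g N * ((exp (t/2) - exp (- t/2)) * (exp (t/2) + exp (- t/2)) powr (- (2 * real N + \<alpha> + \<beta> + 1 + 1)))) sums P t"
      using jacobi_poisson_sums[OF ab _ X[unfolded X_def] Y[unfolded Y_def] XY[unfolded X_def Y_def], of t] that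
      unfolding P_def g_def X_def Y_def by simp
    then show ?thesis
      by (rule sums_le[OF _ sums_zero, rotated]) (use that g in auto)
  qed
  have k0: "k s \<ge> 0" if "s > 0" for s
    unfolding k_def using bes_pos[OF ab1(1), of "(s * X)\<^sup>2"] bes_pos[OF ab1(2), of "(s * Y)\<^sup>2"] by simp
  \<comment> \<open>This also covers an infinite integral, where both sides are 0 by convention; the
    two integrals can be equated before either is known to converge.\<close>
  have conv: "(LINT s:{0<..}|lborel. f s) = enn2real (\<integral>\<^sup>+s. ennreal (f s) * indicator {0<..} s \<partial>lborel)"
    if [measurable]: "f \<in> borel_measurable borel" and "\<And>s. s > 0 \<Longrightarrow> f s \<ge> 0" for f :: "real \<Rightarrow> real"
  proof -
    have "(LINT s:{0<..}|lborel. f s) = enn2real (\<integral>\<^sup>+s. ennreal (indicator {0<..} s * f s) \<partial>lborel)"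
      unfolding set_lebesgue_integral_def using that(2)
      by (subst integral_eq_nn_integral) (auto simp: indicator_def)
    also have "(\<integral>\<^sup>+s. ennreal (indicator {0<..} s * f s) \<partial>lborel) = (\<integral>\<^sup>+s. ennreal (f s) * indicator {0<..} s \<partial>lborel)"
      by (intro nn_integral_cong) (auto simp: indicator_def)
    finally show ?thesis .
  qed
  show ?thesis
    using conv[OF Pm P0] conv[OF km k0] eq unfolding P_def k_def by simp
qed

lemma Gamma_legendre_duplication_real:
  fixes z :: real
  assumes "z > 0"
  shows "Gamma z * Gamma (z + 1/2) = 2 powr (1 - 2 * z) * sqrt pi * Gamma (2 * z)"
proof -
  have nz: "complex_of_real x \<notin> \<int>\<^sub>\<le>\<^sub>0" if "x > 0" for x
  proof
    assume "complex_of_real x \<in> \<int>\<^sub>\<le>\<^sub>0"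
    then obtain n :: nat where "complex_of_real x = - of_nat n" by (auto elim!: nonpos_Ints_cases')
    then have "x = - real n" by (metis of_real_eq_iff of_real_minus of_real_of_nat_eq)
    then show False using that by simp
  qed
  have "Gamma (complex_of_real z) * Gamma (complex_of_real z + 1/2) =
      exp ((1 - 2 * complex_of_real z) * of_real (ln 2)) * of_real (sqrt pi) * Gamma (2 * complex_of_real z)"
    using assms nz[of z] nz[of "z + 1/2"] by (intro Gamma_legendre_duplication) auto
  also have "complex_of_real z + 1/2 = of_real (z + 1/2)" by simp
  also have "2 * complex_of_real z = of_real (2 * z)" by simp
  also have "exp ((1 - of_real (2 * z)) * of_real (ln 2)) = complex_of_real (exp ((1 - 2 * z) * ln 2))"
    by (simp flip: exp_of_real)
  finally have "complex_of_real (Gamma z) * of_real (Gamma (z + 1/2)) = of_real (exp ((1 - 2 * z) * ln 2)) * of_real (sqrt pi) * of_real (Gamma (2 * z))"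
    by (simp only: Gamma_complex_of_real)
  then have "complex_of_real (Gamma z * Gamma (z + 1/2)) = of_real (exp ((1 - 2 * z) * ln 2) * sqrt pi * Gamma (2 * z))"
    by (simp only: of_real_mult)
  then have "Gamma z * Gamma (z + 1/2) = exp ((1 - 2 * z) * ln 2) * sqrt pi * Gamma (2 * z)"
    by (simp only: of_real_eq_iff)
  then show ?thesis by (simp add: powr_def)
qed

subsection \<open>Bounds for Bessel functions uniform in the order\<close>

definition gegen_weight :: "real \<Rightarrow> real \<Rightarrow> real" where
  "gegen_weight \<nu> u = (1 - u\<^sup>2) powr (\<nu> - 1/2)"

text \<open>For \<nu> > 1/2 the exponent is positive and the weight vanishes continuously at both
  endpoints, so every integral below has a continuous integrand on a compact interval.\<close>

lemma continuous_on_gegen_weight: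
  assumes "\<nu> > 1/2"
  shows "continuous_on {-1..1} (gegen_weight \<nu>)"
  unfolding gegen_weight_def[abs_def] using assms
  by (intro continuous_on_powr' continuous_intros) (auto simp: abs_square_le_1)

lemma gegen_weight_Suc: "u \<in> {-1..1} \<Longrightarrow> gegen_weight (\<nu> + 1) u = (1 - u\<^sup>2) * gegen_weight \<nu> u"
proof -
  assume u: "u \<in> {-1..1}"
  then have "1 - u\<^sup>2 \<ge> 0" by (auto simp: abs_square_le_1 abs_le_iff)
  moreover have "\<nu> + 1 - 1/2 = 1 + (\<nu> - 1/2)" by simp
  ultimately show ?thesis
    unfolding gegen_weight_def by (simp only: powr_add powr_one)
qed

lemma DERIV_gegen_weight_Suc:
  assumes "u \<in> {-1<..<1}"
  shows "(gegen_weight (\<nu> + 1) has_real_derivative (- (2 * \<nu> + 1) * u * gegen_weight \<nu> u)) (at u)"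
proof -
  have "1 - u\<^sup>2 > 0" using assms by (simp add: abs_square_less_1 abs_less_iff)
  moreover have "((\<lambda>u. 1 - u\<^sup>2) has_real_derivative (- 2 * u)) (at u)"
    by (auto intro!: derivative_eq_intros)
  ultimately have "((\<lambda>u. (1 - u\<^sup>2) powr (\<nu> + 1/2)) has_real_derivative ((\<nu> + 1/2) * (1 - u\<^sup>2) powr (\<nu> + 1/2 - of_nat 1) * (- 2 * u))) (at u)"
    by (intro DERIV_fun_powr)
  then show ?thesis unfolding gegen_weight_def[abs_def] by (simp add: algebra_simps)
qed

text \<open>The affine map from [0, 1] turns the integral into Beta (p, p) with p = \<nu> + 1/2, and
  Legendre's duplication formula turns that into the quotient of Gamma values half a unit
  apart.\<close>

lemma gegen_moment_0:
  assumes "\<nu> > 1/2"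
  shows "(gegen_weight \<nu> has_integral (sqrt pi * Gamma (\<nu> + 1/2) / Gamma (\<nu> + 1))) {-1..1}"
proof -
  define p where "p = \<nu> + 1/2"
  have p: "p > 0" using assms by (simp add: p_def)
  have "((\<lambda>t. t powr (p - 1) * (1 - t) powr (p - 1)) has_integral Beta p p) (cbox 0 1)"
    using has_integral_Beta_real[OF p p] by simp
  from has_integral_affinity'[OF this, of "1/2" "1/2"]
  have "((\<lambda>x. (1/2 * x + 1/2) powr (p - 1) * (1 - (1/2 * x + 1/2)) powr (p - 1)) has_integral (2 * Beta p p)) {-1..1}"
    by simp
  then have "((\<lambda>x. 4 powr (p - 1) * ((1/2 * x + 1/2) powr (p - 1) * (1 - (1/2 * x + 1/2)) powr (p - 1))) has_integral (4 powr (p - 1) * (2 * Beta p p))) {-1..1}"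
    by (rule has_integral_mult_right)
  moreover have "4 powr (p - 1) * ((1/2 * x + 1/2) powr (p - 1) * (1 - (1/2 * x + 1/2)) powr (p - 1)) = gegen_weight \<nu> x" if "x \<in> {-1..1}" for x :: real
  proof -
    have "1 - x\<^sup>2 = 4 * ((1/2 * x + 1/2) * (1 - (1/2 * x + 1/2)))" by (simp add: power2_eq_square algebra_simps)
    then have "gegen_weight \<nu> x = (4 * ((1/2 * x + 1/2) * (1 - (1/2 * x + 1/2)))) powr (p - 1)"
      unfolding gegen_weight_def p_def by simp
    also have "\<dots> = 4 powr (p - 1) * ((1/2 * x + 1/2) powr (p - 1) * (1 - (1/2 * x + 1/2)) powr (p - 1))"
      using that by (subst powr_mult; (subst powr_mult)?) auto
    finally show ?thesis by simp
  qed
  ultimately have "(gegen_weight \<nu> has_integral (4 powr (p - 1) * (2 * Beta p p))) {-1..1}"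
    by (rule has_integral_eq[rotated])
  moreover have "4 powr (p - 1) * (2 * Beta p p) = sqrt pi * Gamma (\<nu> + 1/2) / Gamma (\<nu> + 1)"
  proof -
    have g: "Gamma p > 0" "Gamma (p + 1/2) > 0" "Gamma (2 * p) > 0" using p by (auto intro!: Gamma_real_pos)
    have leg: "Gamma p * Gamma (p + 1/2) = 2 powr (1 - 2 * p) * sqrt pi * Gamma (2 * p)"
      by (rule Gamma_legendre_duplication_real[OF p])
    have "4 powr (p - 1) * 2 = 2 powr (2 * p - 1)"
    proof -
      have "(4::real) powr (p - 1) = (2 powr 2) powr (p - 1)" by simp
      also have "\<dots> = 2 powr (2 * p - 2)" unfolding powr_powr by (simp add: algebra_simps)
      finally have "(4::real) powr (p - 1) * 2 = 2 powr (2 * p - 2) * 2 powr 1" by simp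
      also have "\<dots> = 2 powr (2 * p - 1)" unfolding powr_add[symmetric] by simp
      finally show ?thesis .
    qed
    moreover have "2 powr (2 * p - 1) * (2 powr (1 - 2 * p) :: real) = 1"
      unfolding powr_add[symmetric] by simp
    ultimately have "4 powr (p - 1) * 2 * (Gamma p * Gamma (p + 1/2)) = sqrt pi * Gamma (2 * p)"
      unfolding leg by (simp add: mult.assoc[symmetric])
    moreover have "Beta p p = Gamma p * Gamma p / Gamma (2 * p)" by (simp add: Beta_def)
    moreover have e: "\<nu> + 1/2 = p" "\<nu> + 1 = p + 1/2" by (simp_all add: p_def)
    moreover have "4 powr (p - 1) * (2 * (G * G / H)) = S * G / G'"
      if "G > 0" "G' > 0" "H > 0" "4 powr (p - 1) * 2 * (G * G') = S * H" for G G' H S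
      using that by (simp add: divide_simps mult_ac)
    ultimately show ?thesis using g unfolding e by simp
  qed
  ultimately show ?thesis by simp
qed

text \<open>The integrand is the derivative of \<open>u ^ (n + 1)\<close> times the weight of index
  \<nu> + 1, a function that vanishes at both endpoints.\<close>

lemma gegen_moment_step:
  assumes "\<nu> > 1/2"
  shows "((\<lambda>u. (real n + 1) * (u ^ n * gegen_weight \<nu> u) - (real n + 2 + 2 * \<nu>) * (u ^ (n + 2) * gegen_weight \<nu> u)) has_integral 0) {-1..1}"
proof -
  have "((\<lambda>u. (real n + 1) * (u ^ n * gegen_weight \<nu> u) - (real n + 2 + 2 * \<nu>) * (u ^ (n + 2) * gegen_weight \<nu> u)) has_integral
     (1 ^ (n + 1) * gegen_weight (\<nu> + 1) 1 - (-1) ^ (n + 1) * gegen_weight (\<nu> + 1) (-1))) {-1..1}"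
  proof (rule fundamental_theorem_of_calculus_interior)
    show "continuous_on {-1..1} (\<lambda>u. u ^ (n + 1) * gegen_weight (\<nu> + 1) u)"
      using assms by (intro continuous_intros continuous_on_gegen_weight) auto
    fix u :: real assume u: "u \<in> {-1<..<1}"
    have "((\<lambda>u. u ^ (n + 1) * gegen_weight (\<nu> + 1) u) has_real_derivative
       (real (n + 1) * u ^ n * gegen_weight (\<nu> + 1) u + (- (2 * \<nu> + 1) * u * gegen_weight \<nu> u) * u ^ (n + 1))) (at u)"
      using DERIV_mult[OF DERIV_pow[of "n + 1" u] DERIV_gegen_weight_Suc[OF u]] by simp
    also have "real (n + 1) * u ^ n * gegen_weight (\<nu> + 1) u + (- (2 * \<nu> + 1) * u * gegen_weight \<nu> u) * u ^ (n + 1)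
       = (real n + 1) * (u ^ n * gegen_weight \<nu> u) - (real n + 2 + 2 * \<nu>) * (u ^ (n + 2) * gegen_weight \<nu> u)"
    proof -
      have W: "gegen_weight (\<nu> + 1) u = (1 - u\<^sup>2) * gegen_weight \<nu> u"
        using u by (intro gegen_weight_Suc) auto
      show ?thesis unfolding W by (simp add: power2_eq_square algebra_simps)
    qed
    finally show "((\<lambda>u. u ^ (n + 1) * gegen_weight (\<nu> + 1) u) has_vector_derivative
       (real n + 1) * (u ^ n * gegen_weight \<nu> u) - (real n + 2 + 2 * \<nu>) * (u ^ (n + 2) * gegen_weight \<nu> u)) (at u)"
      by (simp add: has_real_derivative_iff_has_vector_derivative)
  qed simp
  then show ?thesis by (simp add: gegen_weight_def)
qed

definition gegen_moment :: "real \<Rightarrow> nat \<Rightarrow> real" where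
  "gegen_moment \<nu> n = integral {-1..1} (\<lambda>u. u ^ n * gegen_weight \<nu> u)"

lemma has_integral_gegen_moment:
  assumes "\<nu> > 1/2"
  shows "((\<lambda>u. u ^ n * gegen_weight \<nu> u) has_integral gegen_moment \<nu> n) {-1..1}"
  unfolding gegen_moment_def using assms
  by (intro integrable_integral integrable_continuous_real continuous_intros continuous_on_gegen_weight)

lemma gegen_moment_rec:
  assumes "\<nu> > 1/2"
  shows "(real n + 2 + 2 * \<nu>) * gegen_moment \<nu> (n + 2) = (real n + 1) * gegen_moment \<nu> n"
proof -
  have "((\<lambda>u. (real n + 1) * (u ^ n * gegen_weight \<nu> u) - (real n + 2 + 2 * \<nu>) * (u ^ (n + 2) * gegen_weight \<nu> u)) has_integral
     ((real n + 1) * gegen_moment \<nu> n - (real n + 2 + 2 * \<nu>) * gegen_moment \<nu> (n + 2))) {-1..1}"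
    by (intro has_integral_diff has_integral_mult_right has_integral_gegen_moment assms)
  from has_integral_unique[OF this gegen_moment_step[OF assms]] show ?thesis by simp
qed

text \<open>The moment recursion descends to n = 1, where the integrand is a constant multiple of
  the derivative of the weight of index \<nu> + 1.\<close>

lemma gegen_moment_odd:
  assumes "\<nu> > 1/2"
  shows "odd n \<Longrightarrow> gegen_moment \<nu> n = 0"
proof (induction n rule: less_induct)
  case (less n)
  show ?case
  proof (cases "n = 1")
    case True
    have "((\<lambda>u. - (2 * \<nu> + 1) * u * gegen_weight \<nu> u) has_integral (gegen_weight (\<nu> + 1) 1 - gegen_weight (\<nu> + 1) (-1))) {-1..1}"
    proof (rule fundamental_theorem_of_calculus_interior)
      show "continuous_on {-1..1} (gegen_weight (\<nu> + 1))"
        using assms by (intro continuous_on_gegen_weight) auto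
      fix u :: real assume "u \<in> {-1<..<1}"
      then show "(gegen_weight (\<nu> + 1) has_vector_derivative - (2 * \<nu> + 1) * u * gegen_weight \<nu> u) (at u)"
        unfolding has_real_derivative_iff_has_vector_derivative[symmetric] by (rule DERIV_gegen_weight_Suc)
    qed simp
    then have "((\<lambda>u. - (2 * \<nu> + 1) * (u ^ 1 * gegen_weight \<nu> u)) has_integral 0) {-1..1}"
      by (simp add: gegen_weight_def mult.assoc)
    from has_integral_unique[OF this has_integral_mult_right[OF has_integral_gegen_moment[OF assms]]]
    show ?thesis using True assms by simp
  next
    case False
    then obtain m where m: "n = m + 2" using less.prems
      by (metis add_2_eq_Suc' even_zero not0_implies_Suc One_nat_def)
    then show ?thesis using less.IH[of m] less.prems gegen_moment_rec[OF assms, of m] assms by simp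
  qed
qed

text \<open>Normalized by the coefficients of the exponential series, the even moments satisfy the
  recursion of \<open>bes_coeff\<close>; the zeroth moment fixes the constant.\<close>

lemma gegen_moment_even:
  assumes "\<nu> > 1/2"
  shows "2 ^ (2 * m) / fact (2 * m) * gegen_moment \<nu> (2 * m) = sqrt pi * Gamma (\<nu> + 1/2) * bes_coeff \<nu> m"
proof (induction m)
  case 0
  have "gegen_moment \<nu> 0 = sqrt pi * Gamma (\<nu> + 1/2) / Gamma (\<nu> + 1)"
    using has_integral_unique[OF has_integral_gegen_moment[OF assms, of 0]] gegen_moment_0[OF assms] by simp
  then show ?case by (simp add: bes_coeff_def)
next
  case (Suc m)
  have p: "\<nu> + real m + 1 > 0" using assms by simp
  have G: "Gamma (\<nu> + real (Suc m) + 1) = (\<nu> + real m + 1) * Gamma (\<nu> + real m + 1)"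
    using Gamma_plus1_pos[OF p] by (simp add: add_ac)
  have b: "bes_coeff \<nu> (Suc m) = bes_coeff \<nu> m / ((real m + 1) * (\<nu> + real m + 1))"
    unfolding bes_coeff_def G by (simp add: add_ac)
  have r: "gegen_moment \<nu> (2 * m + 2) = (2 * real m + 1) / (2 * (\<nu> + real m + 1)) * gegen_moment \<nu> (2 * m)"
    using gegen_moment_rec[OF assms, of "2 * m"] p by (simp add: field_simps)
  have "2 ^ (2 * Suc m) / fact (2 * Suc m) * gegen_moment \<nu> (2 * Suc m) =
     (2 ^ (2 * m) / fact (2 * m) * gegen_moment \<nu> (2 * m)) / ((real m + 1) * (\<nu> + real m + 1))"
  proof -
    have e: "2 * Suc m = 2 * m + 2" by simp
    have f: "fact (2 * m + 2) = (2 * real m + 1) * (2 * (real m + 1)) * fact (2 * m)"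
      by (simp add: algebra_simps)
    have *: "A * 2 ^ 2 / (t * (2 * s) * F) * (t / (2 * q) * M) = A / F * M / (s * q)"
      if "t \<noteq> 0" "s \<noteq> 0" "q \<noteq> 0" "F \<noteq> 0" for A t s q F M :: real
      using that by (simp add: divide_simps)
    show ?thesis unfolding e f r power_add by (rule *) (use p in auto)
  qed
  then show ?case unfolding Suc b by simp
qed

text \<open>Poisson's integral. The weight is at most 1, so the exponential series converges
  uniformly on [-1, 1] and may be integrated term by term; odd moments drop out and even ones give
  the Bessel series.\<close>

lemma bes_has_integral:
  assumes "\<nu> > 1/2"
  shows "((\<lambda>u. exp (2 * z * u) * gegen_weight \<nu> u) has_integral (sqrt pi * Gamma (\<nu> + 1/2) * bes \<nu> (z\<^sup>2))) {-1..1}"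
proof -
  define f where "f n u = (2 * z) ^ n / fact n * (u ^ n * gegen_weight \<nu> u)" for n u
  have w: "0 \<le> gegen_weight \<nu> u" "gegen_weight \<nu> u \<le> 1" if "u \<in> {-1..1}" for u
    unfolding gegen_weight_def using that assms by (auto intro!: powr_le1 simp: abs_square_le_1)
  have "uniform_limit {-1..1} (\<lambda>n u. \<Sum>i<n. f i u) (\<lambda>u. suminf (\<lambda>i. f i u)) sequentially"
  proof (rule Weierstrass_m_test)
    show "summable (\<lambda>n. \<bar>2 * z\<bar> ^ n / fact n)"
      using summable_exp[of "\<bar>2 * z\<bar>"] by (simp add: field_simps)
    fix n and u :: real assume u: "u \<in> {-1..1}"
    have "norm (f n u) = \<bar>2 * z\<bar> ^ n / fact n * (\<bar>u\<bar> ^ n * gegen_weight \<nu> u)"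
      unfolding f_def using w[OF u] by (simp add: abs_mult power_abs)
    also have "\<dots> \<le> \<bar>2 * z\<bar> ^ n / fact n * (1 * 1)"
      using w[OF u] u by (intro mult_left_mono mult_mono power_le_one) auto
    finally show "norm (f n u) \<le> \<bar>2 * z\<bar> ^ n / fact n" by simp
  qed
  moreover have sumf: "suminf (\<lambda>i. f i u) = exp (2 * z * u) * gegen_weight \<nu> u" for u
  proof -
    have "(\<lambda>n. (2 * z * u) ^ n /\<^sub>R fact n * gegen_weight \<nu> u) sums (exp (2 * z * u) * gegen_weight \<nu> u)"
      by (intro sums_mult2 exp_converges)
    moreover have "(2 * z * u) ^ n /\<^sub>R fact n * gegen_weight \<nu> u = f n u" for n
      unfolding f_def by (simp add: power_mult_distrib divide_inverse)
    ultimately show ?thesis by (simp add: sums_iff)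
  qed
  ultimately have ul: "uniform_limit (cbox (-1) 1) (\<lambda>n u. \<Sum>i<n. f i u) (\<lambda>u. exp (2 * z * u) * gegen_weight \<nu> u) sequentially"
    by simp
  have "continuous_on (cbox (-1) 1) (\<lambda>u. \<Sum>i<n. f i u)" for n
    unfolding f_def using continuous_on_gegen_weight[OF assms] by (auto intro!: continuous_intros)
  from uniform_limit_integral_cbox[OF ul this trivial_limit_sequentially]
  obtain I J where IJ: "\<And>n. ((\<lambda>u. \<Sum>i<n. f i u) has_integral I n) {-1..1}"
    "((\<lambda>u. exp (2 * z * u) * gegen_weight \<nu> u) has_integral J) {-1..1}" "I \<longlonglongrightarrow> J"
    by auto
  have "I n = (\<Sum>i<n. (2 * z) ^ i / fact i * gegen_moment \<nu> i)" for n
    by (rule has_integral_unique[OF IJ(1)])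
       (unfold f_def, intro has_integral_sum has_integral_mult_right has_integral_gegen_moment assms, auto)
  then have "I = (\<lambda>n. \<Sum>i<n. (2 * z) ^ i / fact i * gegen_moment \<nu> i)" by (rule ext)
  then have J: "(\<lambda>i. (2 * z) ^ i / fact i * gegen_moment \<nu> i) sums J"
    using IJ(3) unfolding sums_def by (simp only:)
  moreover have "strict_mono (\<lambda>m::nat. 2 * m)" by (simp add: strict_mono_def)
  ultimately have "(\<lambda>m. (2 * z) ^ (2 * m) / fact (2 * m) * gegen_moment \<nu> (2 * m)) sums J"
    by (subst (asm) sums_mono_reindex[of "\<lambda>m. 2 * m", symmetric]) (auto intro!: gegen_moment_odd[OF assms])
  moreover have "(2 * z) ^ (2 * m) / fact (2 * m) * gegen_moment \<nu> (2 * m) = sqrt pi * Gamma (\<nu> + 1/2) * (bes_coeff \<nu> m * (z\<^sup>2) ^ m)" for m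
    using gegen_moment_even[OF assms, of m] by (simp add: power_mult_distrib power_mult[symmetric] field_simps)
  ultimately have "(\<lambda>m. sqrt pi * Gamma (\<nu> + 1/2) * (bes_coeff \<nu> m * (z\<^sup>2) ^ m)) sums J" by simp
  moreover have "(\<lambda>m. sqrt pi * Gamma (\<nu> + 1/2) * (bes_coeff \<nu> m * (z\<^sup>2) ^ m)) sums (sqrt pi * Gamma (\<nu> + 1/2) * bes \<nu> (z\<^sup>2))"
    unfolding bes_def using assms by (intro sums_mult summable_sums summable_bes) auto
  ultimately have "J = sqrt pi * Gamma (\<nu> + 1/2) * bes \<nu> (z\<^sup>2)" by (rule sums_unique2)
  then show ?thesis using IJ(2) by simp
qed

text \<open>Integration by parts against the weight of index \<nu> + 1. Subtracted from
  \<open>bes_has_integral\<close> it represents I_\<nu> - I_(\<nu> + 1) by an integral with the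
  extra factor 1 - u, which is both nonnegative and small where the exponential is large.\<close>

lemma bes_Suc_has_integral:
  assumes "\<nu> > 1/2"
  shows "((\<lambda>u. u * (exp (2 * z * u) * gegen_weight \<nu> u)) has_integral (sqrt pi * Gamma (\<nu> + 1/2) * (z * bes (\<nu> + 1) (z\<^sup>2)))) {-1..1}"
proof -
  have F: "((\<lambda>u. 2 * z * (exp (2 * z * u) * gegen_weight (\<nu> + 1) u) - (2 * \<nu> + 1) * (u * (exp (2 * z * u) * gegen_weight \<nu> u))) has_integral
     (exp (2 * z * 1) * gegen_weight (\<nu> + 1) 1 - exp (2 * z * (-1)) * gegen_weight (\<nu> + 1) (-1))) {-1..1}"
  proof (rule fundamental_theorem_of_calculus_interior)
    show "continuous_on {-1..1} (\<lambda>u. exp (2 * z * u) * gegen_weight (\<nu> + 1) u)"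
      using assms by (intro continuous_intros continuous_on_gegen_weight) auto
    fix u :: real assume u: "u \<in> {-1<..<1}"
    have "((\<lambda>u. exp (2 * z * u) * gegen_weight (\<nu> + 1) u) has_real_derivative
       (exp (2 * z * u) * (2 * z)) * gegen_weight (\<nu> + 1) u + (- (2 * \<nu> + 1) * u * gegen_weight \<nu> u) * exp (2 * z * u)) (at u)"
    proof -
      have "((\<lambda>u. exp (2 * z * u)) has_real_derivative exp (2 * z * u) * (2 * z)) (at u)"
        by (auto intro!: derivative_eq_intros)
      from DERIV_mult[OF this DERIV_gegen_weight_Suc[OF u]] show ?thesis .
    qed
    then show "((\<lambda>u. exp (2 * z * u) * gegen_weight (\<nu> + 1) u) has_vector_derivative
       2 * z * (exp (2 * z * u) * gegen_weight (\<nu> + 1) u) - (2 * \<nu> + 1) * (u * (exp (2 * z * u) * gegen_weight \<nu> u))) (at u)"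
      by (simp add: has_real_derivative_iff_has_vector_derivative[symmetric] algebra_simps)
  qed simp
  define B where "B = sqrt pi * Gamma (\<nu> + 1 + 1/2) * bes (\<nu> + 1) (z\<^sup>2)"
  have "((\<lambda>u. 2 * z * (exp (2 * z * u) * gegen_weight (\<nu> + 1) u)
     - (2 * z * (exp (2 * z * u) * gegen_weight (\<nu> + 1) u) - (2 * \<nu> + 1) * (u * (exp (2 * z * u) * gegen_weight \<nu> u)))) has_integral
     (2 * z * B - 0)) {-1..1}"
    using F assms unfolding B_def
    by (intro has_integral_diff has_integral_mult_right bes_has_integral) (auto simp: gegen_weight_def)
  then have "((\<lambda>u. (2 * \<nu> + 1) * (u * (exp (2 * z * u) * gegen_weight \<nu> u))) has_integral (2 * z * B)) {-1..1}"
    by simp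
  from has_integral_mult_right[OF this, of "1 / (2 * \<nu> + 1)"]
  have "((\<lambda>u. u * (exp (2 * z * u) * gegen_weight \<nu> u)) has_integral (1 / (2 * \<nu> + 1) * (2 * z * B))) {-1..1}"
    using assms by simp
  moreover have "Gamma (\<nu> + 1 + 1/2) = (\<nu> + 1/2) * Gamma (\<nu> + 1/2)"
    using Gamma_plus1_pos[of "\<nu> + 1/2"] assms by (simp add: add_ac)
  then have "1 / (2 * \<nu> + 1) * (2 * z * B) = sqrt pi * Gamma (\<nu> + 1/2) * (z * bes (\<nu> + 1) (z\<^sup>2))"
  proof -
    assume G: "Gamma (\<nu> + 1 + 1/2) = (\<nu> + 1/2) * Gamma (\<nu> + 1/2)"
    have "1 / (2 * \<nu> + 1) * (2 * z * (s * ((\<nu> + 1/2) * g) * b)) = s * g * (z * b)" for s g b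
      using assms by (simp add: field_simps)
    then show ?thesis unfolding B_def G .
  qed
  ultimately show ?thesis by simp
qed

text \<open>With v = 1 - u the weight is a power of v (2 - v), and 2 - v \<le> 2 exp (- v / 2) adds
  (\<nu> - 1/2) / 2 to the decay rate 2 z. This keeps track of large orders even for small z. What
  remains is a Gamma integral over the half line; a factor v powr k sharpens its decay by k
  powers.\<close>

lemma gegen_laplace_le:
  assumes \<nu>: "\<nu> > 1/2" and z: "z \<ge> 0" and k: "k \<ge> 0"
    and I: "((\<lambda>u. (1 - u) powr k * (exp (- 2 * z * (1 - u)) * gegen_weight \<nu> u)) has_integral I) {-1..1}"
  shows "I \<le> 2 powr (\<nu> - 1/2) * ((2 * z + (\<nu> - 1/2) / 2) powr (- (\<nu> + 1/2 + k)) * Gamma (\<nu> + 1/2 + k))"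
proof -
  define a where "a = 2 * z + (\<nu> - 1/2) / 2"
  define q where "q = \<nu> + 1/2 + k"
  have a: "a > 0" unfolding a_def using \<nu> z by (intro add_nonneg_pos) auto
  have q: "q > 0" unfolding q_def using \<nu> k by simp
  have G: "Gamma q > 0" by (rule Gamma_real_pos[OF q])
  define F where "F u = ennreal ((1 - u) powr k * (exp (- 2 * z * (1 - u)) * gegen_weight \<nu> u)) * indicator {-1..1} u" for u
  have [measurable]: "F \<in> borel_measurable borel"
    unfolding F_def gegen_weight_def by measurable
  have "ennreal I = (\<integral>\<^sup>+u. F u \<partial>lborel)"
    unfolding F_def by (rule nn_integral_has_integral_lebesgue'[OF _ I, symmetric]) (auto simp: gegen_weight_def)
  also have "\<dots> = ennreal \<bar>- 1\<bar> * (\<integral>\<^sup>+v. F (1 + (- 1) * v) \<partial>lborel)"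
    by (rule nn_integral_real_affine) auto
  also have "\<dots> = (\<integral>\<^sup>+v. F (1 - v) \<partial>lborel)" by simp
  also have "\<dots> \<le> (\<integral>\<^sup>+v. ennreal (2 powr (\<nu> - 1/2)) * (ennreal (exp (- a * v) * v powr (q - 1)) * indicator {0..} v) \<partial>lborel)"
  proof (rule nn_integral_mono)
    fix v :: real
    show "F (1 - v) \<le> ennreal (2 powr (\<nu> - 1/2)) * (ennreal (exp (- a * v) * v powr (q - 1)) * indicator {0..} v)"
    proof (cases "v \<in> {0..2}")
      case True
      have e: "2 - v \<le> 2 * exp (- v / 2)" using exp_ge_add_one_self[of "- v / 2"] by simp
      have "1 - (1 - v)\<^sup>2 = v * (2 - v)" by (simp add: power2_eq_square algebra_simps)
      then have "gegen_weight \<nu> (1 - v) = v powr (\<nu> - 1/2) * (2 - v) powr (\<nu> - 1/2)"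
        unfolding gegen_weight_def using True by (simp add: powr_mult)
      also have "\<dots> \<le> v powr (\<nu> - 1/2) * (2 * exp (- v / 2)) powr (\<nu> - 1/2)"
        using True \<nu> e by (intro mult_left_mono powr_mono2) auto
      also have "(2 * exp (- v / 2)) powr (\<nu> - 1/2) = 2 powr (\<nu> - 1/2) * exp (- ((\<nu> - 1/2) / 2) * v)"
        by (simp add: powr_mult exp_powr_real field_simps)
      finally have "v powr k * (exp (- 2 * z * v) * gegen_weight \<nu> (1 - v)) \<le>
         v powr k * (exp (- 2 * z * v) * (v powr (\<nu> - 1/2) * (2 powr (\<nu> - 1/2) * exp (- ((\<nu> - 1/2) / 2) * v))))"
        by (intro mult_left_mono) auto
      also have "\<dots> = 2 powr (\<nu> - 1/2) * ((exp (- 2 * z * v) * exp (- ((\<nu> - 1/2) / 2) * v)) * (v powr k * v powr (\<nu> - 1/2)))"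
        by (simp only: mult_ac)
      also have "exp (- 2 * z * v) * exp (- ((\<nu> - 1/2) / 2) * v) = exp (- a * v)"
        unfolding exp_add[symmetric] a_def by (simp add: algebra_simps)
      also have "v powr k * v powr (\<nu> - 1/2) = v powr (q - 1)"
        unfolding powr_add[symmetric] q_def by (simp add: algebra_simps)
      finally show ?thesis using True
        by (simp add: F_def indicator_def ennreal_mult[symmetric] ennreal_leI)
    qed (auto simp: F_def indicator_def)
  qed
  also have "\<dots> = ennreal (2 powr (\<nu> - 1/2)) * ennreal (a powr (- q) * Gamma q)"
    by (subst nn_integral_cmult, simp) (simp only: nn_integral_exp_powr[OF a q])
  also have "\<dots> = ennreal (2 powr (\<nu> - 1/2) * (a powr (- q) * Gamma q))"
    using G by (subst ennreal_mult) auto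
  finally show ?thesis
    using G by (subst (asm) ennreal_le_iff) (auto simp: a_def q_def)
qed

text \<open>The cases k = 0 and k = 1 of \<open>gegen_laplace_le\<close>. The Gamma values of
  Poisson's integral cancel, up to the factor \<nu> + 1/2 in the second case, so the constants do
  not depend on the order; sqrt pi \<ge> 1 and the negative powers of 2 are dropped.\<close>

lemma bes_exp_le:
  assumes \<nu>: "\<nu> > 1/2" and z: "z \<ge> 0"
  shows "exp (- 2 * z) * bes \<nu> (z\<^sup>2) \<le> (z + (\<nu> - 1/2) / 4) powr (- (\<nu> + 1/2))"
    and "0 \<le> exp (- 2 * z) * (bes \<nu> (z\<^sup>2) - z * bes (\<nu> + 1) (z\<^sup>2))"
    and "exp (- 2 * z) * (bes \<nu> (z\<^sup>2) - z * bes (\<nu> + 1) (z\<^sup>2)) \<le> (\<nu> + 1/2) * (z + (\<nu> - 1/2) / 4) powr (- (\<nu> + 3/2))"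
proof -
  define c where "c = z + (\<nu> - 1/2) / 4"
  have c: "c > 0" unfolding c_def using \<nu> z by (intro add_nonneg_pos) auto
  define g where "g = Gamma (\<nu> + 1/2)"
  have g: "g > 0" unfolding g_def using \<nu> by (intro Gamma_real_pos) auto
  have s1: "sqrt pi \<ge> 1" using pi_ge_two by simp
  have e: "exp (- 2 * z) * exp (2 * z * u) = exp (- 2 * z * (1 - u))" for u :: real
    unfolding exp_add[symmetric] by (simp add: algebra_simps)
  have sc: "2 powr (\<nu> - 1/2) * (2 * z + (\<nu> - 1/2) / 2) powr (- (\<nu> + 1/2 + k)) = 2 powr (- 1 - k) * c powr (- (\<nu> + 1/2 + k))" for k
  proof -
    have "2 * z + (\<nu> - 1/2) / 2 = 2 * c" unfolding c_def by simp
    then have "2 powr (\<nu> - 1/2) * (2 * z + (\<nu> - 1/2) / 2) powr (- (\<nu> + 1/2 + k))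
       = (2 powr (\<nu> - 1/2) * 2 powr (- (\<nu> + 1/2 + k))) * c powr (- (\<nu> + 1/2 + k))"
      using c by (simp add: powr_mult)
    also have "2 powr (\<nu> - 1/2) * 2 powr (- (\<nu> + 1/2 + k)) = (2::real) powr (- 1 - k)"
      unfolding powr_add[symmetric] by simp
    finally show ?thesis .
  qed
  have i0: "((\<lambda>u. exp (- 2 * z) * (exp (2 * z * u) * gegen_weight \<nu> u)) has_integral (exp (- 2 * z) * (sqrt pi * g * bes \<nu> (z\<^sup>2)))) {-1..1}"
    unfolding g_def by (intro has_integral_mult_right bes_has_integral \<nu>)
  have "((\<lambda>u. (1 - u) powr 0 * (exp (- 2 * z * (1 - u)) * gegen_weight \<nu> u)) has_integral (exp (- 2 * z) * (sqrt pi * g * bes \<nu> (z\<^sup>2)))) {-1..1}"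
  \<comment> \<open>\<open>0 powr 0\<close> is 0, so at u = 1 the factor
    \<open>(1 - u) powr 0\<close> is not 1 and that point is left out.\<close>
  proof (rule has_integral_spike_finite[OF _ _ i0])
    show "finite {1::real}" by simp
    fix u :: real assume "u \<in> {-1..1} - {1}"
    then show "(1 - u) powr 0 * (exp (- 2 * z * (1 - u)) * gegen_weight \<nu> u) = exp (- 2 * z) * (exp (2 * z * u) * gegen_weight \<nu> u)"
      unfolding e[symmetric] by simp
  qed
  from gegen_laplace_le[OF \<nu> z _ this]
  have "exp (- 2 * z) * (sqrt pi * g * bes \<nu> (z\<^sup>2)) \<le> 2 powr (- 1 - 0) * c powr (- (\<nu> + 1/2 + 0)) * Gamma (\<nu> + 1/2 + 0)"
    unfolding sc[symmetric] by (simp only: order_refl mult.assoc)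
  then have "g * (sqrt pi * (exp (- 2 * z) * bes \<nu> (z\<^sup>2))) \<le> g * (1/2 * c powr (- (\<nu> + 1/2)))"
    unfolding g_def by (simp add: powr_minus[of 2 1] mult_ac)
  then have 1: "sqrt pi * (exp (- 2 * z) * bes \<nu> (z\<^sup>2)) \<le> 1/2 * c powr (- (\<nu> + 1/2))"
    using g by (simp only: mult_le_cancel_left_pos)
  have "0 \<le> exp (- 2 * z) * bes \<nu> (z\<^sup>2)" using bes_pos[of \<nu> "z\<^sup>2"] \<nu> by simp
  then have "1 * (exp (- 2 * z) * bes \<nu> (z\<^sup>2)) \<le> sqrt pi * (exp (- 2 * z) * bes \<nu> (z\<^sup>2))"
    using s1 by (intro mult_right_mono) auto
  also note 1
  also have "1/2 * c powr (- (\<nu> + 1/2)) \<le> c powr (- (\<nu> + 1/2))" by simp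
  finally show "exp (- 2 * z) * bes \<nu> (z\<^sup>2) \<le> (z + (\<nu> - 1/2) / 4) powr (- (\<nu> + 1/2))"
    unfolding c_def by simp
  define R where "R = exp (- 2 * z) * (bes \<nu> (z\<^sup>2) - z * bes (\<nu> + 1) (z\<^sup>2))"
  have "((\<lambda>u. exp (- 2 * z) * (exp (2 * z * u) * gegen_weight \<nu> u - u * (exp (2 * z * u) * gegen_weight \<nu> u))) has_integral
      (exp (- 2 * z) * (sqrt pi * g * bes \<nu> (z\<^sup>2) - sqrt pi * g * (z * bes (\<nu> + 1) (z\<^sup>2))))) {-1..1}"
    unfolding g_def by (intro has_integral_mult_right has_integral_diff bes_has_integral bes_Suc_has_integral \<nu>)
  also have "exp (- 2 * z) * (sqrt pi * g * bes \<nu> (z\<^sup>2) - sqrt pi * g * (z * bes (\<nu> + 1) (z\<^sup>2))) = sqrt pi * g * R"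
    unfolding R_def by (simp add: algebra_simps)
  finally have "((\<lambda>u. exp (- 2 * z) * (exp (2 * z * u) * gegen_weight \<nu> u - u * (exp (2 * z * u) * gegen_weight \<nu> u))) has_integral (sqrt pi * g * R)) {-1..1}" .
  moreover have "exp (- 2 * z) * (exp (2 * z * u) * gegen_weight \<nu> u - u * (exp (2 * z * u) * gegen_weight \<nu> u))
     = (1 - u) powr 1 * (exp (- 2 * z * (1 - u)) * gegen_weight \<nu> u)" if "u \<in> {-1..1}" for u
    unfolding e[symmetric] using that by (simp add: algebra_simps)
  ultimately have i1: "((\<lambda>u. (1 - u) powr 1 * (exp (- 2 * z * (1 - u)) * gegen_weight \<nu> u)) has_integral (sqrt pi * g * R)) {-1..1}"
    by (rule has_integral_eq[rotated])
  have "0 \<le> sqrt pi * g * R"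
    by (rule has_integral_nonneg[OF i1]) (auto simp: gegen_weight_def)
  moreover have "sqrt pi * g > 0" using g by simp
  ultimately have R0: "R \<ge> 0" by (metis mult_pos_neg not_le)
  then show "0 \<le> exp (- 2 * z) * (bes \<nu> (z\<^sup>2) - z * bes (\<nu> + 1) (z\<^sup>2))" unfolding R_def .
  have G1: "Gamma (\<nu> + 1/2 + 1) = (\<nu> + 1/2) * g" unfolding g_def using \<nu> by (intro Gamma_plus1_pos) auto
  have "sqrt pi * g * R \<le> Gamma (\<nu> + 1/2 + 1) * (2 powr (- 1 - 1) * c powr (- (\<nu> + 1/2 + 1)))"
  proof -
    have "sqrt pi * g * R \<le> 2 powr (\<nu> - 1/2) * ((2 * z + (\<nu> - 1/2) / 2) powr (- (\<nu> + 1/2 + 1)) * Gamma (\<nu> + 1/2 + 1))"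
      by (rule gegen_laplace_le[OF \<nu> z _ i1]) simp
    also have "\<dots> = Gamma (\<nu> + 1/2 + 1) * (2 powr (- 1 - 1) * c powr (- (\<nu> + 1/2 + 1)))"
      unfolding sc[symmetric] by (simp only: mult_ac)
    finally show ?thesis .
  qed
  also have "\<dots> = g * ((\<nu> + 1/2) * (2 powr (-2) * c powr (- (\<nu> + 3/2))))"
  proof -
    have "- (\<nu> + 1/2 + 1) = - (\<nu> + 3/2)" "(- 1 - 1 :: real) = - 2" by simp_all
    then show ?thesis unfolding G1 by (simp only: mult_ac)
  qed
  finally have "g * (sqrt pi * R) \<le> g * ((\<nu> + 1/2) * (2 powr (-2) * c powr (- (\<nu> + 3/2))))"
    by (simp only: mult_ac)
  then have 2: "sqrt pi * R \<le> (\<nu> + 1/2) * (2 powr (-2) * c powr (- (\<nu> + 3/2)))"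
    using g by (simp only: mult_le_cancel_left_pos)
  have "1 * R \<le> sqrt pi * R" using s1 R0 by (intro mult_right_mono) auto
  also note 2
  also have "(\<nu> + 1/2) * (2 powr (-2) * c powr (- (\<nu> + 3/2))) \<le> (\<nu> + 1/2) * (1 * c powr (- (\<nu> + 3/2)))"
    using \<nu> by (intro mult_left_mono mult_right_mono) (auto simp: powr_minus)
  finally show "exp (- 2 * z) * (bes \<nu> (z\<^sup>2) - z * bes (\<nu> + 1) (z\<^sup>2)) \<le> (\<nu> + 1/2) * (z + (\<nu> - 1/2) / 4) powr (- (\<nu> + 3/2))"
    unfolding R_def c_def by simp
qed

section \<open>Elementary inequalities behind the decay in the order\<close>

lemma powr_Bernoulli:
  fixes x \<mu> :: real
  assumes "\<mu> \<ge> 1" "x \<ge> 0"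
  shows "1 + \<mu> * x \<le> (1 + x) powr \<mu>"
proof -
  define f where "f x = (1 + x) powr \<mu> - \<mu> * x" for x
  have "f 0 \<le> f x"
  proof (rule DERIV_nonneg_imp_nondecreasing[OF assms(2)])
    fix y :: real assume y: "0 \<le> y" "y \<le> x"
    have "((\<lambda>x. (1 + x) powr \<mu>) has_real_derivative (\<mu> * (1 + y) powr (\<mu> - of_nat 1) * 1)) (at y)"
    proof (rule DERIV_fun_powr)
      show "((\<lambda>x. 1 + x) has_real_derivative 1) (at y)" by (auto intro!: derivative_eq_intros)
    qed (use y in simp)
    from DERIV_diff[OF this DERIV_cmult_Id[of \<mu> y]]
    have "(f has_real_derivative (\<mu> * (1 + y) powr (\<mu> - of_nat 1) * 1 - \<mu>)) (at y)"
      unfolding f_def .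
    moreover have "(1 + y) powr (\<mu> - of_nat 1) \<ge> 1"
      using y assms by (intro ge_one_powr_ge_zero) auto
    then have "\<mu> * (1 + y) powr (\<mu> - of_nat 1) * 1 - \<mu> \<ge> 0"
      using assms mult_left_mono[of 1 "(1 + y) powr (\<mu> - of_nat 1)" \<mu>] by simp
    ultimately show "\<exists>d. (f has_real_derivative d) (at y) \<and> d \<ge> 0" by blast
  qed
  then show ?thesis by (simp add: f_def)
qed

text \<open>Bernoulli's inequality for (1 + c / z) powr \<mu>. Since c itself grows like \<mu>, the
  resulting threshold for z is of size \<mu>^2 and not only \<mu>.\<close>

lemma ratio_powr_le:
  fixes z c \<delta> \<mu> :: real
  assumes z: "z > 0" and d: "\<delta> > 0" and m: "\<mu> \<ge> 1" and c: "c \<ge> \<delta> * \<mu>"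
  shows "(z / (z + c)) powr \<mu> \<le> z / (z + \<delta> * \<mu>\<^sup>2)"
proof -
  have "\<delta> * \<mu> > 0" using d m by simp
  then have c0: "c > 0" using c by linarith
  have "1 + \<mu> * (\<delta> * \<mu> / z) \<le> (1 + \<delta> * \<mu> / z) powr \<mu>"
    using z d m by (intro powr_Bernoulli) auto
  also have "\<dots> \<le> (1 + c / z) powr \<mu>"
    using z d m c by (intro powr_mono2 add_left_mono divide_right_mono) auto
  finally have le: "(z + \<delta> * \<mu>\<^sup>2) / z \<le> ((z + c) / z) powr \<mu>"
    using z by (simp add: power2_eq_square add_divide_distrib mult_ac)
  have pos: "(z + \<delta> * \<mu>\<^sup>2) / z > 0" using z d by (intro divide_pos_pos add_pos_nonneg) auto
  have "(z / (z + c)) powr \<mu> = inverse (((z + c) / z) powr \<mu>)"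
    using z c0 by (simp add: powr_divide)
  also have "\<dots> \<le> inverse ((z + \<delta> * \<mu>\<^sup>2) / z)" by (rule le_imp_inverse_le[OF le pos])
  finally show ?thesis by simp
qed

text \<open>A geometric mean of z and \<delta> \<mu>^2 on the left, their sum on the right. It lets
  one factor \<mu> be absorbed at the price of half a power of 1 + z; the term 1 under the root is
  covered by (\<delta> \<mu>^2)^2.\<close>

lemma damping_denominator:
  fixes z \<delta> \<mu> :: real
  assumes "z > 0" "0 < \<delta>" "\<delta> \<le> 1" "\<mu> \<ge> 1"
  shows "\<delta> * \<mu> * sqrt (1 + z) \<le> z + \<delta> * \<mu>\<^sup>2"
proof (rule power2_le_imp_le)
  define e where "e = \<delta> * \<mu>\<^sup>2"
  have e: "e \<ge> 0" unfolding e_def using assms by simp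
  have 1: "(\<delta> * \<mu>)\<^sup>2 \<le> e"
    unfolding e_def using assms by (simp add: power2_eq_square mult_left_le_one_le)
  then have "(\<delta> * \<mu>)\<^sup>2 * z \<le> e * z" using assms by (intro mult_right_mono) auto
  moreover have "(\<delta> * \<mu>)\<^sup>2 \<le> e\<^sup>2"
    unfolding e_def using assms by (intro power_mono mult_left_mono) (auto simp: power2_eq_square)
  moreover have "(\<delta> * \<mu> * sqrt (1 + z))\<^sup>2 = (\<delta> * \<mu>)\<^sup>2 + (\<delta> * \<mu>)\<^sup>2 * z"
    using assms by (simp add: power_mult_distrib algebra_simps)
  moreover have "(z + e)\<^sup>2 = z\<^sup>2 + 2 * (e * z) + e\<^sup>2"
    by (simp add: power2_sum)
  moreover have "e * z \<ge> 0" using e assms by simp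
  ultimately show "(\<delta> * \<mu> * sqrt (1 + z))\<^sup>2 \<le> (z + \<delta> * \<mu>\<^sup>2)\<^sup>2"
    using zero_le_power2[of z] unfolding e_def[symmetric] by linarith
qed (use assms in auto)

text \<open>For z > 0 this is z powr (- \<alpha>) exp (- 2 z) I_(\<alpha> + \<mu>)(2 z). The
  normalization by \<alpha> alone is what remains when the weights \<open>u_fun\<close> have
  absorbed the powers depending on j.\<close>

definition ebes :: "real \<Rightarrow> real \<Rightarrow> real \<Rightarrow> real" where
  "ebes \<alpha> \<mu> z = exp (- 2 * z) * z powr \<mu> * bes (\<alpha> + \<mu>) (z\<^sup>2)"

text \<open>The same with I_(\<alpha> + \<mu>) - I_(\<alpha> + \<mu> + 1). The difference is kept
  together because it is nonnegative and decays one power faster than its two parts.\<close>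

definition rbes :: "real \<Rightarrow> real \<Rightarrow> real \<Rightarrow> real" where
  "rbes \<alpha> \<mu> z = exp (- 2 * z) * z powr \<mu> * (bes (\<alpha> + \<mu>) (z\<^sup>2) - z * bes (\<alpha> + \<mu> + 1) (z\<^sup>2))"

definition debes :: "real \<Rightarrow> real \<Rightarrow> real \<Rightarrow> real" where
  "debes \<alpha> \<mu> z = \<mu> * ebes \<alpha> \<mu> z / z - 2 * rbes \<alpha> \<mu> z"

lemma DERIV_ebes:
  assumes "z > 0" "\<alpha> + \<mu> > -1"
  shows "(ebes \<alpha> \<mu> has_real_derivative debes \<alpha> \<mu> z) (at z)"
proof -
  have "((\<lambda>z. exp (- 2 * z) * z powr \<mu> * bes (\<alpha> + \<mu>) (z\<^sup>2)) has_real_derivative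
     (exp (- 2 * z) * (- 2) * z powr \<mu> + \<mu> * z powr (\<mu> - 1) * exp (- 2 * z)) * bes (\<alpha> + \<mu>) (z\<^sup>2)
      + bes (\<alpha> + \<mu> + 1) (z\<^sup>2) * (2 * z) * (exp (- 2 * z) * z powr \<mu>)) (at z)"
    using assms by (intro DERIV_mult DERIV_bes has_real_derivative_powr) (auto intro!: derivative_eq_intros)
  also have "(exp (- 2 * z) * (- 2) * z powr \<mu> + \<mu> * z powr (\<mu> - 1) * exp (- 2 * z)) * bes (\<alpha> + \<mu>) (z\<^sup>2)
      + bes (\<alpha> + \<mu> + 1) (z\<^sup>2) * (2 * z) * (exp (- 2 * z) * z powr \<mu>) = debes \<alpha> \<mu> z"
    unfolding debes_def ebes_def rbes_def using assms by (simp add: powr_diff algebra_simps)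
  finally show ?thesis unfolding ebes_def[abs_def] .
qed

lemma ebes_nonneg: "\<alpha> + \<mu> > -1 \<Longrightarrow> ebes \<alpha> \<mu> z \<ge> 0"
  unfolding ebes_def using bes_pos[of "\<alpha> + \<mu>" "z\<^sup>2"] by (simp add: less_imp_le)

text \<open>The factor \<open>\<omega> = (z / (z + c)) powr \<mu>\<close> carries the decay in \<open>\<mu>\<close>; it comes from
  \<open>1 + u \<le> 2 exp ((u - 1) / 2)\<close> in the Poisson integral of the Bessel function.\<close>

lemma ebes_basic:
  assumes \<alpha>: "\<alpha> > -1/2"
  shows "\<exists>C>0. \<forall>\<mu>\<ge>1. \<forall>z>0. \<exists>\<omega>. 0 \<le> \<omega> \<and> \<omega> \<le> 1 \<and> \<mu> * \<omega> \<le> C * z * (1 + z) powr (-1/2) \<and> \<mu>\<^sup>2 * \<omega> \<le> C * z \<and>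
     (\<mu> \<ge> 2 \<longrightarrow> \<mu>\<^sup>2 * \<omega> \<le> C * z\<^sup>2 / (1 + z)) \<and>
     ebes \<alpha> \<mu> z \<le> C * \<omega> * (1 + z) powr (- \<alpha> - 1/2) \<and>
     0 \<le> rbes \<alpha> \<mu> z \<and> rbes \<alpha> \<mu> z \<le> C * \<mu> * \<omega> * (1 + z) powr (- \<alpha> - 3/2)"
proof -
  \<comment> \<open>\<open>c\<close> below is affine in \<mu> with slope 1/4 and has the value
    (\<alpha> + 1/2) / 4 at \<mu> = 1, so \<delta> \<mu> lies below it for every \<mu> \<ge>
    1.\<close>
  define \<delta> where "\<delta> = min (1/4) ((\<alpha> + 1/2) / 4)"
  have \<delta>: "0 < \<delta>" "\<delta> \<le> 1/4" "\<delta> \<le> (\<alpha> + 1/2) / 4"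
    unfolding \<delta>_def by (use \<alpha> in simp, rule min.cobounded1, rule min.cobounded2)
  define C where "C = 4 / \<delta>\<^sup>2 + \<delta> powr (- \<alpha> - 1/2) + (\<alpha> + 3/2) * \<delta> powr (- \<alpha> - 3/2)"
  have d1: "1 / \<delta> \<le> 4 / \<delta>\<^sup>2" "0 < 4 / \<delta>\<^sup>2" using \<delta> by (auto simp: power2_eq_square divide_simps)
  have C: "C > 0" "C \<ge> 4 / \<delta>\<^sup>2" "C \<ge> 1 / \<delta>" "C \<ge> \<delta> powr (- \<alpha> - 1/2)" "C \<ge> (\<alpha> + 3/2) * \<delta> powr (- \<alpha> - 3/2)"
    using d1 \<alpha> powr_ge_zero[of \<delta> "- \<alpha> - 1/2"] mult_nonneg_nonneg[of "\<alpha> + 3/2" "\<delta> powr (- \<alpha> - 3/2)"]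
    unfolding C_def by (auto simp: add_pos_nonneg add_increasing2 add_increasing)
  show ?thesis
  proof (rule exI[of _ C], intro conjI allI impI)
    show "C > 0" by fact
    fix \<mu> z :: real assume \<mu>: "\<mu> \<ge> 1" and z: "z > 0"
    define c where "c = (\<alpha> + \<mu> - 1/2) / 4"
    have c: "c \<ge> \<delta> * \<mu>"
    proof (cases "\<alpha> \<ge> 1/2")
      case True
      then have "c \<ge> 1/4 * \<mu>" unfolding c_def by simp
      moreover have "1/4 * \<mu> \<ge> \<delta> * \<mu>" using \<delta> \<mu> by (intro mult_right_mono) auto
      ultimately show ?thesis by linarith
    next
      case False
      have "(\<mu> - 1) * (1 - (\<alpha> + 1/2)) \<ge> 0" using False \<mu> by (intro mult_nonneg_nonneg) auto
      then have "c \<ge> (\<alpha> + 1/2) / 4 * \<mu>" unfolding c_def by (simp add: field_simps)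
      moreover have "(\<alpha> + 1/2) / 4 * \<mu> \<ge> \<delta> * \<mu>" using \<delta> \<mu> by (intro mult_right_mono) auto
      ultimately show ?thesis by linarith
    qed
    have "\<delta> * \<mu> > 0" using \<delta> \<mu> by simp
    then have c0: "c > 0" using c by linarith
    define \<omega> where "\<omega> = (z / (z + c)) powr \<mu>"
    define a where "a = 1 + z"
    have a: "a \<ge> 1" "a > 0" using z by (auto simp: a_def)
    have \<omega>1: "\<omega> \<le> z / (z + \<delta> * \<mu>\<^sup>2)" unfolding \<omega>_def using \<delta> \<mu> z c by (intro ratio_powr_le) auto
    have w0: "\<omega> \<ge> 0" unfolding \<omega>_def by simp
    have den: "z + \<delta> * \<mu>\<^sup>2 > 0" using z \<delta> by (intro add_pos_nonneg) auto
    have cz: "\<delta> * a \<le> z + c"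
    proof -
      have "\<delta> * z \<le> 1 * z" using \<delta> z by (intro mult_right_mono) auto
      moreover have "\<delta> * 1 \<le> \<delta> * \<mu>" using \<delta> \<mu> by (intro mult_left_mono) auto
      ultimately show ?thesis using c unfolding a_def by (simp add: distrib_left)
    qed
    have pw: "(z + c) powr (- p) \<le> \<delta> powr (- p) * a powr (- p)" if "p \<ge> 0" for p
    proof -
      have "(z + c) powr (- p) \<le> (\<delta> * a) powr (- p)"
        using cz \<delta> a that by (intro powr_mono2') auto
      then show ?thesis using \<delta> a by (simp add: powr_mult)
    qed
    show "\<exists>\<omega>. 0 \<le> \<omega> \<and> \<omega> \<le> 1 \<and> \<mu> * \<omega> \<le> C * z * (1 + z) powr (-1/2) \<and> \<mu>\<^sup>2 * \<omega> \<le> C * z \<and>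
     (\<mu> \<ge> 2 \<longrightarrow> \<mu>\<^sup>2 * \<omega> \<le> C * z\<^sup>2 / (1 + z)) \<and>
     ebes \<alpha> \<mu> z \<le> C * \<omega> * (1 + z) powr (- \<alpha> - 1/2) \<and>
     0 \<le> rbes \<alpha> \<mu> z \<and> rbes \<alpha> \<mu> z \<le> C * \<mu> * \<omega> * (1 + z) powr (- \<alpha> - 3/2)"
      unfolding a_def[symmetric]
    proof (intro exI[of _ \<omega>] conjI impI)
      show "0 \<le> \<omega>" by fact
      show "\<omega> \<le> 1" using \<omega>1 den z \<delta> by (rule_tac order_trans[OF \<omega>1]) (simp add: divide_simps)
      show "\<mu> * \<omega> \<le> C * z * a powr (-1/2)"
      proof -
        have dd: "\<delta> * \<mu> * sqrt a \<le> z + \<delta> * \<mu>\<^sup>2"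
          unfolding a_def using z \<delta> \<mu> by (intro damping_denominator) auto
        have pos: "\<delta> * \<mu> * sqrt a > 0" using \<delta> \<mu> a by simp
        have "\<mu> * \<omega> \<le> \<mu> * (z / (z + \<delta> * \<mu>\<^sup>2))" using \<omega>1 \<mu> by (intro mult_left_mono) auto
        also have "\<dots> \<le> \<mu> * (z / (\<delta> * \<mu> * sqrt a))"
          using \<mu> z dd mult_pos_pos[OF den pos] by (intro mult_left_mono divide_left_mono) auto
        also have "\<dots> = 1 / \<delta> * z * a powr (-1/2)"
          using \<mu> \<delta> a by (simp add: powr_minus powr_half_sqrt divide_simps)
        also have "\<dots> \<le> C * z * a powr (-1/2)" using C z by (intro mult_right_mono) auto
        finally show ?thesis .
      qed
      show "\<mu>\<^sup>2 * \<omega> \<le> C * z"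
      proof -
        have "\<mu>\<^sup>2 * \<omega> \<le> \<mu>\<^sup>2 * (z / (z + \<delta> * \<mu>\<^sup>2))" using \<omega>1 by (intro mult_left_mono) auto
        also have "\<dots> \<le> \<mu>\<^sup>2 * (z / (\<delta> * \<mu>\<^sup>2))"
          using \<mu> z \<delta> den by (intro mult_left_mono divide_left_mono mult_pos_pos) auto
        also have "\<dots> = 1 / \<delta> * z" using \<mu> by simp
        also have "\<dots> \<le> C * z" using C z by (intro mult_right_mono) auto
        finally show ?thesis .
      qed
      \<comment> \<open>For \<mu> \<ge> 2 the exponent can be halved and still satisfy Bernoulli's
        condition. Each half gains z / (\<mu> sqrt (1 + z)); the constant 2 \<delta> makes up for
        \<mu> / 2.\<close>
      show "\<mu>\<^sup>2 * \<omega> \<le> C * z\<^sup>2 / a" if "\<mu> \<ge> 2"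
      proof -
        have dd: "(2 * \<delta>) * (\<mu> / 2) * sqrt a \<le> z + (2 * \<delta>) * (\<mu> / 2)\<^sup>2"
          unfolding a_def using z \<delta> \<mu> that by (intro damping_denominator) auto
        have pos: "(2 * \<delta>) * (\<mu> / 2) * sqrt a > 0" using \<delta> \<mu> a by simp
        have "(z / (z + c)) powr (\<mu> / 2) \<le> z / (z + (2 * \<delta>) * (\<mu> / 2)\<^sup>2)"
          using z \<delta> that c by (intro ratio_powr_le) auto
        also have "\<dots> \<le> z / ((2 * \<delta>) * (\<mu> / 2) * sqrt a)"
        proof -
          have d2: "z + 2 * \<delta> * (\<mu> / 2)\<^sup>2 > 0" using z \<delta> by (intro add_pos_nonneg) auto
          show ?thesis
            by (rule divide_left_mono[OF dd less_imp_le[OF z]]) (rule mult_pos_pos[OF d2 pos] mult_pos_pos[OF pos d2])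
        qed
        finally have h: "(z / (z + c)) powr (\<mu> / 2) \<le> z / (\<delta> * \<mu> * sqrt a)" by (simp add: mult_ac)
        have "\<omega> = ((z / (z + c)) powr (\<mu> / 2))\<^sup>2"
          unfolding \<omega>_def power2_eq_square powr_add[symmetric] by simp
        also have "\<dots> \<le> (z / (\<delta> * \<mu> * sqrt a))\<^sup>2" by (intro power_mono h) auto
        also have "\<dots> = z\<^sup>2 / (\<delta>\<^sup>2 * \<mu>\<^sup>2 * a)" using a by (simp add: power_divide power_mult_distrib)
        finally have "\<mu>\<^sup>2 * \<omega> \<le> \<mu>\<^sup>2 * (z\<^sup>2 / (\<delta>\<^sup>2 * \<mu>\<^sup>2 * a))" by (intro mult_left_mono) auto
        also have "\<dots> = 1 / \<delta>\<^sup>2 * (z\<^sup>2 / a)" using \<mu> by simp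
        also have "\<dots> \<le> C * (z\<^sup>2 / a)"
          using C(2) a \<delta> by (intro mult_right_mono order_trans[OF _ C(2)]) (auto simp: divide_right_mono)
        finally show ?thesis by simp
      qed
      have \<nu>: "\<alpha> + \<mu> > 1/2" using \<alpha> \<mu> by simp
      note B = bes_exp_le[OF \<nu> less_imp_le[OF z], unfolded c_def[symmetric]]
      have zw: "z powr \<mu> * (z + c) powr (- \<mu>) = \<omega>"
        unfolding \<omega>_def using z c0 by (simp add: powr_divide powr_minus_divide)
      have spl: "(z + c) powr (- (\<alpha> + \<mu> + p)) = (z + c) powr (- \<mu>) * (z + c) powr (- (\<alpha> + p))" for p
        unfolding powr_add[symmetric] by (simp add: algebra_simps)
      show "ebes \<alpha> \<mu> z \<le> C * \<omega> * a powr (- \<alpha> - 1/2)"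
      proof -
        have "ebes \<alpha> \<mu> z \<le> z powr \<mu> * (z + c) powr (- (\<alpha> + \<mu> + 1/2))"
          unfolding ebes_def using mult_left_mono[OF B(1), of "z powr \<mu>"] by (simp add: mult_ac)
        also have "\<dots> = \<omega> * (z + c) powr (- (\<alpha> + 1/2))"
          unfolding spl zw[symmetric] by simp
        also have "\<dots> \<le> \<omega> * (\<delta> powr (- (\<alpha> + 1/2)) * a powr (- (\<alpha> + 1/2)))"
          using \<alpha> w0 by (intro mult_left_mono pw) auto
        also have "\<dots> = \<delta> powr (- \<alpha> - 1/2) * (\<omega> * a powr (- \<alpha> - 1/2))" by simp
        also have "\<dots> \<le> C * (\<omega> * a powr (- \<alpha> - 1/2))" using C w0 by (intro mult_right_mono) auto
        finally show ?thesis by simp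
      qed
      show "0 \<le> rbes \<alpha> \<mu> z"
        unfolding rbes_def using mult_nonneg_nonneg[OF powr_ge_zero[of z \<mu>] B(2)] by (simp add: mult_ac)
      show "rbes \<alpha> \<mu> z \<le> C * \<mu> * \<omega> * a powr (- \<alpha> - 3/2)"
      proof -
        have "rbes \<alpha> \<mu> z \<le> z powr \<mu> * ((\<alpha> + \<mu> + 1/2) * (z + c) powr (- (\<alpha> + \<mu> + 3/2)))"
          unfolding rbes_def using mult_left_mono[OF B(3), of "z powr \<mu>"] by (simp add: mult_ac)
        also have "\<dots> = (\<alpha> + \<mu> + 1/2) * (\<omega> * (z + c) powr (- (\<alpha> + 3/2)))"
          unfolding spl zw[symmetric] by simp
        also have "\<dots> \<le> ((\<alpha> + 3/2) * \<mu>) * (\<omega> * (\<delta> powr (- (\<alpha> + 3/2)) * a powr (- (\<alpha> + 3/2))))"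
        proof (intro mult_mono mult_left_mono pw)
          have "(\<alpha> + 1/2) * 1 \<le> (\<alpha> + 1/2) * \<mu>" using \<alpha> \<mu> by (intro mult_left_mono) auto
          then show "\<alpha> + \<mu> + 1/2 \<le> (\<alpha> + 3/2) * \<mu>" by (simp add: algebra_simps)
        qed (use \<alpha> \<mu> w0 in auto)
        also have "\<dots> = ((\<alpha> + 3/2) * \<delta> powr (- \<alpha> - 3/2)) * (\<mu> * \<omega> * a powr (- \<alpha> - 3/2))" by simp
        also have "\<dots> \<le> C * (\<mu> * \<omega> * a powr (- \<alpha> - 3/2))" using C w0 \<mu> by (intro mult_right_mono) auto
        finally show ?thesis by (simp add: mult_ac)
      qed
    qed
  qed
qed

text \<open>Here the order \<alpha> may lie at or below 1/2, outside the range of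
  \<open>bes_exp_le\<close>. The recurrence raises it to \<alpha> + 1 and \<alpha> + 2. For the
  derivative the same substitution leaves (\<alpha> + 1) times the function of order \<alpha> + 1
  minus z times the difference \<open>R1\<close> at that order, so the faster decay of the
  difference survives.\<close>

lemma ebes_zero_bounds:
  assumes \<alpha>: "\<alpha> > -1/2"
  shows "\<exists>C>0. \<forall>z>0. ebes \<alpha> 0 z \<le> C * (1 + z) powr (- \<alpha> - 1/2) \<and> \<bar>debes \<alpha> 0 z\<bar> \<le> C * (1 + z) powr (- \<alpha> - 1)"
proof -
  define \<delta> where "\<delta> = min 1 ((\<alpha> + 1/2) / 4)"
  have \<delta>: "0 < \<delta>" "\<delta> \<le> 1" "\<delta> \<le> (\<alpha> + 1/2) / 4"
    unfolding \<delta>_def by (use \<alpha> in simp, rule min.cobounded1, rule min.cobounded2)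
  define K where "K = \<delta> powr (- \<alpha> - 3/2) + \<delta> powr (- \<alpha> - 5/2)"
  have K: "K > 0" "\<delta> powr (- \<alpha> - 3/2) \<le> K" "\<delta> powr (- \<alpha> - 5/2) \<le> K" using \<delta> by (auto simp: K_def add_pos_pos)
  define C where "C = 2 * ((\<alpha> + 1) * K + (\<alpha> + 3/2) * K + K)"
  have aK: "(\<alpha> + 1) * K > 0" "(\<alpha> + 3/2) * K > 0" using \<alpha> K by auto
  have C: "C > 0" using aK K unfolding C_def by simp
  show ?thesis
  proof (intro exI[of _ C] conjI allI impI)
    show "C > 0" by fact
    fix z :: real assume z: "z > 0"
    define a where "a = 1 + z"
    have a: "a \<ge> 1" "a > 0" "z \<le> a" using z by (auto simp: a_def)
    have pw: "(z + c) powr (- p) \<le> \<delta> powr (- p) * a powr (- p)" if "p \<ge> 0" "c \<ge> \<delta>" for p c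
    proof -
      have "\<delta> * z \<le> 1 * z" using \<delta> z by (intro mult_right_mono) auto
      then have "\<delta> * a \<le> z + c" unfolding a_def using that(2) by (simp add: distrib_left)
      then have "(z + c) powr (- p) \<le> (\<delta> * a) powr (- p)"
        using \<delta> a that by (intro powr_mono2') auto
      then show ?thesis using \<delta> a by (simp add: powr_mult)
    qed
    have b1: "exp (- 2 * z) * bes (\<alpha> + 1) (z\<^sup>2) \<le> K * a powr (- \<alpha> - 3/2)"
    proof -
      have "exp (- 2 * z) * bes (\<alpha> + 1) (z\<^sup>2) \<le> (z + (\<alpha> + 1 - 1/2) / 4) powr (- (\<alpha> + 1 + 1/2))"
        using \<alpha> z by (intro bes_exp_le) auto
      also have "\<dots> \<le> \<delta> powr (- (\<alpha> + 1 + 1/2)) * a powr (- (\<alpha> + 1 + 1/2))"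
        using \<alpha> \<delta> by (intro pw) auto
      also have "- (\<alpha> + 1 + 1/2) = - \<alpha> - 3/2" by simp
      also have "\<delta> powr (- \<alpha> - 3/2) * a powr (- \<alpha> - 3/2) \<le> K * a powr (- \<alpha> - 3/2)"
        using K by (intro mult_right_mono) auto
      finally show ?thesis .
    qed
    have b2: "exp (- 2 * z) * bes (\<alpha> + 2) (z\<^sup>2) \<le> K * a powr (- \<alpha> - 5/2)"
    proof -
      have "exp (- 2 * z) * bes (\<alpha> + 2) (z\<^sup>2) \<le> (z + (\<alpha> + 2 - 1/2) / 4) powr (- (\<alpha> + 2 + 1/2))"
        using \<alpha> z by (intro bes_exp_le) auto
      also have "\<dots> \<le> \<delta> powr (- (\<alpha> + 2 + 1/2)) * a powr (- (\<alpha> + 2 + 1/2))"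
        using \<alpha> \<delta> by (intro pw) auto
      also have "- (\<alpha> + 2 + 1/2) = - \<alpha> - 5/2" by simp
      also have "\<delta> powr (- \<alpha> - 5/2) * a powr (- \<alpha> - 5/2) \<le> K * a powr (- \<alpha> - 5/2)"
        using K by (intro mult_right_mono) auto
      finally show ?thesis .
    qed
    define R1 where "R1 = exp (- 2 * z) * (bes (\<alpha> + 1) (z\<^sup>2) - z * bes (\<alpha> + 1 + 1) (z\<^sup>2))"
    have R1: "0 \<le> R1" "R1 \<le> (\<alpha> + 3/2) * K * a powr (- \<alpha> - 5/2)"
    proof -
      have \<nu>: "\<alpha> + 1 > 1/2" using \<alpha> by simp
      note B = bes_exp_le[OF \<nu> less_imp_le[OF z]]
      show "0 \<le> R1" unfolding R1_def by (rule B(2))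
      have "R1 \<le> (\<alpha> + 1 + 1/2) * (z + (\<alpha> + 1 - 1/2) / 4) powr (- (\<alpha> + 1 + 3/2))"
        unfolding R1_def by (rule B(3))
      also have "\<dots> \<le> (\<alpha> + 1 + 1/2) * (\<delta> powr (- (\<alpha> + 1 + 3/2)) * a powr (- (\<alpha> + 1 + 3/2)))"
        using \<alpha> \<delta> by (intro mult_left_mono pw) auto
      also have "- (\<alpha> + 1 + 3/2) = - \<alpha> - 5/2" by simp
      also have "\<alpha> + 1 + 1/2 = \<alpha> + 3/2" by simp
      also have "(\<alpha> + 3/2) * (\<delta> powr (- \<alpha> - 5/2) * a powr (- \<alpha> - 5/2)) \<le> (\<alpha> + 3/2) * (K * a powr (- \<alpha> - 5/2))"
        using K \<alpha> by (intro mult_left_mono mult_right_mono) auto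
      finally show "R1 \<le> (\<alpha> + 3/2) * K * a powr (- \<alpha> - 5/2)" by simp
    qed
    have rec: "bes \<alpha> (z\<^sup>2) = (\<alpha> + 1) * bes (\<alpha> + 1) (z\<^sup>2) + z\<^sup>2 * bes (\<alpha> + 2) (z\<^sup>2)"
      using \<alpha> by (intro bes_recurrence) auto
    have pm: "a powr p \<le> a powr q" if "p \<le> q" for p q using a that by (intro powr_mono) auto
    have z5: "z * a powr (- \<alpha> - 5/2) \<le> a powr (- \<alpha> - 3/2)"
    proof -
      have "z * a powr (- \<alpha> - 5/2) \<le> a powr 1 * a powr (- \<alpha> - 5/2)" using a by (intro mult_right_mono) auto
      also have "a powr 1 * a powr (- \<alpha> - 5/2) = a powr (- \<alpha> - 3/2)"
        unfolding powr_add[symmetric] by (rule arg_cong[where f = "(powr) a"]) simp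
      finally show ?thesis .
    qed
    have z25: "z\<^sup>2 * a powr (- \<alpha> - 5/2) \<le> a powr (- \<alpha> - 1/2)"
    proof -
      have "z\<^sup>2 * a powr (- \<alpha> - 5/2) \<le> a\<^sup>2 * a powr (- \<alpha> - 5/2)" using a z by (intro mult_right_mono power_mono) auto
      also have "a\<^sup>2 = a powr 2" using a by simp
      also have "a powr 2 * a powr (- \<alpha> - 5/2) = a powr (- \<alpha> - 1/2)"
        unfolding powr_add[symmetric] by (rule arg_cong[where f = "(powr) a"]) simp
      finally show ?thesis .
    qed
    have "ebes \<alpha> 0 z = (\<alpha> + 1) * (exp (- 2 * z) * bes (\<alpha> + 1) (z\<^sup>2)) + z\<^sup>2 * (exp (- 2 * z) * bes (\<alpha> + 2) (z\<^sup>2))"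
      unfolding ebes_def using z rec by (simp add: algebra_simps)
    also have "\<dots> \<le> (\<alpha> + 1) * (K * a powr (- \<alpha> - 1/2)) + K * a powr (- \<alpha> - 1/2)"
    proof (intro add_mono mult_left_mono)
      show "exp (- 2 * z) * bes (\<alpha> + 1) (z\<^sup>2) \<le> K * a powr (- \<alpha> - 1/2)"
        by (rule order_trans[OF b1]) (use K pm in auto)
      have "z\<^sup>2 * (exp (- 2 * z) * bes (\<alpha> + 2) (z\<^sup>2)) \<le> z\<^sup>2 * (K * a powr (- \<alpha> - 5/2))"
        by (intro mult_left_mono b2) auto
      also have "\<dots> = K * (z\<^sup>2 * a powr (- \<alpha> - 5/2))" by simp
      also have "\<dots> \<le> K * a powr (- \<alpha> - 1/2)" using K z25 by (intro mult_left_mono) auto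
      finally show "z\<^sup>2 * (exp (- 2 * z) * bes (\<alpha> + 2) (z\<^sup>2)) \<le> K * a powr (- \<alpha> - 1/2)" .
    qed (use \<alpha> in auto)
    also have "\<dots> = ((\<alpha> + 1) * K + K) * a powr (- \<alpha> - 1/2)" by (simp add: algebra_simps)
    also have "\<dots> \<le> C * a powr (- \<alpha> - 1/2)"
    proof (rule mult_right_mono)
      have "U + K \<le> 2 * (U + V + K)" if "U > 0" "V > 0" for U V using that K by simp
      then show "(\<alpha> + 1) * K + K \<le> C" using aK unfolding C_def by blast
    qed simp
    finally show "ebes \<alpha> 0 z \<le> C * (1 + z) powr (- \<alpha> - 1/2)" unfolding a_def .
    have "rbes \<alpha> 0 z = (\<alpha> + 1) * (exp (- 2 * z) * bes (\<alpha> + 1) (z\<^sup>2)) - z * R1"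
      unfolding rbes_def R1_def using z rec by (simp add: algebra_simps power2_eq_square)
    then have "\<bar>debes \<alpha> 0 z\<bar> \<le> 2 * (\<bar>(\<alpha> + 1) * (exp (- 2 * z) * bes (\<alpha> + 1) (z\<^sup>2))\<bar> + \<bar>z * R1\<bar>)"
    proof -
      assume R: "rbes \<alpha> 0 z = (\<alpha> + 1) * (exp (- 2 * z) * bes (\<alpha> + 1) (z\<^sup>2)) - z * R1"
      have "\<bar>0 * e / z - 2 * (x - y)\<bar> \<le> 2 * (\<bar>x\<bar> + \<bar>y\<bar>)" for e x y :: real by simp
      then show ?thesis unfolding debes_def R .
    qed
    also have "\<bar>(\<alpha> + 1) * (exp (- 2 * z) * bes (\<alpha> + 1) (z\<^sup>2))\<bar> = (\<alpha> + 1) * (exp (- 2 * z) * bes (\<alpha> + 1) (z\<^sup>2))"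
      using \<alpha> bes_pos[of "\<alpha> + 1" "z\<^sup>2"] by simp
    also have "\<bar>z * R1\<bar> = z * R1" using z R1 by simp
    also have "2 * ((\<alpha> + 1) * (exp (- 2 * z) * bes (\<alpha> + 1) (z\<^sup>2)) + z * R1)
       \<le> 2 * ((\<alpha> + 1) * (K * a powr (- \<alpha> - 3/2)) + (\<alpha> + 3/2) * K * a powr (- \<alpha> - 3/2))"
    proof (intro mult_left_mono add_mono b1)
      have "z * R1 \<le> z * ((\<alpha> + 3/2) * K * a powr (- \<alpha> - 5/2))" using z R1 by (intro mult_left_mono) auto
      also have "\<dots> = (\<alpha> + 3/2) * K * (z * a powr (- \<alpha> - 5/2))" by simp
      also have "\<dots> \<le> (\<alpha> + 3/2) * K * a powr (- \<alpha> - 3/2)" using z5 aK by (intro mult_left_mono) auto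
      finally show "z * R1 \<le> (\<alpha> + 3/2) * K * a powr (- \<alpha> - 3/2)" .
    qed (use \<alpha> in auto)
    also have "\<dots> = 2 * ((\<alpha> + 1) * K + (\<alpha> + 3/2) * K) * a powr (- \<alpha> - 3/2)" by (simp add: algebra_simps)
    also have "\<dots> \<le> C * a powr (- \<alpha> - 1)"
    proof (rule mult_mono)
      show "2 * ((\<alpha> + 1) * K + (\<alpha> + 3/2) * K) \<le> C" using K unfolding C_def by simp
      show "a powr (- \<alpha> - 3/2) \<le> a powr (- \<alpha> - 1)" by (rule pm) simp
    qed (use C in auto)
    finally show "\<bar>debes \<alpha> 0 z\<bar> \<le> C * (1 + z) powr (- \<alpha> - 1)" unfolding a_def .
  qed
qed

text \<open>Bounds without gain in \<mu>, for the factor of order \<beta> + \<kappa>. The half power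
  by which the derivative decays faster is what its extra factor s y' or s y requires.\<close>

lemma ebes_size:
  assumes \<alpha>: "\<alpha> > -1/2"
  shows "\<exists>C>0. \<forall>\<mu>. \<mu> = 0 \<or> \<mu> \<ge> 1 \<longrightarrow> (\<forall>z>0. ebes \<alpha> \<mu> z \<le> C * (1 + z) powr (- \<alpha> - 1/2) \<and>
    \<bar>debes \<alpha> \<mu> z\<bar> \<le> C * (1 + z) powr (- \<alpha> - 1))"
proof -
  obtain C where C: "C > 0" and B: "\<And>\<mu> z. \<mu> \<ge> 1 \<Longrightarrow> z > 0 \<Longrightarrow> \<exists>\<omega>. 0 \<le> \<omega> \<and> \<omega> \<le> 1 \<and> \<mu> * \<omega> \<le> C * z * (1 + z) powr (-1/2) \<and> \<mu>\<^sup>2 * \<omega> \<le> C * z \<and>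
     (\<mu> \<ge> 2 \<longrightarrow> \<mu>\<^sup>2 * \<omega> \<le> C * z\<^sup>2 / (1 + z)) \<and>
     ebes \<alpha> \<mu> z \<le> C * \<omega> * (1 + z) powr (- \<alpha> - 1/2) \<and>
     0 \<le> rbes \<alpha> \<mu> z \<and> rbes \<alpha> \<mu> z \<le> C * \<mu> * \<omega> * (1 + z) powr (- \<alpha> - 3/2)"
    using ebes_basic[OF \<alpha>] by blast
  obtain C0 where C0: "C0 > 0" and B0: "\<And>z. z > 0 \<Longrightarrow> ebes \<alpha> 0 z \<le> C0 * (1 + z) powr (- \<alpha> - 1/2)"
    "\<And>z. z > 0 \<Longrightarrow> \<bar>debes \<alpha> 0 z\<bar> \<le> C0 * (1 + z) powr (- \<alpha> - 1)"
    using ebes_zero_bounds[OF \<alpha>] by blast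
  define K where "K = C + 3 * C\<^sup>2 + C0"
  have K: "K > 0" "K \<ge> C" "K \<ge> 3 * C\<^sup>2" "K \<ge> C0" using C C0 by (auto simp: K_def add_pos_pos)
  show ?thesis
  proof (intro exI[of _ K] conjI allI impI)
    show "K > 0" by fact
    fix \<mu> z :: real assume \<mu>: "\<mu> = 0 \<or> \<mu> \<ge> 1" and z: "z > 0"
    show "ebes \<alpha> \<mu> z \<le> K * (1 + z) powr (- \<alpha> - 1/2)"
    proof (cases "\<mu> = 0")
      case True
      have "C0 * (1 + z) powr (- \<alpha> - 1/2) \<le> K * (1 + z) powr (- \<alpha> - 1/2)" using K by (intro mult_right_mono) auto
      then show ?thesis using B0(1)[OF z] True by simp
    next
      case False
      then have "\<mu> \<ge> 1" using \<mu> by simp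
      from B[OF this z] obtain \<omega> where w: "0 \<le> \<omega>" "\<omega> \<le> 1" "ebes \<alpha> \<mu> z \<le> C * \<omega> * (1 + z) powr (- \<alpha> - 1/2)" by blast
      note w(3)
      also have "C * \<omega> * (1 + z) powr (- \<alpha> - 1/2) \<le> (K * 1) * (1 + z) powr (- \<alpha> - 1/2)"
        using K C w by (intro mult_right_mono mult_mono) auto
      finally show ?thesis by simp
    qed
    show "\<bar>debes \<alpha> \<mu> z\<bar> \<le> K * (1 + z) powr (- \<alpha> - 1)"
    proof (cases "\<mu> = 0")
      case True
      have "C0 * (1 + z) powr (- \<alpha> - 1) \<le> K * (1 + z) powr (- \<alpha> - 1)" using K by (intro mult_right_mono) auto
      then show ?thesis using B0(2)[OF z] True by simp
    next
      case False
      then have m: "\<mu> \<ge> 1" using \<mu> by simp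
      define a where "a = 1 + z"
      have a: "a > 0" "z \<le> a" using z by (auto simp: a_def)
      from B[OF m z] obtain \<omega> where w: "0 \<le> \<omega>" "\<mu> * \<omega> \<le> C * z * a powr (-1/2)"
        "ebes \<alpha> \<mu> z \<le> C * \<omega> * a powr (- \<alpha> - 1/2)"
        "0 \<le> rbes \<alpha> \<mu> z" "rbes \<alpha> \<mu> z \<le> C * \<mu> * \<omega> * a powr (- \<alpha> - 3/2)" unfolding a_def by blast
      have e0: "ebes \<alpha> \<mu> z \<ge> 0" using m \<alpha> by (intro ebes_nonneg) auto
      have 1: "\<mu> * ebes \<alpha> \<mu> z / z \<le> C\<^sup>2 * a powr (- \<alpha> - 1)"
      proof -
        have "\<mu> * ebes \<alpha> \<mu> z / z \<le> \<mu> * (C * \<omega> * a powr (- \<alpha> - 1/2)) / z"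
          using w m z by (intro divide_right_mono mult_left_mono) auto
        also have "\<dots> = (\<mu> * \<omega>) * (C * a powr (- \<alpha> - 1/2) / z)" by simp
        also have "\<dots> \<le> (C * z * a powr (-1/2)) * (C * a powr (- \<alpha> - 1/2) / z)"
          using w C z by (intro mult_right_mono) auto
        also have "\<dots> = C\<^sup>2 * (a powr (-1/2) * a powr (- \<alpha> - 1/2))" using z by (simp add: power2_eq_square)
        also have "a powr (-1/2) * a powr (- \<alpha> - 1/2) = a powr (- \<alpha> - 1)"
          unfolding powr_add[symmetric] by (rule arg_cong[where f = "(powr) a"]) simp
        finally show ?thesis .
      qed
      have 2: "rbes \<alpha> \<mu> z \<le> C\<^sup>2 * a powr (- \<alpha> - 1)"
      proof -
        have "rbes \<alpha> \<mu> z \<le> (\<mu> * \<omega>) * (C * a powr (- \<alpha> - 3/2))" using w(5) by (simp add: mult_ac)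
        also have "\<dots> \<le> (C * z * a powr (-1/2)) * (C * a powr (- \<alpha> - 3/2))"
          using w C by (intro mult_right_mono) auto
        also have "\<dots> \<le> (C * a * a powr (-1/2)) * (C * a powr (- \<alpha> - 3/2))"
          using a C by (intro mult_right_mono mult_left_mono) auto
        also have "\<dots> = C\<^sup>2 * (a powr 1 * a powr (-1/2) * a powr (- \<alpha> - 3/2))" using a by (simp add: power2_eq_square)
        also have "a powr 1 * a powr (-1/2) * a powr (- \<alpha> - 3/2) = a powr (- \<alpha> - 1)"
          unfolding powr_add[symmetric] by (rule arg_cong[where f = "(powr) a"]) simp
        finally show ?thesis .
      qed
      have "\<bar>debes \<alpha> \<mu> z\<bar> \<le> \<mu> * ebes \<alpha> \<mu> z / z + 2 * rbes \<alpha> \<mu> z"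
        unfolding debes_def using e0 w(4) m z by (simp add: abs_le_iff)
      also have "\<dots> \<le> 3 * C\<^sup>2 * a powr (- \<alpha> - 1)" using 1 2 by simp
      also have "\<dots> \<le> K * a powr (- \<alpha> - 1)" using K by (intro mult_right_mono) auto
      finally show ?thesis unfolding a_def .
    qed
  qed
qed

text \<open>Bounds that survive multiplication by \<mu>, for the factor next to 1/x. The third one
  is made for the derivative of 1/x: z E' - E equals (\<mu> - 1) E minus 2 z times
  \<open>rbes\<close>. Near 0 the first part behaves like z powr \<mu>, which is not O(z^2) for 1 <
  \<mu> < 2, while for \<mu> = 1 it is absent.\<close>

lemma ebes_gain:
  assumes \<alpha>: "\<alpha> > -1/2"
  shows "\<exists>C>0. \<forall>\<mu>\<ge>1. \<forall>z>0. \<mu> * ebes \<alpha> \<mu> z \<le> C * z * (1 + z) powr (- \<alpha> - 1) \<and>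
    \<mu> * \<bar>debes \<alpha> \<mu> z\<bar> \<le> C * (1 + z) powr (- \<alpha> - 1/2) \<and>
    (\<mu> = 1 \<or> \<mu> \<ge> 2 \<longrightarrow> \<mu> * \<bar>z * debes \<alpha> \<mu> z - ebes \<alpha> \<mu> z\<bar> \<le> C * z\<^sup>2 * (1 + z) powr (- \<alpha> - 3/2))"
proof -
  obtain C where C: "C > 0" and B: "\<And>\<mu> z. \<mu> \<ge> 1 \<Longrightarrow> z > 0 \<Longrightarrow> \<exists>\<omega>. 0 \<le> \<omega> \<and> \<omega> \<le> 1 \<and> \<mu> * \<omega> \<le> C * z * (1 + z) powr (-1/2) \<and> \<mu>\<^sup>2 * \<omega> \<le> C * z \<and>
     (\<mu> \<ge> 2 \<longrightarrow> \<mu>\<^sup>2 * \<omega> \<le> C * z\<^sup>2 / (1 + z)) \<and>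
     ebes \<alpha> \<mu> z \<le> C * \<omega> * (1 + z) powr (- \<alpha> - 1/2) \<and>
     0 \<le> rbes \<alpha> \<mu> z \<and> rbes \<alpha> \<mu> z \<le> C * \<mu> * \<omega> * (1 + z) powr (- \<alpha> - 3/2)"
    using ebes_basic[OF \<alpha>] by blast
  define K where "K = 3 * C\<^sup>2"
  have K: "K > 0" "K \<ge> C\<^sup>2" using C by (auto simp: K_def)
  show ?thesis
  proof (intro exI[of _ K] conjI allI impI)
    show "K > 0" by fact
    fix \<mu> z :: real assume m: "\<mu> \<ge> 1" and z: "z > 0"
    define a where "a = 1 + z"
    have a: "a > 0" "z \<le> a" using z by (auto simp: a_def)
    from B[OF m z] obtain \<omega> where w: "0 \<le> \<omega>" "\<mu> * \<omega> \<le> C * z * a powr (-1/2)"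
        "\<mu>\<^sup>2 * \<omega> \<le> C * z" "\<mu> \<ge> 2 \<longrightarrow> \<mu>\<^sup>2 * \<omega> \<le> C * z\<^sup>2 / a"
        "ebes \<alpha> \<mu> z \<le> C * \<omega> * a powr (- \<alpha> - 1/2)"
        "0 \<le> rbes \<alpha> \<mu> z" "rbes \<alpha> \<mu> z \<le> C * \<mu> * \<omega> * a powr (- \<alpha> - 3/2)" unfolding a_def by blast
    have e0: "ebes \<alpha> \<mu> z \<ge> 0" using m \<alpha> by (intro ebes_nonneg) auto
    have r2: "\<mu> * rbes \<alpha> \<mu> z \<le> C\<^sup>2 * z * a powr (- \<alpha> - 3/2)"
    proof -
      have "\<mu> * rbes \<alpha> \<mu> z \<le> \<mu> * (C * \<mu> * \<omega> * a powr (- \<alpha> - 3/2))" using w m by (intro mult_left_mono) auto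
      also have "\<dots> = (\<mu>\<^sup>2 * \<omega>) * (C * a powr (- \<alpha> - 3/2))" by (simp add: power2_eq_square)
      also have "\<dots> \<le> (C * z) * (C * a powr (- \<alpha> - 3/2))" using w C by (intro mult_right_mono) auto
      finally show ?thesis by (simp add: power2_eq_square mult_ac)
    qed
    show "\<mu> * ebes \<alpha> \<mu> z \<le> K * z * (1 + z) powr (- \<alpha> - 1)"
    proof -
      have "\<mu> * ebes \<alpha> \<mu> z \<le> \<mu> * (C * \<omega> * a powr (- \<alpha> - 1/2))" using w m by (intro mult_left_mono) auto
      also have "\<dots> = (\<mu> * \<omega>) * (C * a powr (- \<alpha> - 1/2))" by simp
      also have "\<dots> \<le> (C * z * a powr (-1/2)) * (C * a powr (- \<alpha> - 1/2))" using w C by (intro mult_right_mono) auto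
      also have "\<dots> = C\<^sup>2 * z * (a powr (-1/2) * a powr (- \<alpha> - 1/2))" by (simp add: power2_eq_square)
      also have "a powr (-1/2) * a powr (- \<alpha> - 1/2) = a powr (- \<alpha> - 1)"
        unfolding powr_add[symmetric] by (rule arg_cong[where f = "(powr) a"]) simp
      also have "C\<^sup>2 * z * a powr (- \<alpha> - 1) \<le> K * z * a powr (- \<alpha> - 1)" using K z by (intro mult_right_mono) auto
      finally show ?thesis unfolding a_def .
    qed
    show "\<mu> * \<bar>debes \<alpha> \<mu> z\<bar> \<le> K * (1 + z) powr (- \<alpha> - 1/2)"
    proof -
      have 1: "\<mu> * (\<mu> * ebes \<alpha> \<mu> z / z) \<le> C\<^sup>2 * a powr (- \<alpha> - 1/2)"
      proof -
        have "\<mu> * (\<mu> * ebes \<alpha> \<mu> z / z) = (\<mu>\<^sup>2 / z) * ebes \<alpha> \<mu> z" by (simp add: power2_eq_square)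
        also have "\<dots> \<le> (\<mu>\<^sup>2 / z) * (C * \<omega> * a powr (- \<alpha> - 1/2))" using w z by (intro mult_left_mono) auto
        also have "\<dots> = (\<mu>\<^sup>2 * \<omega>) * (C * a powr (- \<alpha> - 1/2) / z)" by simp
        also have "\<dots> \<le> (C * z) * (C * a powr (- \<alpha> - 1/2) / z)" using w C z by (intro mult_right_mono) auto
        also have "\<dots> = C\<^sup>2 * a powr (- \<alpha> - 1/2)" using z by (simp add: power2_eq_square)
        finally show ?thesis .
      qed
      have 2: "\<mu> * rbes \<alpha> \<mu> z \<le> C\<^sup>2 * a powr (- \<alpha> - 1/2)"
      proof -
        note r2
        also have "C\<^sup>2 * z * a powr (- \<alpha> - 3/2) \<le> C\<^sup>2 * a powr 1 * a powr (- \<alpha> - 3/2)"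
          using a C by (intro mult_right_mono mult_left_mono) auto
        also have "\<dots> = C\<^sup>2 * (a powr 1 * a powr (- \<alpha> - 3/2))" by simp
        also have "a powr 1 * a powr (- \<alpha> - 3/2) = a powr (- \<alpha> - 1/2)"
          unfolding powr_add[symmetric] by (rule arg_cong[where f = "(powr) a"]) simp
        finally show ?thesis .
      qed
      have "\<bar>debes \<alpha> \<mu> z\<bar> \<le> \<mu> * ebes \<alpha> \<mu> z / z + 2 * rbes \<alpha> \<mu> z"
        unfolding debes_def using e0 w(6) m z by (simp add: abs_le_iff)
      then have "\<mu> * \<bar>debes \<alpha> \<mu> z\<bar> \<le> \<mu> * (\<mu> * ebes \<alpha> \<mu> z / z + 2 * rbes \<alpha> \<mu> z)"
        using m by (intro mult_left_mono) auto
      also have "\<dots> = \<mu> * (\<mu> * ebes \<alpha> \<mu> z / z) + 2 * (\<mu> * rbes \<alpha> \<mu> z)" by (simp add: algebra_simps)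
      also have "\<dots> \<le> K * a powr (- \<alpha> - 1/2)" using 1 2 unfolding K_def by simp
      finally show ?thesis unfolding a_def .
    qed
    show "\<mu> * \<bar>z * debes \<alpha> \<mu> z - ebes \<alpha> \<mu> z\<bar> \<le> K * z\<^sup>2 * (1 + z) powr (- \<alpha> - 3/2)" if m2: "\<mu> = 1 \<or> \<mu> \<ge> 2"
    proof -
      have 1: "\<mu> * ((\<mu> - 1) * ebes \<alpha> \<mu> z) \<le> C\<^sup>2 * z\<^sup>2 * a powr (- \<alpha> - 3/2)"
      proof (cases "\<mu> = 1")
        case False
        then have m2: "\<mu> \<ge> 2" using m2 by simp
        have "\<mu> * ((\<mu> - 1) * ebes \<alpha> \<mu> z) \<le> \<mu> * (\<mu> * ebes \<alpha> \<mu> z)" using m e0 by (intro mult_left_mono mult_right_mono) auto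
        also have "\<dots> = \<mu>\<^sup>2 * ebes \<alpha> \<mu> z" by (simp add: power2_eq_square)
        also have "\<dots> \<le> \<mu>\<^sup>2 * (C * \<omega> * a powr (- \<alpha> - 1/2))" using w by (intro mult_left_mono) auto
        also have "\<dots> = (\<mu>\<^sup>2 * \<omega>) * (C * a powr (- \<alpha> - 1/2))" by simp
        also have "\<dots> \<le> (C * z\<^sup>2 / a) * (C * a powr (- \<alpha> - 1/2))" using w m2 C by (intro mult_right_mono) auto
        also have "\<dots> = C\<^sup>2 * z\<^sup>2 * (a powr (-1) * a powr (- \<alpha> - 1/2))"
        proof -
          have "a powr (-1) = 1 / a" using a powr_minus_divide[of a 1] by simp
          then show ?thesis by (simp add: power2_eq_square)
        qed
        also have "a powr (-1) * a powr (- \<alpha> - 1/2) = a powr (- \<alpha> - 3/2)"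
          unfolding powr_add[symmetric] by (rule arg_cong[where f = "(powr) a"]) simp
        finally show ?thesis .
      qed simp
      have 2: "\<mu> * (z * rbes \<alpha> \<mu> z) \<le> C\<^sup>2 * z\<^sup>2 * a powr (- \<alpha> - 3/2)"
        using mult_left_mono[OF r2, of z] z by (simp add: power2_eq_square mult_ac)
      have "z * debes \<alpha> \<mu> z - ebes \<alpha> \<mu> z = (\<mu> - 1) * ebes \<alpha> \<mu> z - 2 * (z * rbes \<alpha> \<mu> z)"
        unfolding debes_def using z by (simp add: field_simps)
      then have "\<bar>z * debes \<alpha> \<mu> z - ebes \<alpha> \<mu> z\<bar> \<le> (\<mu> - 1) * ebes \<alpha> \<mu> z + 2 * (z * rbes \<alpha> \<mu> z)"
        using e0 w(6) m z mult_nonneg_nonneg[of "\<mu> - 1" "ebes \<alpha> \<mu> z"] by (simp add: abs_le_iff)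
      then have "\<mu> * \<bar>z * debes \<alpha> \<mu> z - ebes \<alpha> \<mu> z\<bar> \<le> \<mu> * ((\<mu> - 1) * ebes \<alpha> \<mu> z + 2 * (z * rbes \<alpha> \<mu> z))"
        using m by (intro mult_left_mono) auto
      also have "\<dots> = \<mu> * ((\<mu> - 1) * ebes \<alpha> \<mu> z) + 2 * (\<mu> * (z * rbes \<alpha> \<mu> z))" by (simp add: algebra_simps)
      also have "\<dots> \<le> K * z\<^sup>2 * a powr (- \<alpha> - 3/2)" using 1 2 unfolding K_def by simp
      finally show ?thesis unfolding a_def .
    qed
  qed
qed

subsection \<open>The weighted kernel\<close>

lemma powr_exp_absorb:
  fixes p \<tau> :: real
  assumes "p \<ge> 0" "\<tau> \<ge> 0"
  shows "(1 + \<tau>) powr p * exp (- \<tau> / 2) \<le> (1 + 2 * p) powr p"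
proof (cases "p = 0")
  case False
  then have p: "p > 0" using assms by simp
  have "1 + \<tau> \<le> (1 + 2 * p) * (1 + \<tau> / (2 * p))"
    using p assms by (simp add: field_simps)
  also have "\<dots> \<le> (1 + 2 * p) * exp (\<tau> / (2 * p))"
    using p exp_ge_add_one_self[of "\<tau> / (2 * p)"] by (intro mult_left_mono) auto
  finally have "(1 + \<tau>) powr p \<le> ((1 + 2 * p) * exp (\<tau> / (2 * p))) powr p"
    using assms by (intro powr_mono2) auto
  also have "\<dots> = (1 + 2 * p) powr p * exp (\<tau> / 2)"
    using p by (simp add: powr_mult exp_powr_real)
  finally have "(1 + \<tau>) powr p * exp (- \<tau> / 2) \<le> (1 + 2 * p) powr p * exp (\<tau> / 2) * exp (- \<tau> / 2)"
    by (intro mult_right_mono) auto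
  also have "\<dots> = (1 + 2 * p) powr p" by (simp add: mult_exp_exp)
  finally show ?thesis .
qed (use assms in auto)

text \<open>The weight needed is a power of (x + x')^2, but the Bessel bounds only know X = x x',
  which is much smaller when x and x' differ widely. Then D is large: s v is at most 4 (1 + s X) (1
  + s D), and the exponential swallows powers of 1 + s D.\<close>

lemma powr_absorb:
  fixes p s X D v :: real
  assumes "p \<ge> 0" "s > 0" "X > 0" "D \<ge> 0" "v > 0" "v \<le> 4 * (X + D)"
  shows "exp (- (s * D) / 2) * (1 + s * X) powr (- p) \<le> (4 * (1 + 2 * p)) powr p * (s * v) powr (- p)"
proof -
  have "s * v \<le> s * (4 * (X + D))" using assms by (intro mult_left_mono) auto
  also have "\<dots> \<le> 4 * ((1 + s * X) * (1 + s * D))" using assms by (simp add: algebra_simps)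
  finally have "s * v \<le> 4 * ((1 + s * X) * (1 + s * D))" .
  then have le: "s * v / (4 * (1 + s * D)) \<le> 1 + s * X"
  proof -
    have "4 * (1 + s * D) > 0" using assms by (simp add: add_pos_nonneg)
    moreover have "s * v \<le> (1 + s * X) * (4 * (1 + s * D))"
      using \<open>s * v \<le> 4 * ((1 + s * X) * (1 + s * D))\<close> by (simp only: mult_ac)
    ultimately show ?thesis by (rule pos_divide_le_eq[THEN iffD2])
  qed
  have "(1 + s * X) powr (- p) \<le> (s * v / (4 * (1 + s * D))) powr (- p)"
    using assms le by (intro powr_mono2') (auto intro!: divide_pos_pos mult_pos_pos add_pos_nonneg)
  also have "\<dots> = (s * v) powr (- p) * (4 powr p * (1 + s * D) powr p)"
  proof -
    define q where "q = 4 * (1 + s * D)"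
    have q: "q > 0" unfolding q_def using assms by (simp add: add_pos_nonneg)
    have "(s * v / q) powr (- p) = (s * v) powr (- p) * q powr p"
      using assms q by (simp add: powr_divide powr_minus_divide)
    also have "q powr p = 4 powr p * (1 + s * D) powr p"
      unfolding q_def by (rule powr_mult)
    finally show ?thesis unfolding q_def .
  qed
  finally have "exp (- (s * D) / 2) * (1 + s * X) powr (- p) \<le>
      exp (- (s * D) / 2) * ((s * v) powr (- p) * (4 powr p * (1 + s * D) powr p))"
    by (intro mult_left_mono) auto
  also have "\<dots> = (s * v) powr (- p) * 4 powr p * ((1 + s * D) powr p * exp (- (s * D) / 2))"
    by (simp only: mult_ac)
  also have "\<dots> \<le> (s * v) powr (- p) * 4 powr p * (1 + 2 * p) powr p"
    using assms by (intro mult_left_mono powr_exp_absorb) auto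
  also have "\<dots> = (4 * (1 + 2 * p)) powr p * (s * v) powr (- p)"
    unfolding powr_mult by (simp only: mult_ac)
  finally show ?thesis .
qed

text \<open>Two points of the open quarter circle in coordinates, that is the sines and cosines of
  the half angles. In this form the reflection \<theta> to \<pi> - \<theta> is just the exchange of
  the coordinates.\<close>

definition circle_pair :: "real \<Rightarrow> real \<Rightarrow> real \<Rightarrow> real \<Rightarrow> bool" where
  "circle_pair x y x' y' \<longleftrightarrow> x > 0 \<and> y > 0 \<and> x' > 0 \<and> y' > 0 \<and> x\<^sup>2 + y\<^sup>2 = 1 \<and> x'\<^sup>2 + y'\<^sup>2 = 1"

text \<open>Half the squared Euclidean distance of the two points; this is the D of the exponential
  factor.\<close>

definition chord :: "real \<Rightarrow> real \<Rightarrow> real \<Rightarrow> real \<Rightarrow> real" where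
  "chord x y x' y' = 1 - x * x' - y * y'"

lemma circle_pair_swap: "circle_pair x y x' y' \<Longrightarrow> circle_pair y x y' x'"
  unfolding circle_pair_def by (auto simp: add.commute)

lemma chord_swap: "chord y x y' x' = chord x y x' y'"
  unfolding chord_def by simp

text \<open>x x' + D is 1 - y y', at least 1 - (y^2 + y'^2) / 2 = (x^2 + x'^2) / 2, which gives the
  second bound. In the third, y x' - x y' is the sine of the difference of the half angles, whose
  cosine is 1 - D.\<close>

lemma chord_bounds:
  assumes "circle_pair x y x' y'"
  shows "chord x y x' y' \<ge> 0" "(x + x')\<^sup>2 \<le> 4 * (x * x' + chord x y x' y')"
    "\<bar>y * x' - x * y'\<bar> \<le> 2 * sqrt (chord x y x' y')" "x \<le> 1" "y \<le> 1" "x' \<le> 1" "y' \<le> 1"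
proof -
  have c: "x\<^sup>2 + y\<^sup>2 = 1" "x'\<^sup>2 + y'\<^sup>2 = 1" and pos: "x > 0" "y > 0" "x' > 0" "y' > 0"
    using assms unfolding circle_pair_def by auto
  define D where "D = chord x y x' y'"
  have D2: "2 * D = (x - x')\<^sup>2 + (y - y')\<^sup>2"
    using c unfolding D_def chord_def by (simp add: power2_diff)
  show D0: "chord x y x' y' \<ge> 0" using D2 zero_le_power2[of "x - x'"] zero_le_power2[of "y - y'"]
    unfolding D_def by linarith
  have "2 * (y * y') \<le> y\<^sup>2 + y'\<^sup>2" using zero_le_power2[of "y - y'"] by (simp add: power2_diff)
  moreover have "(x + x')\<^sup>2 \<le> 2 * x\<^sup>2 + 2 * x'\<^sup>2" using zero_le_power2[of "x - x'"] by (simp add: power2_diff power2_sum)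
  ultimately show "(x + x')\<^sup>2 \<le> 4 * (x * x' + chord x y x' y')"
  proof -
    assume 1: "2 * (y * y') \<le> y\<^sup>2 + y'\<^sup>2" and 2: "(x + x')\<^sup>2 \<le> 2 * x\<^sup>2 + 2 * x'\<^sup>2"
    have eq: "x * x' + chord x y x' y' = 1 - y * y'" by (simp add: chord_def)
    have aux: "P \<le> 4 * (1 - w)" if "P \<le> 2 * a + 2 * b" "2 * w \<le> d + e" "a + d = 1" "b + e = 1" for P a b d e w :: real
    proof -
      have "P \<le> 2 * (1 - d) + 2 * (1 - e)" using that by simp
      then show ?thesis using that(2) by simp
    qed
    show ?thesis unfolding eq by (rule aux[OF 2 1 c])
  qed
  have "(y * x' - x * y')\<^sup>2 + (x * x' + y * y')\<^sup>2 = (x\<^sup>2 + y\<^sup>2) * (x'\<^sup>2 + y'\<^sup>2)"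
    by (simp add: power2_eq_square algebra_simps)
  then have "(y * x' - x * y')\<^sup>2 = 1 - (1 - D)\<^sup>2" using c unfolding D_def chord_def by simp
  also have "\<dots> = 2 * D - D * D" by (simp add: power2_eq_square algebra_simps)
  also have "\<dots> \<le> 2 * D" by simp
  also have "\<dots> \<le> 4 * D" using D0 unfolding D_def[symmetric] by simp
  also have "\<dots> = (2 * sqrt D)\<^sup>2" using D0 unfolding D_def[symmetric] by (simp add: power_mult_distrib)
  finally have "\<bar>y * x' - x * y'\<bar> \<le> \<bar>2 * sqrt D\<bar>" by (simp only: abs_le_square_iff)
  then show "\<bar>y * x' - x * y'\<bar> \<le> 2 * sqrt (chord x y x' y')"
    unfolding D_def[symmetric] using D0[folded D_def] by simp
  have le1: "u \<le> 1" if "u\<^sup>2 + w\<^sup>2 = 1" for u w :: real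
  proof -
    have "0 \<le> w\<^sup>2" by simp
    then have "u\<^sup>2 \<le> 1" using that by linarith
    then show ?thesis using power2_le_imp_le[of u 1] by simp
  qed
  show "x \<le> 1" "x' \<le> 1" using le1 c by auto
  show "y \<le> 1" "y' \<le> 1" using le1[of y x] le1[of y' x'] c by auto
qed

text \<open>The exponential is halved, one half for the weight in x and one for the weight in y; the
  second follows from the first by exchanging the coordinates.\<close>

lemma two_weight_absorb:
  assumes cp: "circle_pair x y x' y'" and s: "s > 0" and pq: "p \<ge> 0" "q \<ge> 0"
  shows "exp (- s * chord x y x' y') * ((1 + s * (x * x')) powr (- p) * (1 + s * (y * y')) powr (- q))
    \<le> ((4 * (1 + 2 * p)) powr p * (4 * (1 + 2 * q)) powr q) *
      (s powr (- p - q) * ((x + x') powr (- 2 * p) * (y + y') powr (- 2 * q)))"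
proof -
  define D where "D = chord x y x' y'"
  have pos: "x > 0" "y > 0" "x' > 0" "y' > 0" using cp unfolding circle_pair_def by auto
  have D: "D \<ge> 0" unfolding D_def by (rule chord_bounds(1)[OF cp])
  have 1: "exp (- (s * D) / 2) * (1 + s * (x * x')) powr (- p) \<le> (4 * (1 + 2 * p)) powr p * (s * (x + x')\<^sup>2) powr (- p)"
    using s pq pos D chord_bounds(2)[OF cp] unfolding D_def by (intro powr_absorb) auto
  have 2: "exp (- (s * D) / 2) * (1 + s * (y * y')) powr (- q) \<le> (4 * (1 + 2 * q)) powr q * (s * (y + y')\<^sup>2) powr (- q)"
    using s pq pos D chord_bounds(2)[OF circle_pair_swap[OF cp]] unfolding D_def chord_swap[of y x y' x'] by (intro powr_absorb) auto
  have sq: "(s * w\<^sup>2) powr (- r) = s powr (- r) * w powr (- 2 * r)" if "w > 0" for w r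
  proof -
    have "w\<^sup>2 = w powr 2" using that by simp
    then have "(w\<^sup>2) powr (- r) = w powr (- 2 * r)" by (simp only: powr_powr) simp
    then show ?thesis using s that by (simp add: powr_mult)
  qed
  have e: "exp (- s * D) = exp (- (s * D) / 2) * exp (- (s * D) / 2)" by (simp add: mult_exp_exp)
  have "exp (- s * D) * ((1 + s * (x * x')) powr (- p) * (1 + s * (y * y')) powr (- q)) =
     (exp (- (s * D) / 2) * (1 + s * (x * x')) powr (- p)) * (exp (- (s * D) / 2) * (1 + s * (y * y')) powr (- q))"
    unfolding e by (simp only: mult_ac)
  also have "\<dots> \<le> ((4 * (1 + 2 * p)) powr p * (s * (x + x')\<^sup>2) powr (- p)) * ((4 * (1 + 2 * q)) powr q * (s * (y + y')\<^sup>2) powr (- q))"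
    by (intro mult_mono 1 2) auto
  also have "\<dots> = ((4 * (1 + 2 * p)) powr p * (4 * (1 + 2 * q)) powr q) *
      ((s powr (- p) * s powr (- q)) * ((x + x') powr (- 2 * p) * (y + y') powr (- 2 * q)))"
    using pos by (simp add: sq)
  also have "s powr (- p) * s powr (- q) = s powr (- p - q)"
    unfolding powr_add[symmetric] by simp
  finally show ?thesis unfolding D_def .
qed

text \<open>The integrand in s of the weighted kernel for a projective space, with 1/x for
  \<open>sqrt (rho M \<theta>)\<close>. Of exp (- 2 s) the parts belonging to X and Y sit inside the
  functions \<open>ebes\<close>, which also contain the powers of X and Y from
  \<open>u_fun\<close>.\<close>

definition wker :: "real \<Rightarrow> real \<Rightarrow> real \<Rightarrow> real \<Rightarrow> real \<Rightarrow> real \<Rightarrow> real \<Rightarrow> real \<Rightarrow> real \<Rightarrow> real" where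
  "wker \<alpha> \<beta> \<mu> \<kappa> s x y x' y' = 2 * s powr (\<alpha> + \<beta>) * exp (- 2 * s * chord x y x' y') *
     (ebes \<alpha> \<mu> (s * (x * x')) * ebes \<beta> \<kappa> (s * (y * y')) / x)"

text \<open>The derivative in \<theta>, where x and y have derivatives y / 2 and - x / 2. The
  derivatives of 1/x and of the first Bessel factor are joined to z E' - E with z = s x x', since
  separately they would be too singular at x = 0.\<close>

definition wker_d1 :: "real \<Rightarrow> real \<Rightarrow> real \<Rightarrow> real \<Rightarrow> real \<Rightarrow> real \<Rightarrow> real \<Rightarrow> real \<Rightarrow> real \<Rightarrow> real" where
  "wker_d1 \<alpha> \<beta> \<mu> \<kappa> s x y x' y' = 2 * s powr (\<alpha> + \<beta>) * exp (- 2 * s * chord x y x' y') *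
     (y / (2 * x\<^sup>2) * (s * (x * x') * debes \<alpha> \<mu> (s * (x * x')) - ebes \<alpha> \<mu> (s * (x * x'))) * ebes \<beta> \<kappa> (s * (y * y'))
      + s / x * (y * x' - x * y') * (ebes \<alpha> \<mu> (s * (x * x')) * ebes \<beta> \<kappa> (s * (y * y')))
      - s * y' / 2 * (ebes \<alpha> \<mu> (s * (x * x')) * debes \<beta> \<kappa> (s * (y * y'))))"

text \<open>The derivative in \<phi>. As 1/x does not depend on \<phi>, no cancellation is involved
  and the bound for it holds for every \<mu> \<ge> 1.\<close>

definition wker_d2 :: "real \<Rightarrow> real \<Rightarrow> real \<Rightarrow> real \<Rightarrow> real \<Rightarrow> real \<Rightarrow> real \<Rightarrow> real \<Rightarrow> real \<Rightarrow> real" where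
  "wker_d2 \<alpha> \<beta> \<mu> \<kappa> s x y x' y' = 2 * s powr (\<alpha> + \<beta>) * exp (- 2 * s * chord x y x' y') *
     (s * y' / 2 * debes \<alpha> \<mu> (s * (x * x')) * ebes \<beta> \<kappa> (s * (y * y'))
      + s / x * (x * y' - y * x') * (ebes \<alpha> \<mu> (s * (x * x')) * ebes \<beta> \<kappa> (s * (y * y')))
      - s * y * x' / (2 * x) * (ebes \<alpha> \<mu> (s * (x * x')) * debes \<beta> \<kappa> (s * (y * y'))))"

text \<open>The part of the bounds that does not depend on s. Divided by the distance of the angles
  it is controlled by the reciprocal measure of the ball
  (\<open>jacobi_measure_ball\<close>).\<close>

definition sweight :: "real \<Rightarrow> real \<Rightarrow> real \<Rightarrow> real \<Rightarrow> real \<Rightarrow> real \<Rightarrow> real" where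
  "sweight \<alpha> \<beta> x y x' y' = (x + x') powr (- 2 * \<alpha> - 1) * (y + y') powr (- 2 * \<beta> - 1)"

text \<open>Power counting: decay exponents p and q pay for monomials of degree i = 2 p - 2 \<alpha>
  - 1 in x, x' and k = 2 q - 2 \<beta> - 1 in y, y'. Every choice leaves the same weight, and only
  the power of s varies.\<close>

lemma weight_monomial_le:
  assumes cp: "circle_pair x y x' y'" and s: "s > 0" and pq: "p \<ge> 0" "q \<ge> 0"
    and m: "0 \<le> m" "m \<le> (x + x') powr i" and n: "0 \<le> n" "n \<le> (y + y') powr k"
    and e: "i = 2 * p - 2 * \<alpha> - 1" "k = 2 * q - 2 * \<beta> - 1"
  shows "s powr t * (m * n) * (exp (- s * chord x y x' y') * ((1 + s * (x * x')) powr (- p) * (1 + s * (y * y')) powr (- q)))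
    \<le> ((4 * (1 + 2 * p)) powr p * (4 * (1 + 2 * q)) powr q) * (s powr (t - p - q) * sweight \<alpha> \<beta> x y x' y')"
proof -
  define K where "K = (4 * (1 + 2 * p)) powr p * (4 * (1 + 2 * q)) powr q"
  have pos: "x > 0" "y > 0" "x' > 0" "y' > 0" using cp unfolding circle_pair_def by auto
  have "s powr t * (m * n) * (exp (- s * chord x y x' y') * ((1 + s * (x * x')) powr (- p) * (1 + s * (y * y')) powr (- q)))
    \<le> s powr t * ((x + x') powr i * (y + y') powr k) * (K * (s powr (- p - q) * ((x + x') powr (- 2 * p) * (y + y') powr (- 2 * q))))"
    unfolding K_def using m n by (intro mult_mono two_weight_absorb cp s pq order_refl) (auto intro!: mult_nonneg_nonneg)
  also have "\<dots> = K * ((s powr t * s powr (- p - q)) * (((x + x') powr i * (x + x') powr (- 2 * p)) * ((y + y') powr k * (y + y') powr (- 2 * q))))"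
    by (simp only: mult_ac)
  also have "s powr t * s powr (- p - q) = s powr (t - p - q)"
    unfolding powr_add[symmetric] by (rule arg_cong[where f = "(powr) s"]) simp
  also have "(x + x') powr i * (x + x') powr (- 2 * p) = (x + x') powr (- 2 * \<alpha> - 1)"
    unfolding powr_add[symmetric] e by simp
  also have "(y + y') powr k * (y + y') powr (- 2 * q) = (y + y') powr (- 2 * \<beta> - 1)"
    unfolding powr_add[symmetric] e by simp
  finally show ?thesis unfolding K_def sweight_def .
qed

lemma sqrt_mult_exp_le: "\<tau> \<ge> 0 \<Longrightarrow> sqrt \<tau> * exp (- \<tau> / 2) \<le> 1"
proof -
  assume t: "\<tau> \<ge> 0"
  have "\<tau> \<le> exp \<tau>" using exp_ge_add_one_self[of \<tau>] by linarith
  then have "sqrt \<tau> \<le> sqrt (exp \<tau>)" by simp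
  also have "sqrt (exp \<tau>) = exp (\<tau> / 2)" by (rule real_sqrt_unique) (simp_all add: power2_eq_square mult_exp_exp)
  finally have "sqrt \<tau> * exp (- \<tau> / 2) \<le> exp (\<tau> / 2) * exp (- \<tau> / 2)" by (intro mult_right_mono) auto
  then show ?thesis by (simp add: mult_exp_exp)
qed

text \<open>The exponential exp (- 2 s D) is spent in three portions: exp (- s D) restores the
  weights, one factor exp (- s D / 2) compensates sqrt D where it occurs, and another is kept for
  the integration in s. The Bessel factor in X takes \<mu> by \<open>ebes_gain\<close>; the one in Y
  is bounded by \<open>ebes_size\<close>.\<close>

lemma wker_bounds:
  assumes \<alpha>: "\<alpha> > -1/2" and \<beta>: "\<beta> > -1/2"
  shows "\<exists>C>0. \<forall>\<mu> \<kappa> s x y x' y'. \<mu> \<ge> 1 \<longrightarrow> \<kappa> = 0 \<or> \<kappa> \<ge> 1 \<longrightarrow> s > 0 \<longrightarrow> circle_pair x y x' y' \<longrightarrow>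
    \<mu> * \<bar>wker \<alpha> \<beta> \<mu> \<kappa> s x y x' y'\<bar> \<le> C * sweight \<alpha> \<beta> x y x' y' * (s powr (-1/2) * exp (- (1/2) * chord x y x' y' * s)) \<and>
    (\<mu> = 1 \<or> \<mu> \<ge> 2 \<longrightarrow> \<mu> * \<bar>wker_d1 \<alpha> \<beta> \<mu> \<kappa> s x y x' y'\<bar> \<le> C * sweight \<alpha> \<beta> x y x' y' * exp (- (1/2) * chord x y x' y' * s)) \<and>
    \<mu> * \<bar>wker_d2 \<alpha> \<beta> \<mu> \<kappa> s x y x' y'\<bar> \<le> C * sweight \<alpha> \<beta> x y x' y' * exp (- (1/2) * chord x y x' y' * s)"
proof -
  obtain C1 where C1: "C1 > 0" and S: "\<And>\<mu> z. \<mu> = 0 \<or> \<mu> \<ge> 1 \<Longrightarrow> z > 0 \<Longrightarrow> ebes \<beta> \<mu> z \<le> C1 * (1 + z) powr (- \<beta> - 1/2)"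
    "\<And>\<mu> z. \<mu> = 0 \<or> \<mu> \<ge> 1 \<Longrightarrow> z > 0 \<Longrightarrow> \<bar>debes \<beta> \<mu> z\<bar> \<le> C1 * (1 + z) powr (- \<beta> - 1)"
    using ebes_size[OF \<beta>] by blast
  obtain C2 where C2: "C2 > 0" and G: "\<And>\<mu> z. \<mu> \<ge> 1 \<Longrightarrow> z > 0 \<Longrightarrow> \<mu> * ebes \<alpha> \<mu> z \<le> C2 * z * (1 + z) powr (- \<alpha> - 1)"
    "\<And>\<mu> z. \<mu> \<ge> 1 \<Longrightarrow> z > 0 \<Longrightarrow> \<mu> * \<bar>debes \<alpha> \<mu> z\<bar> \<le> C2 * (1 + z) powr (- \<alpha> - 1/2)"
    "\<And>\<mu> z. \<mu> \<ge> 1 \<Longrightarrow> z > 0 \<Longrightarrow> \<mu> = 1 \<or> \<mu> \<ge> 2 \<Longrightarrow>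
      \<mu> * \<bar>z * debes \<alpha> \<mu> z - ebes \<alpha> \<mu> z\<bar> \<le> C2 * z\<^sup>2 * (1 + z) powr (- \<alpha> - 3/2)"
    using ebes_gain[OF \<alpha>] by blast
  \<comment> \<open>\<open>k p q\<close> is the constant of \<open>weight_monomial_le\<close>; the
    four pairs that follow are the decay exponents of E F, (z E' - E) F, E F' and E' F, in this
    order.\<close>
  define k where "k p q = (4 * (1 + 2 * p)) powr p * (4 * (1 + 2 * q)) powr q" for p q :: real
  have k0: "k p q \<ge> 0" for p q unfolding k_def by simp
  define k1 where "k1 = k (\<alpha> + 1) (\<beta> + 1/2)"
  define k2 where "k2 = k (\<alpha> + 3/2) (\<beta> + 1/2)"
  define k3 where "k3 = k (\<alpha> + 1) (\<beta> + 1)"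
  define k4 where "k4 = k (\<alpha> + 1/2) (\<beta> + 1/2)"
  have ks: "k1 \<ge> 0" "k2 \<ge> 0" "k3 \<ge> 0" "k4 \<ge> 0" unfolding k1_def k2_def k3_def k4_def using k0 by auto
  define C where "C = C1 * C2 * (4 * k1 + k2 + k3 + k4 + 1)"
  have C: "C > 0" unfolding C_def using C1 C2 ks by (intro mult_pos_pos add_nonneg_pos) auto
  show ?thesis
  proof (intro exI[of _ C] conjI allI impI)
    show "C > 0" by fact
  next
    fix \<mu> \<kappa> s x y x' y' :: real
    assume \<mu>: "\<mu> \<ge> 1" and \<kappa>: "\<kappa> = 0 \<or> \<kappa> \<ge> 1" and s: "s > 0" and cp: "circle_pair x y x' y'"
    define D where "D = chord x y x' y'"
    define X where "X = x * x'"
    define Y where "Y = y * y'"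
    define E where "E = ebes \<alpha> \<mu> (s * X)"
    define E' where "E' = debes \<alpha> \<mu> (s * X)"
    define F where "F = ebes \<beta> \<kappa> (s * Y)"
    define F' where "F' = debes \<beta> \<kappa> (s * Y)"
    define A where "A = 1 + s * X"
    define B where "B = 1 + s * Y"
    define W where "W = sweight \<alpha> \<beta> x y x' y'"
    define g where "g = 2 * s powr (\<alpha> + \<beta>) * exp (- 2 * s * D)"
    have pos: "x > 0" "y > 0" "x' > 0" "y' > 0" using cp unfolding circle_pair_def by auto
    note cb = chord_bounds[OF cp, folded D_def]
    have XY: "X > 0" "Y > 0" unfolding X_def Y_def using pos by auto
    have AB: "A > 0" "B > 0" unfolding A_def B_def using XY s by (auto intro!: add_pos_pos)
    have sz: "s * X > 0" "s * Y > 0" using s XY by auto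
    have E0: "E \<ge> 0" "F \<ge> 0" unfolding E_def F_def using \<alpha> \<beta> \<mu> \<kappa> by (auto intro!: ebes_nonneg)
    have FB: "F \<le> C1 * B powr (- (\<beta> + 1/2))" "\<bar>F'\<bar> \<le> C1 * B powr (- (\<beta> + 1))"
      using S[OF \<kappa> sz(2)] unfolding F_def F'_def B_def by simp_all
    have EB: "\<mu> * E \<le> C2 * (s * X) * A powr (- (\<alpha> + 1))" "\<mu> * \<bar>E'\<bar> \<le> C2 * A powr (- (\<alpha> + 1/2))"
      using G(1,2)[OF \<mu> sz(1)] unfolding E_def E'_def A_def by simp_all
    have W0: "W \<ge> 0" unfolding W_def sweight_def by simp
    define ee where "ee = exp (- (1/2) * D * s)"
    have g: "g = 2 * s powr (\<alpha> + \<beta>) * (exp (- s * D) * (ee * ee))"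
      unfolding g_def ee_def by (simp add: mult_exp_exp)
    have ee: "0 \<le> ee" "ee \<le> 1" unfolding ee_def using s cb(1) by auto
    have g0: "g \<ge> 0" unfolding g_def by simp
    have one: "1 \<le> (x + x') powr 0" "1 \<le> (y + y') powr 0" using pos by auto
    have lex: "x' \<le> (x + x') powr 1" "y' \<le> (y + y') powr 1" "y \<le> (y + y') powr 1" "x'\<^sup>2 \<le> (x + x') powr 2"
      using pos by (auto intro!: power_mono)
    have M1: "s powr t * (x' * 1) * (exp (- s * D) * (A powr (- (\<alpha> + 1)) * B powr (- (\<beta> + 1/2)))) \<le> k1 * (s powr (t - (\<alpha> + 1) - (\<beta> + 1/2)) * W)" for t
      unfolding D_def A_def B_def X_def Y_def W_def k1_def k_def using \<alpha> \<beta> lex one pos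
      by (intro weight_monomial_le[OF cp s, where i = 1 and k = 0]) auto
    have M2: "s powr t * (x'\<^sup>2 * 1) * (exp (- s * D) * (A powr (- (\<alpha> + 3/2)) * B powr (- (\<beta> + 1/2)))) \<le> k2 * (s powr (t - (\<alpha> + 3/2) - (\<beta> + 1/2)) * W)" for t
      unfolding D_def A_def B_def X_def Y_def W_def k2_def k_def using \<alpha> \<beta> lex one pos
      by (intro weight_monomial_le[OF cp s, where i = 2 and k = 0]) auto
    have M3: "s powr t * (x' * w) * (exp (- s * D) * (A powr (- (\<alpha> + 1)) * B powr (- (\<beta> + 1)))) \<le> k3 * (s powr (t - (\<alpha> + 1) - (\<beta> + 1)) * W)"
      if "w = y \<or> w = y'" for t w
      unfolding D_def A_def B_def X_def Y_def W_def k3_def k_def using \<alpha> \<beta> lex one pos that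
      by (intro weight_monomial_le[OF cp s, where i = 1 and k = 1]) auto
    have M4: "s powr t * (1 * 1) * (exp (- s * D) * (A powr (- (\<alpha> + 1/2)) * B powr (- (\<beta> + 1/2)))) \<le> k4 * (s powr (t - (\<alpha> + 1/2) - (\<beta> + 1/2)) * W)" for t
      unfolding D_def A_def B_def X_def Y_def W_def k4_def k_def using \<alpha> \<beta> lex one pos
      by (intro weight_monomial_le[OF cp s, where i = 0 and k = 0]) auto
    have sp: "s powr (\<alpha> + \<beta>) * s = s powr (\<alpha> + \<beta> + 1)" "s powr (\<alpha> + \<beta>) * s\<^sup>2 = s powr (\<alpha> + \<beta> + 2)"
      using s by (simp_all add: powr_add)
    \<comment> \<open>The remaining powers of s: 0 for three gradient terms, -1/2 for the size, and
      1/2 for the gradient term with y x' - x y'.\<close>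
    have t0: "\<alpha> + \<beta> + 2 - (\<alpha> + 3/2) - (\<beta> + 1/2) = 0" "\<alpha> + \<beta> + 2 - (\<alpha> + 1) - (\<beta> + 1) = 0"
      "\<alpha> + \<beta> + 1 - (\<alpha> + 1/2) - (\<beta> + 1/2) = 0" "\<alpha> + \<beta> + 1 - (\<alpha> + 1) - (\<beta> + 1/2) = - 1/2"
      "\<alpha> + \<beta> + 2 - (\<alpha> + 1) - (\<beta> + 1/2) = 1/2" by simp_all
    note M1a = M1[of "\<alpha> + \<beta> + 1", unfolded t0(4)] and M1b = M1[of "\<alpha> + \<beta> + 2", unfolded t0(5)]
      and M2a = M2[of "\<alpha> + \<beta> + 2", unfolded t0(1)] and M4a = M4[of "\<alpha> + \<beta> + 1", unfolded t0(3)]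
    note M3a = M3[where t = "\<alpha> + \<beta> + 2", unfolded t0(2)]
    have EF: "\<mu> * (E * F) / x \<le> C1 * C2 * (s * (x' * 1) * (A powr (- (\<alpha> + 1)) * B powr (- (\<beta> + 1/2))))"
    proof -
      have "(\<mu> * E) * F / x \<le> (C2 * (s * X) * A powr (- (\<alpha> + 1))) * (C1 * B powr (- (\<beta> + 1/2))) / x"
        by (rule divide_right_mono[OF mult_mono[OF EB(1) FB(1)]]) (use C2 sz E0 pos in auto)
      also have "\<dots> = C1 * C2 * (s * (x' * 1) * (A powr (- (\<alpha> + 1)) * B powr (- (\<beta> + 1/2))))"
        using pos unfolding X_def by simp
      finally show ?thesis by (simp add: mult.assoc)
    qed
    have EF': "\<mu> * (E * \<bar>F'\<bar>) \<le> C1 * C2 * (s * X * (A powr (- (\<alpha> + 1)) * B powr (- (\<beta> + 1))))"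
    proof -
      have "(\<mu> * E) * \<bar>F'\<bar> \<le> (C2 * (s * X) * A powr (- (\<alpha> + 1))) * (C1 * B powr (- (\<beta> + 1)))"
        by (rule mult_mono[OF EB(1) FB(2)]) (use C2 sz in auto)
      then show ?thesis by (simp add: mult_ac)
    qed
    have tri: "\<bar>g * (u + v - w)\<bar> \<le> g * (\<bar>u\<bar> + \<bar>v\<bar> + \<bar>w\<bar>)" for u v w
      using g0 by (simp add: abs_mult mult_left_mono)
    have ee2: "ee * ee \<le> ee" using ee by (simp add: mult_left_le_one_le)
    show "\<mu> * \<bar>wker \<alpha> \<beta> \<mu> \<kappa> s x y x' y'\<bar> \<le> C * sweight \<alpha> \<beta> x y x' y' * (s powr (-1/2) * exp (- (1/2) * chord x y x' y' * s))"
    proof -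
      have "\<mu> * \<bar>wker \<alpha> \<beta> \<mu> \<kappa> s x y x' y'\<bar> = g * (\<mu> * (E * F) / x)"
        unfolding wker_def g_def E_def[symmetric] F_def[symmetric] X_def[symmetric] Y_def[symmetric] D_def[symmetric]
        using E0 pos by (simp add: abs_mult E_def F_def X_def Y_def)
      also have "\<dots> \<le> g * (C1 * C2 * (s * (x' * 1) * (A powr (- (\<alpha> + 1)) * B powr (- (\<beta> + 1/2)))))"
        by (intro mult_left_mono EF g0)
      also have "\<dots> = 2 * C1 * C2 * (ee * ee) * ((s powr (\<alpha> + \<beta>) * s) * (x' * 1) * (exp (- s * D) * (A powr (- (\<alpha> + 1)) * B powr (- (\<beta> + 1/2)))))"
        unfolding g by (simp only: mult_ac)
      also have "\<dots> \<le> 2 * C1 * C2 * (ee * ee) * (k1 * (s powr (- 1/2) * W))"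
        unfolding sp using C1 C2 ee by (intro mult_left_mono M1a) auto
      also have "\<dots> \<le> 2 * C1 * C2 * ee * (k1 * (s powr (- 1/2) * W))"
        using C1 C2 ee2 ks W0 by (intro mult_right_mono mult_left_mono) auto
      also have "\<dots> = (C1 * C2 * (2 * k1)) * (W * (s powr (- 1/2) * ee))" by (simp only: mult_ac)
      also have "\<dots> \<le> C * (W * (s powr (- 1/2) * ee))"
        unfolding C_def using C1 C2 ks W0 ee by (intro mult_right_mono mult_left_mono) auto
      finally show ?thesis unfolding W_def ee_def D_def by (simp add: mult.assoc)
    qed
    \<comment> \<open>The excess s powr (1/2) meets the sqrt D from |y x' - x y'|, and sqrt (s D) is
      absorbed by one of the two factors \<open>ee\<close>.\<close>
    have T2: "g * (s * \<bar>y * x' - x * y'\<bar> * (\<mu> * (E * F) / x)) \<le> C1 * C2 * (4 * k1) * (W * ee)"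
    proof -
      have "g * (s * \<bar>y * x' - x * y'\<bar> * (\<mu> * (E * F) / x)) \<le>
         g * (s * (2 * sqrt D) * (C1 * C2 * (s * (x' * 1) * (A powr (- (\<alpha> + 1)) * B powr (- (\<beta> + 1/2))))))"
      proof (rule mult_left_mono[OF _ g0], rule mult_mono[OF mult_left_mono[OF cb(3)] EF])
        show "0 \<le> s * (2 * sqrt D)" using s cb(1) by simp
        show "0 \<le> \<mu> * (E * F) / x" using E0 \<mu> pos by simp
      qed (use s in simp)
      also have "\<dots> = 4 * C1 * C2 * (ee * (ee * sqrt D)) * ((s powr (\<alpha> + \<beta>) * s\<^sup>2) * (x' * 1) * (exp (- s * D) * (A powr (- (\<alpha> + 1)) * B powr (- (\<beta> + 1/2)))))"
        unfolding g power2_eq_square by (simp only: mult_ac numeral_times_numeral[symmetric])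
      also have "\<dots> \<le> 4 * C1 * C2 * (ee * (ee * sqrt D)) * (k1 * (s powr (1/2) * W))"
        unfolding sp using C1 C2 ee cb(1) by (intro mult_left_mono M1b) auto
      also have "\<dots> = C1 * C2 * (4 * k1) * (W * ee) * (s powr (1/2) * sqrt D * ee)" by (simp only: mult_ac)
      also have "\<dots> \<le> C1 * C2 * (4 * k1) * (W * ee) * 1"
      proof (rule mult_left_mono)
        show "s powr (1/2) * sqrt D * ee \<le> 1"
          using sqrt_mult_exp_le[of "D * s"] s cb(1) unfolding ee_def
          by (simp add: powr_half_sqrt real_sqrt_mult mult_ac)
      qed (use C1 C2 ks W0 ee in auto)
      finally show ?thesis by simp
    qed
    \<comment> \<open>One estimate for the E F' terms of both derivatives, with m = 1 in \<theta>
      and m = x' / x in \<phi>.\<close>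
    have T3: "g * (s * w / 2 * (\<mu> * (E * \<bar>F'\<bar>) * m)) \<le> C1 * C2 * k3 * (W * ee)"
      if w: "w = y \<or> w = y'" and m: "0 \<le> m" "X * m \<le> x'" for w m
    proof -
      have w0: "w > 0" using w pos by auto
      have "g * (s * w / 2 * (\<mu> * (E * \<bar>F'\<bar>) * m)) \<le> g * (s * w / 2 * (C1 * C2 * (s * X * (A powr (- (\<alpha> + 1)) * B powr (- (\<beta> + 1)))) * m))"
        using g0 s w0 EF' m by (intro mult_left_mono mult_right_mono) auto
      also have "\<dots> = (g * (s * w / 2) * (C1 * C2 * s * (A powr (- (\<alpha> + 1)) * B powr (- (\<beta> + 1))))) * (X * m)"
        by (simp only: mult_ac)
      also have "\<dots> \<le> (g * (s * w / 2) * (C1 * C2 * s * (A powr (- (\<alpha> + 1)) * B powr (- (\<beta> + 1))))) * x'"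
        using g0 s w0 C1 C2 m by (intro mult_left_mono) auto
      also have "\<dots> = C1 * C2 * (ee * ee) * ((s powr (\<alpha> + \<beta>) * s\<^sup>2) * (x' * w) * (exp (- s * D) * (A powr (- (\<alpha> + 1)) * B powr (- (\<beta> + 1)))))"
        unfolding g power2_eq_square by simp
      also have "\<dots> \<le> C1 * C2 * (ee * ee) * (k3 * (s powr 0 * W))"
        unfolding sp using C1 C2 ee by (intro mult_left_mono M3a w) auto
      also have "\<dots> \<le> C1 * C2 * ee * (k3 * (s powr 0 * W))"
        using C1 C2 ee2 ks W0 by (intro mult_right_mono mult_left_mono) auto
      finally show ?thesis using s by (simp add: mult_ac)
    qed
    have fin: "C1 * C2 * u * (W * ee) \<le> C * (W * ee)" if "u \<le> 4 * k1 + k2 + k3 + k4" for u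
      unfolding C_def using C1 C2 that W0 ee by (intro mult_right_mono mult_left_mono) auto
    have X1: "X * 1 \<le> x'" "X * (x' / x) \<le> x'" unfolding X_def using pos cb by (auto simp: mult_left_le_one_le mult_left_le)
    show "\<mu> * \<bar>wker_d1 \<alpha> \<beta> \<mu> \<kappa> s x y x' y'\<bar> \<le> C * sweight \<alpha> \<beta> x y x' y' * exp (- (1/2) * chord x y x' y' * s)"
      if m2: "\<mu> = 1 \<or> \<mu> \<ge> 2"
    proof -
      define Q where "Q = s * X * E' - E"
      have Q: "\<mu> * \<bar>Q\<bar> \<le> C2 * (s * X)\<^sup>2 * A powr (- (\<alpha> + 3/2))"
        using G(3)[OF \<mu> sz(1) m2] unfolding Q_def E_def E'_def A_def by simp
      have T1: "g * (y / (2 * x\<^sup>2) * (\<mu> * \<bar>Q\<bar>) * F) \<le> C1 * C2 * k2 * (W * ee)"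
      proof -
        have h1: "(\<mu> * \<bar>Q\<bar>) * F \<le> (C2 * (s * X)\<^sup>2 * A powr (- (\<alpha> + 3/2))) * (C1 * B powr (- (\<beta> + 1/2)))"
          by (rule mult_mono[OF Q FB(1)]) (use C2 E0 in auto)
        have h2: "y / (2 * x\<^sup>2) \<le> 1 / (2 * x\<^sup>2)" using cb by (intro divide_right_mono) auto
        have "y / (2 * x\<^sup>2) * ((\<mu> * \<bar>Q\<bar>) * F) \<le> 1 / (2 * x\<^sup>2) * ((C2 * (s * X)\<^sup>2 * A powr (- (\<alpha> + 3/2))) * (C1 * B powr (- (\<beta> + 1/2))))"
          by (rule mult_mono[OF h2 h1]) (use E0 \<mu> in auto)
        from mult_left_mono[OF this g0]
        have "g * (y / (2 * x\<^sup>2) * (\<mu> * \<bar>Q\<bar>) * F) \<le> g * (1 / (2 * x\<^sup>2) * ((C2 * (s * X)\<^sup>2 * A powr (- (\<alpha> + 3/2))) * (C1 * B powr (- (\<beta> + 1/2)))))"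
          by (simp only: mult.assoc)
        also have "\<dots> = C1 * C2 * (ee * ee) * ((s powr (\<alpha> + \<beta>) * s\<^sup>2) * (x'\<^sup>2 * 1) * (exp (- s * D) * (A powr (- (\<alpha> + 3/2)) * B powr (- (\<beta> + 1/2)))))"
          unfolding g X_def using pos by (simp add: power_mult_distrib)
        also have "\<dots> \<le> C1 * C2 * (ee * ee) * (k2 * (s powr 0 * W))"
          unfolding sp using C1 C2 ee by (intro mult_left_mono M2a) auto
        also have "\<dots> \<le> C1 * C2 * ee * (k2 * (s powr 0 * W))"
          using C1 C2 ee2 ks W0 by (intro mult_right_mono mult_left_mono) auto
        finally show ?thesis using s by (simp add: mult_ac)
      qed
      have "wker_d1 \<alpha> \<beta> \<mu> \<kappa> s x y x' y' = g * (y / (2 * x\<^sup>2) * Q * F + s / x * (y * x' - x * y') * (E * F) - s * y' / 2 * (E * F'))"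
        unfolding wker_d1_def g_def Q_def E_def E'_def F_def F'_def D_def X_def Y_def by simp
      also have "\<bar>\<dots>\<bar> \<le> g * (\<bar>y / (2 * x\<^sup>2) * Q * F\<bar> + \<bar>s / x * (y * x' - x * y') * (E * F)\<bar> + \<bar>s * y' / 2 * (E * F')\<bar>)"
        by (rule tri)
      finally have "\<mu> * \<bar>wker_d1 \<alpha> \<beta> \<mu> \<kappa> s x y x' y'\<bar> \<le> \<mu> * (g * (\<bar>y / (2 * x\<^sup>2) * Q * F\<bar> + \<bar>s / x * (y * x' - x * y') * (E * F)\<bar> + \<bar>s * y' / 2 * (E * F')\<bar>))"
        using \<mu> by (intro mult_left_mono) auto
      also have "\<dots> = g * (y / (2 * x\<^sup>2) * (\<mu> * \<bar>Q\<bar>) * F) + g * (s * \<bar>y * x' - x * y'\<bar> * (\<mu> * (E * F) / x)) + g * (s * y' / 2 * (\<mu> * (E * \<bar>F'\<bar>) * 1))"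
        using pos s E0 by (simp add: abs_mult distrib_left mult_ac)
      also have "\<dots> \<le> C1 * C2 * k2 * (W * ee) + C1 * C2 * (4 * k1) * (W * ee) + C1 * C2 * k3 * (W * ee)"
        by (intro add_mono T1 T2 T3) (use X1 in auto)
      also have "\<dots> = C1 * C2 * (k2 + 4 * k1 + k3) * (W * ee)" by (simp add: algebra_simps)
      also have "\<dots> \<le> C * (W * ee)" by (rule fin) (use ks in simp)
      finally show ?thesis unfolding W_def ee_def D_def by (simp add: mult.assoc)
    qed
    show "\<mu> * \<bar>wker_d2 \<alpha> \<beta> \<mu> \<kappa> s x y x' y'\<bar> \<le> C * sweight \<alpha> \<beta> x y x' y' * exp (- (1/2) * chord x y x' y' * s)"
    proof -
      have T1: "g * (s * y' / 2 * (\<mu> * \<bar>E'\<bar>) * F) \<le> C1 * C2 * k4 * (W * ee)"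
      proof -
        have h1: "(\<mu> * \<bar>E'\<bar>) * F \<le> (C2 * A powr (- (\<alpha> + 1/2))) * (C1 * B powr (- (\<beta> + 1/2)))"
          by (rule mult_mono[OF EB(2) FB(1)]) (use C2 E0 in auto)
        have h2: "s * y' / 2 \<le> s * 1 / 2" using cb s by (intro divide_right_mono mult_left_mono) auto
        have "s * y' / 2 * ((\<mu> * \<bar>E'\<bar>) * F) \<le> s * 1 / 2 * ((C2 * A powr (- (\<alpha> + 1/2))) * (C1 * B powr (- (\<beta> + 1/2))))"
          by (rule mult_mono[OF h2 h1]) (use E0 \<mu> s in auto)
        from mult_left_mono[OF this g0]
        have "g * (s * y' / 2 * (\<mu> * \<bar>E'\<bar>) * F) \<le> g * (s * 1 / 2 * ((C2 * A powr (- (\<alpha> + 1/2))) * (C1 * B powr (- (\<beta> + 1/2)))))"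
          by (simp only: mult.assoc)
        also have "\<dots> = C1 * C2 * (ee * ee) * ((s powr (\<alpha> + \<beta>) * s) * (1 * 1) * (exp (- s * D) * (A powr (- (\<alpha> + 1/2)) * B powr (- (\<beta> + 1/2)))))"
          unfolding g by simp
        also have "\<dots> \<le> C1 * C2 * (ee * ee) * (k4 * (s powr 0 * W))"
          unfolding sp using C1 C2 ee by (intro mult_left_mono M4a) auto
        also have "\<dots> \<le> C1 * C2 * ee * (k4 * (s powr 0 * W))"
          using C1 C2 ee2 ks W0 by (intro mult_right_mono mult_left_mono) auto
        finally show ?thesis using s by (simp add: mult_ac)
      qed
      have "wker_d2 \<alpha> \<beta> \<mu> \<kappa> s x y x' y' = g * (s * y' / 2 * E' * F + s / x * (x * y' - y * x') * (E * F) - s * y * x' / (2 * x) * (E * F'))"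
        unfolding wker_d2_def g_def E_def E'_def F_def F'_def D_def X_def Y_def by simp
      also have "\<bar>\<dots>\<bar> \<le> g * (\<bar>s * y' / 2 * E' * F\<bar> + \<bar>s / x * (x * y' - y * x') * (E * F)\<bar> + \<bar>s * y * x' / (2 * x) * (E * F')\<bar>)"
        by (rule tri)
      finally have "\<mu> * \<bar>wker_d2 \<alpha> \<beta> \<mu> \<kappa> s x y x' y'\<bar> \<le> \<mu> * (g * (\<bar>s * y' / 2 * E' * F\<bar> + \<bar>s / x * (x * y' - y * x') * (E * F)\<bar> + \<bar>s * y * x' / (2 * x) * (E * F')\<bar>))"
        using \<mu> by (intro mult_left_mono) auto
      also have "\<dots> = g * (s * y' / 2 * (\<mu> * \<bar>E'\<bar>) * F) + g * (s * \<bar>y * x' - x * y'\<bar> * (\<mu> * (E * F) / x)) + g * (s * y / 2 * (\<mu> * (E * \<bar>F'\<bar>) * (x' / x)))"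
        using pos s E0 by (simp add: abs_mult distrib_left mult_ac abs_minus_commute)
      also have "\<dots> \<le> C1 * C2 * k4 * (W * ee) + C1 * C2 * (4 * k1) * (W * ee) + C1 * C2 * k3 * (W * ee)"
        by (intro add_mono T1 T2 T3) (use X1 pos in auto)
      also have "\<dots> = C1 * C2 * (k4 + 4 * k1 + k3) * (W * ee)" by (simp add: algebra_simps)
      also have "\<dots> \<le> C * (W * ee)" by (rule fin) (use ks in simp)
      finally show ?thesis unfolding W_def ee_def D_def by (simp add: mult.assoc)
    qed
  qed
qed

text \<open>Differentiation under the integral sign for a gradient in several variables. The mean
  value inequality turns the bound on the gradient over a ball into the bound 2 w for the quotient
  \<open>e\<close> of the remainder, and dominated convergence along sequences tending to p
  concludes.\<close>

lemma GDERIV_integral: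
  fixes f :: "'a::euclidean_space \<Rightarrow> 'b \<Rightarrow> real" and G :: "'a \<Rightarrow> 'b \<Rightarrow> 'a"
  assumes r: "r > 0"
    and der: "\<And>q s. q \<in> ball p r \<Longrightarrow> GDERIV (\<lambda>q. f q s) q :> G q s"
    and bnd: "\<And>q s. q \<in> ball p r \<Longrightarrow> norm (G q s) \<le> w s"
    and w: "integrable M w"
    and int: "\<And>q. q \<in> ball p r \<Longrightarrow> integrable M (f q)"
    and meas: "G p \<in> borel_measurable M"
  shows "GDERIV (\<lambda>q. \<integral>s. f q s \<partial>M) p :> (\<integral>s. G p s \<partial>M)" "integrable M (G p)"
proof -
  have pr: "p \<in> ball p r" using r by simp
  have w0: "0 \<le> w s" for s using bnd[OF pr, of s] norm_ge_zero order_trans by blast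
  show Gi: "integrable M (G p)"
    using bnd[OF pr] w0 by (intro Bochner_Integration.integrable_bound[OF w meas]) auto
  define e where "e q s = (f q s - f p s - inner (q - p) (G p s)) / norm (q - p)" for q s
  have lip: "\<bar>f q s - f p s\<bar> \<le> w s * norm (q - p)" if q: "q \<in> ball p r" for q s
  proof -
    have "norm (f q s - f p s) \<le> w s * norm (q - p)"
    proof (rule differentiable_bound[where S = "ball p r" and f' = "\<lambda>x h. inner h (G x s)"])
      fix x assume x: "x \<in> ball p r"
      show "((\<lambda>q. f q s) has_derivative (\<lambda>h. inner h (G x s))) (at x within ball p r)"
        using der[OF x, of s] unfolding gderiv_def by (rule has_derivative_at_withinI)
      show "onorm (\<lambda>h. inner h (G x s)) \<le> w s"
      proof (rule onorm_le)
        fix h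
        have "norm (inner h (G x s)) \<le> norm h * norm (G x s)" using Cauchy_Schwarz_ineq2 by simp
        also have "\<dots> \<le> norm h * w s" using bnd[OF x] by (intro mult_left_mono) auto
        finally show "norm (inner h (G x s)) \<le> w s * norm h" by (simp add: mult.commute)
      qed
    qed (use q pr in auto)
    then show ?thesis by simp
  qed
  have ebnd: "\<bar>e q s\<bar> \<le> 2 * w s" if q: "q \<in> ball p r" for q s
  proof (cases "q = p")
    case False
    have "\<bar>inner (q - p) (G p s)\<bar> \<le> norm (q - p) * norm (G p s)" by (rule Cauchy_Schwarz_ineq2)
    also have "\<dots> \<le> norm (q - p) * w s" using bnd[OF pr] by (intro mult_left_mono) auto
    finally have "\<bar>f q s - f p s - inner (q - p) (G p s)\<bar> \<le> w s * norm (q - p) + norm (q - p) * w s"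
      using lip[OF q, of s] by linarith
    then have "\<bar>f q s - f p s - inner (q - p) (G p s)\<bar> \<le> 2 * w s * norm (q - p)" by simp
    then show ?thesis using False unfolding e_def by (simp add: pos_divide_le_eq)
  qed (use w0 in \<open>simp add: e_def\<close>)
  have elim: "((\<lambda>q. e q s) \<longlongrightarrow> 0) (at p)" for s
  proof -
    have "((\<lambda>q. f q s) has_derivative (\<lambda>h. inner h (G p s))) (at p)"
      using der[OF pr] unfolding gderiv_def .
    then have "((\<lambda>q. norm (f q s - f p s - inner (q - p) (G p s)) / norm (q - p)) \<longlongrightarrow> 0) (at p)"
      unfolding has_derivative_iff_norm by simp
    then have "((\<lambda>q. norm (e q s)) \<longlongrightarrow> 0) (at p)" unfolding e_def by simp
    then show ?thesis by (rule tendsto_norm_zero_cancel)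
  qed
  have int_e: "integrable M (e q)" if "q \<in> ball p r" for q
    unfolding e_def using int[OF that] int[OF pr] Gi by auto
  have main: "((\<lambda>q. norm ((\<integral>s. f q s \<partial>M) - (\<integral>s. f p s \<partial>M) - inner (q - p) (\<integral>s. G p s \<partial>M)) / norm (q - p)) \<longlongrightarrow> 0) (at p)"
  proof (rule tendsto_at_iff_sequentially[THEN iffD2], intro allI impI)
    fix X :: "nat \<Rightarrow> 'a" assume X: "\<forall>i. X i \<in> UNIV - {p}" "X \<longlonglongrightarrow> p"
    \<comment> \<open>Finitely many members of the sequence may leave the ball; replacing them by p
      keeps the domination valid for every index, and \<open>e p\<close> is 0.\<close>
    define Q where "Q i = (if X i \<in> ball p r then X i else p)" for i
    have Q: "Q i \<in> ball p r" for i unfolding Q_def using pr by simp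
    have ev: "\<forall>\<^sub>F i in sequentially. X i \<in> ball p r"
      using X(2) r by (intro topological_tendstoD) auto
    have "(\<lambda>i. \<integral>s. e (Q i) s \<partial>M) \<longlonglongrightarrow> (\<integral>s. 0 \<partial>M)"
    proof (rule integral_dominated_convergence[where w = "\<lambda>s. 2 * w s"])
      show "integrable M (\<lambda>s. 2 * w s)" using w by simp
      show "AE s in M. (\<lambda>i. e (Q i) s) \<longlonglongrightarrow> 0"
      proof (rule AE_I2)
        fix s
        have "(\<lambda>i. e (X i) s) \<longlonglongrightarrow> 0"
          using elim[of s] X unfolding tendsto_at_iff_sequentially comp_def by blast
        moreover have "\<forall>\<^sub>F i in sequentially. e (X i) s = e (Q i) s"
          using ev by eventually_elim (simp add: Q_def)
        ultimately show "(\<lambda>i. e (Q i) s) \<longlonglongrightarrow> 0" by (rule Lim_transform_eventually)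
      qed
      show "AE s in M. norm (e (Q i) s) \<le> 2 * w s" for i using ebnd[OF Q] by simp
      show "e (Q i) \<in> borel_measurable M" for i using int_e[OF Q] by auto
    qed simp
    then have lim0: "(\<lambda>i. norm (\<integral>s. e (Q i) s \<partial>M)) \<longlonglongrightarrow> 0"
      using tendsto_norm by fastforce
    have eqi: "norm (\<integral>s. e (Q i) s \<partial>M) = norm ((\<integral>s. f (X i) s \<partial>M) - (\<integral>s. f p s \<partial>M) - inner (X i - p) (\<integral>s. G p s \<partial>M)) / norm (X i - p)"
      if "X i \<in> ball p r" for i
    proof -
      have "(\<integral>s. e (Q i) s \<partial>M) = ((\<integral>s. f (X i) s \<partial>M) - (\<integral>s. f p s \<partial>M) - inner (X i - p) (\<integral>s. G p s \<partial>M)) / norm (X i - p)"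
        using that int[OF that] int[OF pr] Gi unfolding Q_def e_def by simp
      then show ?thesis by simp
    qed
    have "\<forall>\<^sub>F i in sequentially. norm (\<integral>s. e (Q i) s \<partial>M) = norm ((\<integral>s. f (X i) s \<partial>M) - (\<integral>s. f p s \<partial>M) - inner (X i - p) (\<integral>s. G p s \<partial>M)) / norm (X i - p)"
      by (rule eventually_mono[OF ev]) (rule eqi)
    with lim0 show "((\<lambda>q. norm ((\<integral>s. f q s \<partial>M) - (\<integral>s. f p s \<partial>M) - inner (q - p) (\<integral>s. G p s \<partial>M)) / norm (q - p)) \<circ> X) \<longlonglongrightarrow> 0"
      unfolding comp_def by (rule Lim_transform_eventually)
  qed
  show "GDERIV (\<lambda>q. \<integral>s. f q s \<partial>M) p :> (\<integral>s. G p s \<partial>M)"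
    unfolding gderiv_def has_derivative_iff_norm using main by (auto intro: bounded_linear_inner_left)
qed

lemma GDERIV_wker:
  assumes s: "s > 0" and q: "0 < fst q" "fst q < pi" "0 < snd q" "snd q < pi"
    and ab: "\<alpha> + \<mu> > -1" "\<beta> + \<kappa> > -1"
  shows "GDERIV (\<lambda>q. wker \<alpha> \<beta> \<mu> \<kappa> s (sin (fst q / 2)) (cos (fst q / 2)) (sin (snd q / 2)) (cos (snd q / 2))) q :>
    (wker_d1 \<alpha> \<beta> \<mu> \<kappa> s (sin (fst q / 2)) (cos (fst q / 2)) (sin (snd q / 2)) (cos (snd q / 2)),
     wker_d2 \<alpha> \<beta> \<mu> \<kappa> s (sin (fst q / 2)) (cos (fst q / 2)) (sin (snd q / 2)) (cos (snd q / 2)))"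
proof -
  define x y x' y' where "x = sin (fst q / 2)" and "y = cos (fst q / 2)" and "x' = sin (snd q / 2)" and "y' = cos (snd q / 2)"
  have pos: "x > 0" "y > 0" "x' > 0" "y' > 0"
    unfolding x_def y_def x'_def y'_def using q by (auto intro!: sin_gt_zero cos_gt_zero_pi)
  define E E' F F' where "E = ebes \<alpha> \<mu> (s * (x * x'))" and "E' = debes \<alpha> \<mu> (s * (x * x'))"
    and "F = ebes \<beta> \<kappa> (s * (y * y'))" and "F' = debes \<beta> \<kappa> (s * (y * y'))"
  have S1: "GDERIV (\<lambda>q::real\<times>real. sin (fst q / 2)) q :> (y / 2, 0)"
    and C1: "GDERIV (\<lambda>q::real\<times>real. cos (fst q / 2)) q :> (- x / 2, 0)"
    and S2: "GDERIV (\<lambda>q::real\<times>real. sin (snd q / 2)) q :> (0, y' / 2)"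
    and C2: "GDERIV (\<lambda>q::real\<times>real. cos (snd q / 2)) q :> (0, - x' / 2)"
    unfolding gderiv_def x_def y_def x'_def y'_def
    by (auto intro!: derivative_eq_intros ext simp: inner_prod_def)
  have SS: "GDERIV (\<lambda>q::real\<times>real. sin (fst q / 2) * sin (snd q / 2)) q :> (y * x' / 2, x * y' / 2)"
    by (rule GDERIV_subst[OF GDERIV_mult[OF S1 S2]]) (simp add: x_def x'_def)
  have CC: "GDERIV (\<lambda>q::real\<times>real. cos (fst q / 2) * cos (snd q / 2)) q :> (- (x * y') / 2, - (y * x') / 2)"
    by (rule GDERIV_subst[OF GDERIV_mult[OF C1 C2]]) (simp add: y_def y'_def)
  have GX: "GDERIV (\<lambda>q. s * (sin (fst q / 2) * sin (snd q / 2))) q :> (s * (y * x') / 2, s * (x * y') / 2)"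
    by (rule GDERIV_subst[OF GDERIV_mult[OF GDERIV_const SS]]) simp
  have GY: "GDERIV (\<lambda>q. s * (cos (fst q / 2) * cos (snd q / 2))) q :> (- (s * (x * y')) / 2, - (s * (y * x')) / 2)"
    by (rule GDERIV_subst[OF GDERIV_mult[OF GDERIV_const CC]]) simp
  have GI: "GDERIV (\<lambda>q. inverse (sin (fst q / 2))) q :> (- (y / (2 * x\<^sup>2)), 0)"
  proof -
    have "sin (fst q / 2) \<noteq> 0" using pos unfolding x_def by simp
    note I = GDERIV_inverse[OF S1 this, folded x_def]
    have e: "- (inverse x)\<^sup>2 * (y / 2) = - (y / (2 * x\<^sup>2))" using pos by (simp add: field_simps)
    show ?thesis by (rule GDERIV_subst[OF I]) (simp only: scaleR_Pair real_scaleR_def e mult_zero_right)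
  qed
  have GC: "GDERIV (\<lambda>q. exp (- 2 * s * chord (sin (fst q / 2)) (cos (fst q / 2)) (sin (snd q / 2)) (cos (snd q / 2)))) q :>
     exp (- 2 * s * chord x y x' y') *\<^sub>R (s * (y * x' - x * y'), s * (x * y' - y * x'))"
  proof -
    have "GDERIV (\<lambda>q. - 2 * s * chord (sin (fst q / 2)) (cos (fst q / 2)) (sin (snd q / 2)) (cos (snd q / 2))) q :>
      (s * (y * x' - x * y'), s * (x * y' - y * x'))"
      unfolding chord_def
      by (rule GDERIV_subst[OF GDERIV_mult[OF GDERIV_const GDERIV_diff[OF GDERIV_diff[OF GDERIV_const SS] CC]]])
        (simp add: right_diff_distrib)
    from GDERIV_DERIV_compose[OF this DERIV_exp] show ?thesis unfolding x_def y_def x'_def y'_def .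
  qed
  have GE: "GDERIV (\<lambda>q. ebes \<alpha> \<mu> (s * (sin (fst q / 2) * sin (snd q / 2)))) q :> E' *\<^sub>R (s * (y * x') / 2, s * (x * y') / 2)"
    unfolding E'_def x_def x'_def
    by (rule GDERIV_DERIV_compose[OF GX[unfolded x_def x'_def] DERIV_ebes[OF _ ab(1)]]) (use s pos in \<open>simp add: x_def x'_def\<close>)
  have GF: "GDERIV (\<lambda>q. ebes \<beta> \<kappa> (s * (cos (fst q / 2) * cos (snd q / 2)))) q :> F' *\<^sub>R (- (s * (x * y')) / 2, - (s * (y * x')) / 2)"
    unfolding F'_def y_def y'_def
    by (rule GDERIV_DERIV_compose[OF GY[unfolded y_def y'_def] DERIV_ebes[OF _ ab(2)]]) (use s pos in \<open>simp add: y_def y'_def\<close>)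
  define c where "c = 2 * s powr (\<alpha> + \<beta>)"
  define ex where "ex = exp (- 2 * s * chord x y x' y')"
  from GDERIV_mult[OF GDERIV_const[of c] GDERIV_mult[OF GC GDERIV_mult[OF GDERIV_mult[OF GE GF] GI]]]
  have D: "GDERIV (\<lambda>q. c * (exp (- 2 * s * chord (sin (fst q / 2)) (cos (fst q / 2)) (sin (snd q / 2)) (cos (snd q / 2))) *
     (ebes \<alpha> \<mu> (s * (sin (fst q / 2) * sin (snd q / 2))) * ebes \<beta> \<kappa> (s * (cos (fst q / 2) * cos (snd q / 2))) * inverse (sin (fst q / 2))))) q :>
     c *\<^sub>R (ex *\<^sub>R ((E * F) *\<^sub>R (- (y / (2 * x\<^sup>2)), 0)
        + inverse x *\<^sub>R (E *\<^sub>R (F' *\<^sub>R (- (s * (x * y')) / 2, - (s * (y * x')) / 2)) + F *\<^sub>R (E' *\<^sub>R (s * (y * x') / 2, s * (x * y') / 2))))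
      + (E * F * inverse x) *\<^sub>R (ex *\<^sub>R (s * (y * x' - x * y'), s * (x * y' - y * x'))))
      + (ex * (E * F * inverse x)) *\<^sub>R 0"
    unfolding E_def F_def ex_def x_def y_def x'_def y'_def .
  have fn: "(\<lambda>q. c * (exp (- 2 * s * chord (sin (fst q / 2)) (cos (fst q / 2)) (sin (snd q / 2)) (cos (snd q / 2))) *
     (ebes \<alpha> \<mu> (s * (sin (fst q / 2) * sin (snd q / 2))) * ebes \<beta> \<kappa> (s * (cos (fst q / 2) * cos (snd q / 2))) * inverse (sin (fst q / 2)))))
    = (\<lambda>q. wker \<alpha> \<beta> \<mu> \<kappa> s (sin (fst q / 2)) (cos (fst q / 2)) (sin (snd q / 2)) (cos (snd q / 2)))"
    by (simp only: wker_def c_def divide_inverse mult.assoc)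
  have gr: "c *\<^sub>R (ex *\<^sub>R ((E * F) *\<^sub>R (- (y / (2 * x\<^sup>2)), 0)
        + inverse x *\<^sub>R (E *\<^sub>R (F' *\<^sub>R (- (s * (x * y')) / 2, - (s * (y * x')) / 2)) + F *\<^sub>R (E' *\<^sub>R (s * (y * x') / 2, s * (x * y') / 2))))
      + (E * F * inverse x) *\<^sub>R (ex *\<^sub>R (s * (y * x' - x * y'), s * (x * y' - y * x'))))
      + (ex * (E * F * inverse x)) *\<^sub>R (0::real \<times> real)
    = (wker_d1 \<alpha> \<beta> \<mu> \<kappa> s x y x' y', wker_d2 \<alpha> \<beta> \<mu> \<kappa> s x y x' y')"
  proof -
    have 1: "c * (ex * (E * F * (- (y / (2 * x\<^sup>2))) + inverse x * (E * (F' * (- (s * (x * y')) / 2)) + F * (E' * (s * (y * x') / 2))))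
        + E * F * inverse x * (ex * (s * (y * x' - x * y')))) = wker_d1 \<alpha> \<beta> \<mu> \<kappa> s x y x' y'"
      unfolding wker_d1_def E_def[symmetric] E'_def[symmetric] F_def[symmetric] F'_def[symmetric] c_def[symmetric] ex_def[symmetric]
      using pos by (simp add: field_simps power2_eq_square)
    have 2: "c * (ex * (inverse x * (E * (F' * (- (s * (y * x')) / 2)) + F * (E' * (s * (x * y') / 2))))
        + E * F * inverse x * (ex * (s * (x * y' - y * x')))) = wker_d2 \<alpha> \<beta> \<mu> \<kappa> s x y x' y'"
      unfolding wker_d2_def E_def[symmetric] E'_def[symmetric] F_def[symmetric] F'_def[symmetric] c_def[symmetric] ex_def[symmetric]
      using pos by (simp add: field_simps)
    show ?thesis unfolding 1[symmetric] 2[symmetric]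
      by (simp only: scaleR_Pair add_Pair real_scaleR_def scaleR_zero_right add_0_right add_0_left mult_zero_right)
  qed
  show ?thesis using D unfolding fn gr unfolding x_def y_def x'_def y'_def .
qed

section \<open>Integration in s and the distance of the angles\<close>

lemma has_bochner_integral_exp_powr:
  fixes a q :: real
  assumes "a > 0" "q > 0"
  shows "has_bochner_integral lborel (\<lambda>s. indicator {0<..} s * (s powr (q - 1) * exp (- a * s))) (a powr (- q) * Gamma q)"
proof (rule has_bochner_integral_nn_integral)
  have "(\<integral>\<^sup>+s. ennreal (indicator {0<..} s * (s powr (q - 1) * exp (- a * s))) \<partial>lborel)
     = (\<integral>\<^sup>+s. ennreal (exp (- a * s) * s powr (q - 1)) * indicator {0..} s \<partial>lborel)"
    by (intro nn_integral_cong_AE) (use AE_lborel_singleton[of "0::real"] in eventually_elim, auto simp: indicator_def mult_ac)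
  then show "(\<integral>\<^sup>+s. ennreal (indicator {0<..} s * (s powr (q - 1) * exp (- a * s))) \<partial>lborel) = ennreal (a powr (- q) * Gamma q)"
    using nn_integral_exp_powr[OF assms] by simp
  show "0 \<le> a powr (- q) * Gamma q" using Gamma_real_pos[OF assms(2)] by simp
qed (auto simp: indicator_def)

lemma sin_ge_half: "0 \<le> u \<Longrightarrow> u \<le> pi / 4 \<Longrightarrow> u / 2 \<le> sin (u::real)"
proof -
  assume u: "0 \<le> u" "u \<le> pi / 4"
  define f where "f x = sin x - x / 2" for x :: real
  have "f 0 \<le> f u"
  proof (rule DERIV_nonneg_imp_nondecreasing[OF u(1)])
    fix x assume x: "0 \<le> x" "x \<le> u"
    have "cos (pi / 3) \<le> cos x" using x u by (intro cos_monotone_0_pi_le) auto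
    then have "cos x \<ge> 1 / 2" by (simp add: cos_60)
    moreover have "(f has_real_derivative (cos x - 1 / 2)) (at x)"
      unfolding f_def by (auto intro!: derivative_eq_intros)
    ultimately show "\<exists>d. (f has_real_derivative d) (at x) \<and> d \<ge> 0" by force
  qed
  then show ?thesis by (simp add: f_def)
qed

lemma circle_pair_trig:
  assumes "\<theta> \<in> {0<..<pi}" "\<phi> \<in> {0<..<pi}"
  shows "circle_pair (sin (\<theta> / 2)) (cos (\<theta> / 2)) (sin (\<phi> / 2)) (cos (\<phi> / 2))"
  unfolding circle_pair_def using assms by (auto intro!: sin_gt_zero cos_gt_zero_pi)

lemma chord_trig_ge:
  assumes "\<theta> \<in> {0<..<pi}" "\<phi> \<in> {0<..<pi}"
  shows "(\<theta> - \<phi>)\<^sup>2 / 32 \<le> chord (sin (\<theta> / 2)) (cos (\<theta> / 2)) (sin (\<phi> / 2)) (cos (\<phi> / 2))"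
proof -
  define u where "u = \<bar>\<theta> - \<phi>\<bar> / 4"
  have u: "0 \<le> u" "u \<le> pi / 4" using assms unfolding u_def by auto
  have "chord (sin (\<theta> / 2)) (cos (\<theta> / 2)) (sin (\<phi> / 2)) (cos (\<phi> / 2)) = 1 - cos (\<theta> / 2 - \<phi> / 2)"
    unfolding chord_def cos_diff by simp
  also have "cos (\<theta> / 2 - \<phi> / 2) = cos (2 * u)"
    unfolding u_def by (cases "\<theta> \<ge> \<phi>") (auto simp: diff_divide_distrib intro: cos_minus[symmetric] simp flip: cos_minus[of "\<phi> / 2 - \<theta> / 2"])
  also have "1 - cos (2 * u) = 2 * (sin u)\<^sup>2" by (simp add: cos_double_sin)
  also have "\<dots> \<ge> 2 * (u / 2)\<^sup>2" using sin_ge_half[OF u] u by (intro mult_left_mono power_mono) auto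
  also have "2 * (u / 2)\<^sup>2 = (\<theta> - \<phi>)\<^sup>2 / 32" unfolding u_def by (simp add: power_divide)
  finally show ?thesis .
qed

text \<open>A Gamma integral whose rate is at least c^2, where c will be a multiple of |\<theta> -
  \<phi>|. The power q = 1/2 produces 1 / c for the size and q = 1 produces 1 / c^2 for the
  gradient.\<close>

lemma exp_powr_integral_bound:
  fixes f :: "real \<Rightarrow> 'a::{banach, second_countable_topology}"
  assumes q: "q > 0" and c: "c > 0" "c\<^sup>2 \<le> a" and B: "B \<ge> 0"
    and f: "f \<in> borel_measurable lborel"
    and bnd: "\<And>s. norm (f s) \<le> B * (indicator {0<..} s * (s powr (q - 1) * exp (- a * s)))"
  shows "integrable lborel f" "norm (\<integral>s. f s \<partial>lborel) \<le> B * (c powr (- 2 * q) * Gamma q)"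
proof -
  define h where "h s = B * (indicator {0<..} s * (s powr (q - 1) * exp (- a * s)))" for s :: real
  have "c\<^sup>2 > 0" using c by simp
  then have a: "a > 0" using c by linarith
  have hb: "has_bochner_integral lborel h (B * (a powr (- q) * Gamma q))"
    unfolding h_def by (intro has_bochner_integral_mult_right has_bochner_integral_exp_powr a q)
  then have hi: "integrable lborel h" and he: "(\<integral>s. h s \<partial>lborel) = B * (a powr (- q) * Gamma q)"
    by (auto simp: has_bochner_integral_iff)
  show fi: "integrable lborel f"
    by (rule Bochner_Integration.integrable_bound[OF hi f])
      (use bnd in \<open>auto intro!: AE_I2 order_trans[OF _ abs_ge_self] simp: h_def\<close>)
  have "norm (\<integral>s. f s \<partial>lborel) \<le> (\<integral>s. h s \<partial>lborel)"
    by (rule Bochner_Integration.integral_norm_bound_integral[OF fi hi]) (use bnd in \<open>auto simp: h_def\<close>)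
  also have "\<dots> \<le> B * ((c\<^sup>2) powr (- q) * Gamma q)"
    unfolding he using B c q Gamma_real_pos[OF q]
    by (intro mult_left_mono mult_right_mono powr_mono2') auto
  also have "(c\<^sup>2) powr (- q) = c powr (- 2 * q)"
  proof -
    have "c\<^sup>2 = c powr 2" using c by simp
    then show ?thesis by (simp only: powr_powr) simp
  qed
  finally show "norm (\<integral>s. f s \<partial>lborel) \<le> B * (c powr (- 2 * q) * Gamma q)" .
qed

definition off_diagonal :: "(real \<times> real) set" where
  "off_diagonal = {q. 0 < fst q \<and> fst q < pi \<and> 0 < snd q \<and> snd q < pi \<and> fst q \<noteq> snd q}"

lemma open_off_diagonal: "open off_diagonal"
  unfolding off_diagonal_def
  by (intro open_Collect_conj open_Collect_less open_Collect_neq continuous_intros)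

text \<open>The indicator is part of the function, so that it can be integrated over the whole line
  and its gradient is defined and bounded for every s, including s \<le> 0.\<close>

definition wfun :: "real \<Rightarrow> real \<Rightarrow> real \<Rightarrow> real \<Rightarrow> real \<times> real \<Rightarrow> real \<Rightarrow> real" where
  "wfun \<alpha> \<beta> \<mu> \<kappa> q s = indicator {0<..} s *
     wker \<alpha> \<beta> \<mu> \<kappa> s (sin (fst q / 2)) (cos (fst q / 2)) (sin (snd q / 2)) (cos (snd q / 2))"

definition wgrad :: "real \<Rightarrow> real \<Rightarrow> real \<Rightarrow> real \<Rightarrow> real \<times> real \<Rightarrow> real \<Rightarrow> real \<times> real" where
  "wgrad \<alpha> \<beta> \<mu> \<kappa> q s = indicator {0<..} s *\<^sub>R
    (wker_d1 \<alpha> \<beta> \<mu> \<kappa> s (sin (fst q / 2)) (cos (fst q / 2)) (sin (snd q / 2)) (cos (snd q / 2)),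
     wker_d2 \<alpha> \<beta> \<mu> \<kappa> s (sin (fst q / 2)) (cos (fst q / 2)) (sin (snd q / 2)) (cos (snd q / 2)))"

definition wint :: "real \<Rightarrow> real \<Rightarrow> real \<Rightarrow> real \<Rightarrow> real \<times> real \<Rightarrow> real" where
  "wint \<alpha> \<beta> \<mu> \<kappa> q = (\<integral>s. wfun \<alpha> \<beta> \<mu> \<kappa> q s \<partial>lborel)"

definition hchord :: "real \<times> real \<Rightarrow> real" where
  "hchord q = chord (sin (fst q / 2)) (cos (fst q / 2)) (sin (snd q / 2)) (cos (snd q / 2))"

definition hweight :: "real \<Rightarrow> real \<Rightarrow> real \<times> real \<Rightarrow> real" where
  "hweight \<alpha> \<beta> q = sweight \<alpha> \<beta> (sin (fst q / 2)) (cos (fst q / 2)) (sin (snd q / 2)) (cos (snd q / 2))"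

lemma borel_measurable_wfun:
  assumes "\<alpha> + \<mu> > -1" "\<beta> + \<kappa> > -1"
  shows "wfun \<alpha> \<beta> \<mu> \<kappa> q \<in> borel_measurable lborel"
proof -
  have [measurable]: "bes (\<alpha> + \<mu>) \<in> borel_measurable borel" "bes (\<beta> + \<kappa>) \<in> borel_measurable borel"
    using assms by (auto intro: borel_measurable_bes)
  show ?thesis unfolding wfun_def wker_def ebes_def by measurable
qed

lemma borel_measurable_wgrad:
  assumes "\<alpha> + \<mu> > -1" "\<beta> + \<kappa> > -1"
  shows "wgrad \<alpha> \<beta> \<mu> \<kappa> q \<in> borel_measurable lborel"
proof -
  have [measurable]: "bes (\<alpha> + \<mu>) \<in> borel_measurable borel" "bes (\<beta> + \<kappa>) \<in> borel_measurable borel"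
    "bes (\<alpha> + \<mu> + 1) \<in> borel_measurable borel" "bes (\<beta> + \<kappa> + 1) \<in> borel_measurable borel"
    using assms by (auto intro: borel_measurable_bes)
  have [measurable]: "(\<lambda>s. wker_d1 \<alpha> \<beta> \<mu> \<kappa> s x y x' y') \<in> borel_measurable lborel" for x y x' y'
    unfolding wker_d1_def debes_def rbes_def ebes_def by measurable
  have [measurable]: "(\<lambda>s. wker_d2 \<alpha> \<beta> \<mu> \<kappa> s x y x' y') \<in> borel_measurable lborel" for x y x' y'
    unfolding wker_d2_def debes_def rbes_def ebes_def by measurable
  show ?thesis unfolding wgrad_def by (intro borel_measurable_scaleR borel_measurable_Pair) auto
qed

text \<open>The form needed for \<open>exp_powr_integral_bound\<close>: the rate left in
  \<open>wker_bounds\<close> is half the chord, and (d / 8)^2 is half of d^2 / 32.\<close>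

lemma hchord_ge: "q \<in> off_diagonal \<Longrightarrow> (\<bar>fst q - snd q\<bar> / 8)\<^sup>2 \<le> hchord q / 2"
  using chord_trig_ge[of "fst q" "snd q"] unfolding off_diagonal_def hchord_def by (simp add: power_divide)

lemma hweight_pos: "q \<in> off_diagonal \<Longrightarrow> hweight \<alpha> \<beta> q > 0"
  using circle_pair_trig[of "fst q" "snd q"]
  unfolding off_diagonal_def hweight_def sweight_def circle_pair_def
  by (auto intro!: mult_pos_pos simp: add_pos_pos)

text \<open>The pointwise bounds of \<open>wker_bounds\<close> integrated in s. For the gradient a
  majorant common to a neighbourhood of the point is required; chord and weight are continuous
  there, so they may be frozen up to factors of 2.\<close>

lemma wint_bounds:
  assumes \<alpha>: "\<alpha> > -1/2" and \<beta>: "\<beta> > -1/2"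
  shows "\<exists>C>0. \<forall>\<mu> \<kappa> q. \<mu> \<ge> 1 \<longrightarrow> \<kappa> = 0 \<or> \<kappa> \<ge> 1 \<longrightarrow> q \<in> off_diagonal \<longrightarrow>
     \<mu> * \<bar>wint \<alpha> \<beta> \<mu> \<kappa> q\<bar> \<le> C * hweight \<alpha> \<beta> q / \<bar>fst q - snd q\<bar> \<and>
     (\<mu> = 1 \<or> \<mu> \<ge> 2 \<longrightarrow> (\<exists>g. (GDERIV (wint \<alpha> \<beta> \<mu> \<kappa>) q :> g) \<and>
        \<mu> * norm g \<le> C * hweight \<alpha> \<beta> q / (fst q - snd q)\<^sup>2))"
proof -
  obtain K where K: "K > 0" and KB: "\<And>\<mu> \<kappa> s x y x' y'. \<mu> \<ge> 1 \<Longrightarrow> \<kappa> = 0 \<or> \<kappa> \<ge> 1 \<Longrightarrow> s > 0 \<Longrightarrow> circle_pair x y x' y' \<Longrightarrow>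
    \<mu> * \<bar>wker \<alpha> \<beta> \<mu> \<kappa> s x y x' y'\<bar> \<le> K * sweight \<alpha> \<beta> x y x' y' * (s powr (-1/2) * exp (- (1/2) * chord x y x' y' * s)) \<and>
    (\<mu> = 1 \<or> \<mu> \<ge> 2 \<longrightarrow> \<mu> * \<bar>wker_d1 \<alpha> \<beta> \<mu> \<kappa> s x y x' y'\<bar> \<le> K * sweight \<alpha> \<beta> x y x' y' * exp (- (1/2) * chord x y x' y' * s)) \<and>
    \<mu> * \<bar>wker_d2 \<alpha> \<beta> \<mu> \<kappa> s x y x' y'\<bar> \<le> K * sweight \<alpha> \<beta> x y x' y' * exp (- (1/2) * chord x y x' y' * s)"
    using wker_bounds[OF assms] by metis
  show ?thesis
  \<comment> \<open>64 comes from (d / 8) powr (- 2), and another 2 from bounding the norm of a pair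
    by the sum of its entries; for the size 8 Gamma (1/2) would be enough.\<close>
  proof (rule exI[of _ "128 * K"], intro conjI allI impI)
    show "128 * K > 0" using K by simp
  next
    fix \<mu> \<kappa> :: real and p :: "real \<times> real"
    assume \<mu>: "\<mu> \<ge> 1" and \<kappa>: "\<kappa> = 0 \<or> \<kappa> \<ge> 1" and p: "p \<in> off_diagonal"
    define d where "d = \<bar>fst p - snd p\<bar>"
    have d: "d > 0" using p unfolding d_def off_diagonal_def by simp
    have ab: "\<alpha> + \<mu> > -1" "\<beta> + \<kappa> > -1" using \<alpha> \<beta> \<mu> \<kappa> by auto
    have cp: "circle_pair (sin (fst q / 2)) (cos (fst q / 2)) (sin (snd q / 2)) (cos (snd q / 2))" if "q \<in> off_diagonal" for q
      using circle_pair_trig[of "fst q" "snd q"] that unfolding off_diagonal_def by auto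
    have fb: "norm (wfun \<alpha> \<beta> \<mu> \<kappa> q s) \<le> K / \<mu> * hweight \<alpha> \<beta> q * (indicator {0<..} s * (s powr (1/2 - 1) * exp (- (hchord q / 2) * s)))"
      if "q \<in> off_diagonal" for q s
    proof (cases "s > 0")
      case True
      then show ?thesis
        using conjunct1[OF KB[OF \<mu> \<kappa> True cp[OF that]]] \<mu> unfolding wfun_def hweight_def hchord_def
        by (simp add: pos_le_divide_eq mult.commute)
    qed (simp add: wfun_def)
    have cpos: "\<bar>fst q - snd q\<bar> / 8 > 0" if "q \<in> off_diagonal" for q
      using that unfolding off_diagonal_def by simp
    have B0: "0 \<le> K / \<mu> * hweight \<alpha> \<beta> q" if "q \<in> off_diagonal" for q
      using K \<mu> hweight_pos[OF that, of \<alpha> \<beta>] by simp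
    have half: "(0::real) < 1 / 2" by simp
    note f_int = exp_powr_integral_bound[OF half _ _ _ borel_measurable_wfun[OF ab]]
    have size: "\<mu> * \<bar>wint \<alpha> \<beta> \<mu> \<kappa> p\<bar> \<le> 128 * K * hweight \<alpha> \<beta> p / d"
    proof -
      have "\<bar>wint \<alpha> \<beta> \<mu> \<kappa> p\<bar> \<le> K / \<mu> * hweight \<alpha> \<beta> p * ((d / 8) powr (- 2 * (1/2)) * Gamma (1/2))"
        using f_int(2)[OF cpos[OF p] hchord_ge[OF p] B0[OF p] fb[OF p]] unfolding wint_def d_def by simp
      also have "(d / 8) powr (- 2 * (1/2)) = 8 / d"
        using d by (simp add: powr_minus_divide)
      finally have "\<mu> * \<bar>wint \<alpha> \<beta> \<mu> \<kappa> p\<bar> \<le> \<mu> * (K / \<mu> * hweight \<alpha> \<beta> p * (8 / d * Gamma (1/2)))"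
        using \<mu> by (intro mult_left_mono) auto
      also have "\<dots> = (K * hweight \<alpha> \<beta> p / d) * (8 * Gamma (1/2))" using \<mu> by simp
      also have "\<dots> \<le> (K * hweight \<alpha> \<beta> p / d) * 128"
      proof (rule mult_left_mono)
        have "sqrt pi \<le> sqrt (2\<^sup>2)" using pi_less_4 by (intro real_sqrt_le_mono) simp
        then show "8 * Gamma (1/2) \<le> (128::real)" by (simp add: Gamma_one_half_real)
        show "0 \<le> K * hweight \<alpha> \<beta> p / d" using K d hweight_pos[OF p, of \<alpha> \<beta>] by simp
      qed
      finally show ?thesis by (simp add: mult_ac)
    qed
    show "\<mu> * \<bar>wint \<alpha> \<beta> \<mu> \<kappa> p\<bar> \<le> 128 * K * hweight \<alpha> \<beta> p / \<bar>fst p - snd p\<bar>" using size unfolding d_def .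
    assume m2: "\<mu> = 1 \<or> \<mu> \<ge> 2"
    have gb: "norm (wgrad \<alpha> \<beta> \<mu> \<kappa> q s) \<le> 2 * K / \<mu> * hweight \<alpha> \<beta> q * (indicator {0<..} s * (s powr (1 - 1) * exp (- (hchord q / 2) * s)))"
      if "q \<in> off_diagonal" for q s
    proof (cases "s > 0")
      case True
      define u v where "u = wker_d1 \<alpha> \<beta> \<mu> \<kappa> s (sin (fst q / 2)) (cos (fst q / 2)) (sin (snd q / 2)) (cos (snd q / 2))"
        and "v = wker_d2 \<alpha> \<beta> \<mu> \<kappa> s (sin (fst q / 2)) (cos (fst q / 2)) (sin (snd q / 2)) (cos (snd q / 2))"
      define R where "R = K * hweight \<alpha> \<beta> q * exp (- (hchord q / 2) * s)"
      have uv: "\<mu> * \<bar>u\<bar> \<le> R" "\<mu> * \<bar>v\<bar> \<le> R"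
        using KB[OF \<mu> \<kappa> True cp[OF that]] m2 unfolding u_def v_def R_def hweight_def hchord_def by auto
      have "norm (wgrad \<alpha> \<beta> \<mu> \<kappa> q s) = norm (u, v)" unfolding wgrad_def u_def v_def using True by simp
      also have "\<dots> \<le> \<bar>u\<bar> + \<bar>v\<bar>" using norm_Pair_le[of u v] by simp
      also have "\<dots> \<le> R / \<mu> + R / \<mu>" using uv \<mu> by (intro add_mono) (auto simp: pos_le_divide_eq mult.commute)
      also have "\<dots> = 2 * K / \<mu> * hweight \<alpha> \<beta> q * (indicator {0<..} s * (s powr (1 - 1) * exp (- (hchord q / 2) * s)))"
        unfolding R_def using True by simp
      finally show ?thesis .
    qed (simp add: wgrad_def)
    define W where "W = hweight \<alpha> \<beta> p"
    define D where "D = hchord p"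
    have W: "W > 0" unfolding W_def by (rule hweight_pos[OF p])
    have "0 < (\<bar>fst p - snd p\<bar> / 8)\<^sup>2" using cpos[OF p] by simp
    then have D: "D > 0" using hchord_ge[OF p] unfolding D_def by linarith
    have fs: "((\<lambda>q. fst q) \<longlongrightarrow> fst p) (nhds p)" "((\<lambda>q. snd q) \<longlongrightarrow> snd p) (nhds p)"
      by (rule tendsto_fst[OF filterlim_ident] tendsto_snd[OF filterlim_ident])+
    have "(hchord \<longlongrightarrow> D) (nhds p)"
      unfolding hchord_def chord_def D_def by (intro tendsto_intros fs) auto
    then have ev1: "\<forall>\<^sub>F q in nhds p. hchord q > D / 2"
      using D by (intro order_tendstoD(1)) auto
    have "(hweight \<alpha> \<beta> \<longlongrightarrow> W) (nhds p)"
      unfolding hweight_def sweight_def W_def using cp[OF p] unfolding circle_pair_def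
      by (intro tendsto_intros fs) auto
    then have ev2: "\<forall>\<^sub>F q in nhds p. hweight \<alpha> \<beta> q < 2 * W"
      using W by (intro order_tendstoD(2)) auto
    have ev3: "\<forall>\<^sub>F q in nhds p. q \<in> off_diagonal"
      using open_off_diagonal p by (rule eventually_nhds_in_open)
    from ev1 ev2 ev3 have "\<forall>\<^sub>F q in nhds p. hchord q > D / 2 \<and> hweight \<alpha> \<beta> q < 2 * W \<and> q \<in> off_diagonal"
      by eventually_elim auto
    then obtain r where r: "r > 0" and near: "\<And>q. q \<in> ball p r \<Longrightarrow> hchord q > D / 2 \<and> hweight \<alpha> \<beta> q < 2 * W \<and> q \<in> off_diagonal"
      unfolding eventually_nhds_metric by (auto simp: dist_commute)
    \<comment> \<open>Near p the chord exceeds D / 2, so the decay rate is at least D / 4, and the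
      weight stays below 2 W.\<close>
    define w where "w s = 2 * K / \<mu> * (2 * W) * (indicator {0<..} s * (s powr (1 - 1) * exp (- (D / 4) * s)))" for s :: real
    have G: "GDERIV (\<lambda>q. \<integral>s. wfun \<alpha> \<beta> \<mu> \<kappa> q s \<partial>lborel) p :> (\<integral>s. wgrad \<alpha> \<beta> \<mu> \<kappa> p s \<partial>lborel)"
    proof (rule GDERIV_integral(1)[OF r, where w = w])
      show "integrable lborel w"
        unfolding w_def using D has_bochner_integral_exp_powr[of "D / 4" 1]
        by (intro integrable_mult_right) (auto simp: has_bochner_integral_iff)
      show "wgrad \<alpha> \<beta> \<mu> \<kappa> p \<in> borel_measurable lborel" by (rule borel_measurable_wgrad[OF ab])
    next
      fix q assume q: "q \<in> ball p r"
      then have qo: "q \<in> off_diagonal" and q2: "hchord q > D / 2" "hweight \<alpha> \<beta> q < 2 * W" using near by auto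
      show "integrable lborel (wfun \<alpha> \<beta> \<mu> \<kappa> q)"
        by (rule f_int(1)[OF cpos[OF qo] hchord_ge[OF qo] B0[OF qo] fb[OF qo]])
      fix s
      show "GDERIV (\<lambda>q. wfun \<alpha> \<beta> \<mu> \<kappa> q s) q :> wgrad \<alpha> \<beta> \<mu> \<kappa> q s"
      proof (cases "s > 0")
        case True
        then show ?thesis unfolding wfun_def wgrad_def
          using GDERIV_wker[OF True _ _ _ _ ab, of q] qo unfolding off_diagonal_def by simp
      qed (simp add: wfun_def wgrad_def GDERIV_const flip: zero_prod_def)
      show "norm (wgrad \<alpha> \<beta> \<mu> \<kappa> q s) \<le> w s"
      proof (cases "s > 0")
        case True
        have "exp (- (hchord q / 2) * s) \<le> exp (- (D / 4) * s)" using q2 True by simp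
        then have "2 * K / \<mu> * hweight \<alpha> \<beta> q * (indicator {0<..} s * (s powr (1 - 1) * exp (- (hchord q / 2) * s))) \<le> w s"
          unfolding w_def using K \<mu> W q2 True hweight_pos[OF qo, of \<alpha> \<beta>]
          by (intro mult_mono) auto
        then show ?thesis using gb[OF qo, of s] by linarith
      qed (simp add: w_def wgrad_def)
    qed
    have "norm (\<integral>s. wgrad \<alpha> \<beta> \<mu> \<kappa> p s \<partial>lborel) \<le> 2 * K / \<mu> * hweight \<alpha> \<beta> p * ((d / 8) powr (- 2 * 1) * Gamma 1)"
      unfolding d_def
      by (rule exp_powr_integral_bound(2)[OF _ cpos[OF p] hchord_ge[OF p] _ borel_measurable_wgrad[OF ab] gb[OF p]])
        (use K \<mu> hweight_pos[OF p, of \<alpha> \<beta>] in auto)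
    also have "(d / 8) powr (- 2 * 1) * Gamma 1 = 64 / d\<^sup>2"
      using d by (simp add: powr_minus_divide power_divide)
    finally have "\<mu> * norm (\<integral>s. wgrad \<alpha> \<beta> \<mu> \<kappa> p s \<partial>lborel) \<le> \<mu> * (2 * K / \<mu> * hweight \<alpha> \<beta> p * (64 / d\<^sup>2))"
      using \<mu> by (intro mult_left_mono) auto
    also have "\<dots> = 128 * K * hweight \<alpha> \<beta> p / d\<^sup>2" using \<mu> by simp
    finally show "\<exists>g. (GDERIV (wint \<alpha> \<beta> \<mu> \<kappa>) p :> g) \<and> \<mu> * norm g \<le> 128 * K * hweight \<alpha> \<beta> p / (fst p - snd p)\<^sup>2"
      using G unfolding wint_def d_def by (intro exI[of _ "\<integral>s. wgrad \<alpha> \<beta> \<mu> \<kappa> p s \<partial>lborel"]) auto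
  qed
qed

subsection \<open>The measure of a ball and the final estimates\<close>

text \<open>Positivity matters because the measure stands in a denominator, where 0 would turn the
  estimate into a bound by 0. As \<open>measure\<close> also gives 0 for infinite values, finiteness
  enters its proof.\<close>

lemma jacobi_measure_interval:
  assumes lu: "0 \<le> l" "l < u" "u \<le> pi"
    and bnd: "\<And>\<psi>. \<psi> \<in> {l<..<u} \<Longrightarrow> sin (\<psi> / 2) powr (2 * \<alpha> + 1) * cos (\<psi> / 2) powr (2 * \<beta> + 1) \<le> N"
  shows "0 < measure (jacobi_measure \<alpha> \<beta>) {l<..<u}"
    "measure (jacobi_measure \<alpha> \<beta>) {l<..<u} \<le> N * (u - l)"
proof -
  define h where "h \<psi> = sin (\<psi> / 2) powr (2 * \<alpha> + 1) * cos (\<psi> / 2) powr (2 * \<beta> + 1)" for \<psi> :: real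
  define E where "E = emeasure (jacobi_measure \<alpha> \<beta>) {l<..<u}"
  have hm [measurable]: "h \<in> borel_measurable borel" unfolding h_def by measurable
  have hpos: "h \<psi> > 0" if "\<psi> \<in> {l<..<u}" for \<psi>
    unfolding h_def using that lu sin_gt_zero[of "\<psi> / 2"] cos_gt_zero_pi[of "\<psi> / 2"]
    by (intro mult_pos_pos) auto
  have N: "N \<ge> 0" using hpos[of "(l + u) / 2"] bnd[of "(l + u) / 2"] lu unfolding h_def by auto
  have sub: "{l<..<u} \<subseteq> {0<..<pi}" using lu by auto
  have "E = (\<integral>\<^sup>+\<psi>. ennreal (h \<psi>) * indicator {l<..<u} \<psi> \<partial>restrict_space lborel {0<..<pi})"
    unfolding E_def jacobi_measure_def h_def[symmetric]
  proof (rule emeasure_density)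
    show "(\<lambda>\<psi>. ennreal (h \<psi>)) \<in> borel_measurable (restrict_space lborel {0<..<pi})"
      by (rule measurable_restrict_space1) measurable
    show "{l<..<u} \<in> sets (restrict_space lborel {0<..<pi})"
      using sub by (subst sets_restrict_space_iff) auto
  qed
  also have "\<dots> = (\<integral>\<^sup>+\<psi>. ennreal (h \<psi>) * indicator {l<..<u} \<psi> * indicator {0<..<pi} \<psi> \<partial>lborel)"
    by (rule nn_integral_restrict_space) simp
  also have "\<dots> = (\<integral>\<^sup>+\<psi>. ennreal (h \<psi>) * indicator {l<..<u} \<psi> \<partial>lborel)"
    using sub by (intro nn_integral_cong) (auto simp: indicator_def)
  finally have E: "E = (\<integral>\<^sup>+\<psi>. ennreal (h \<psi>) * indicator {l<..<u} \<psi> \<partial>lborel)" .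
  have "E \<le> (\<integral>\<^sup>+\<psi>. ennreal N * indicator {l<..<u} \<psi> \<partial>lborel)"
    unfolding E using bnd by (intro nn_integral_mono) (auto simp: indicator_def h_def intro: ennreal_leI)
  also have "\<dots> = ennreal (N * (u - l))"
    using lu N by (simp add: nn_integral_cmult_indicator ennreal_mult)
  finally have le: "E \<le> ennreal (N * (u - l))" .
  have "E \<noteq> 0"
  proof
    assume "E = 0"
    then have "AE \<psi> in lborel. ennreal (h \<psi>) * indicator {l<..<u} \<psi> = 0"
      unfolding E by (subst (asm) nn_integral_0_iff_AE) auto
    then have "AE \<psi> in lborel. \<psi> \<notin> {l<..<u}"
      by eventually_elim (use hpos in \<open>force simp: indicator_def split: if_splits\<close>)
    then have "emeasure lborel {l<..<u} = 0"
      by (subst (asm) AE_iff_measurable[of "{l<..<u}"]) auto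
    then show False using lu by simp
  qed
  moreover have "E < top" using le by (rule le_less_trans) simp
  ultimately show "0 < measure (jacobi_measure \<alpha> \<beta>) {l<..<u}"
    unfolding measure_def E_def by (auto simp: enn2real_positive_iff zero_less_iff_neq_zero)
  show "measure (jacobi_measure \<alpha> \<beta>) {l<..<u} \<le> N * (u - l)"
    unfolding measure_def E_def[symmetric] using le N lu by (intro enn2real_leI) auto
qed

text \<open>A point of the ball is less than 2 max(\<theta>, \<phi>), hence its half is at most
  \<theta> + \<phi>, and on (0, \<pi>) each angle is at most 8 times the sine of its half.\<close>

lemma sin_half_ball_le:
  assumes "\<theta> \<in> {0<..<pi}" "\<phi> \<in> {0<..<pi}" "\<psi> \<in> {0<..<pi}" "\<bar>\<psi> - \<theta>\<bar> < \<bar>\<theta> - \<phi>\<bar>"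
  shows "sin (\<psi> / 2) \<le> 8 * (sin (\<theta> / 2) + sin (\<phi> / 2))"
proof -
  have low: "t / 8 \<le> sin (t / 2)" if t: "t \<in> {0<..<pi}" for t :: real
  proof -
    have "cos (pi / 3) \<le> cos (t / 4)" using t by (intro cos_monotone_0_pi_le) auto
    then have c: "1 / 2 \<le> cos (t / 4)" by (simp add: cos_60)
    have "t / 4 / 2 * (1 / 2) \<le> sin (t / 4) * cos (t / 4)"
      using t c sin_ge_half[of "t / 4"] by (intro mult_mono) auto
    moreover have "sin (t / 2) = 2 * (sin (t / 4) * cos (t / 4))"
      using sin_double[of "t / 4"] by simp
    ultimately show ?thesis by simp
  qed
  have "sin (\<psi> / 2) \<le> \<psi> / 2" using assms(3) by (intro sin_x_le_x) auto
  also have "\<dots> \<le> \<theta> + \<phi>" using assms by auto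
  also have "\<dots> \<le> 8 * (sin (\<theta> / 2) + sin (\<phi> / 2))" using low[OF assms(1)] low[OF assms(2)] by simp
  finally show ?thesis .
qed

lemma cos_half_reflect: "cos ((pi - t) / 2) = sin (t / 2)" "sin ((pi - t) / 2) = cos (t / 2)"
  by (simp_all add: diff_divide_distrib cos_diff sin_diff)

text \<open>An upper bound of the measure is what its place in the denominator asks for: supremum of
  the density times length. The density on the ball is at most a constant times the reciprocal of
  \<open>hweight\<close>, because the exponents 2 \<alpha> + 1 and 2 \<beta> + 1 are positive; the
  length is at most 2 |\<theta> - \<phi>|.\<close>

lemma jacobi_measure_ball:
  assumes \<alpha>: "\<alpha> > -1/2" and \<beta>: "\<beta> > -1/2" and q: "(\<theta>, \<phi>) \<in> off_diagonal"
  defines "m \<equiv> measure (jacobi_measure \<alpha> \<beta>) (ball \<theta> \<bar>\<theta> - \<phi>\<bar> \<inter> {0<..<pi})"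
  shows "m > 0" "hweight \<alpha> \<beta> (\<theta>, \<phi>) / \<bar>\<theta> - \<phi>\<bar> \<le> 2 * (8 powr (2 * \<alpha> + 1) * 8 powr (2 * \<beta> + 1)) / m"
proof -
  have th: "\<theta> \<in> {0<..<pi}" "\<phi> \<in> {0<..<pi}" "\<theta> \<noteq> \<phi>" using q unfolding off_diagonal_def by auto
  define d where "d = \<bar>\<theta> - \<phi>\<bar>"
  have d: "d > 0" using th unfolding d_def by simp
  define l u where "l = max 0 (\<theta> - d)" and "u = min pi (\<theta> + d)"
  have B: "ball \<theta> \<bar>\<theta> - \<phi>\<bar> \<inter> {0<..<pi} = {l<..<u}"
    unfolding l_def u_def d_def by (auto simp: dist_real_def)
  have lu: "0 \<le> l" "l < u" "u \<le> pi" "u - l \<le> 2 * d" using th d unfolding l_def u_def by auto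
  define v w where "v = sin (\<theta> / 2) + sin (\<phi> / 2)" and "w = cos (\<theta> / 2) + cos (\<phi> / 2)"
  have vw: "v > 0" "w > 0"
    unfolding v_def w_def using circle_pair_trig[OF th(1,2)] unfolding circle_pair_def by auto
  define N where "N = (8 * v) powr (2 * \<alpha> + 1) * (8 * w) powr (2 * \<beta> + 1)"
  have bnd: "sin (\<psi> / 2) powr (2 * \<alpha> + 1) * cos (\<psi> / 2) powr (2 * \<beta> + 1) \<le> N" if "\<psi> \<in> {l<..<u}" for \<psi>
  proof -
    have \<psi>: "\<psi> \<in> {0<..<pi}" "\<bar>\<psi> - \<theta>\<bar> < \<bar>\<theta> - \<phi>\<bar>"
      using that unfolding B[symmetric] by (auto simp: dist_real_def)
    have "sin (\<psi> / 2) \<le> 8 * v" unfolding v_def by (rule sin_half_ball_le[OF th(1,2) \<psi>])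
    \<comment> \<open>The cosine bound is the sine bound after reflection of all three angles at
      \<pi> / 2.\<close>
    moreover have "cos (\<psi> / 2) \<le> 8 * w"
      using sin_half_ball_le[of "pi - \<theta>" "pi - \<phi>" "pi - \<psi>"] th \<psi> unfolding w_def cos_half_reflect by auto
    moreover have "0 \<le> sin (\<psi> / 2)" "0 \<le> cos (\<psi> / 2)"
      using circle_pair_trig[OF \<psi>(1) \<psi>(1)] unfolding circle_pair_def by auto
    ultimately show ?thesis unfolding N_def using \<alpha> \<beta> by (intro mult_mono powr_mono2) auto
  qed
  note M = jacobi_measure_interval[OF lu(1-3) bnd]
  show m: "m > 0" unfolding m_def B by (rule M(1))
  have N0: "N > 0" unfolding N_def using vw by simp
  have "m \<le> N * (u - l)" unfolding m_def B by (rule M(2))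
  also have "\<dots> \<le> N * (2 * d)" using lu N0 by (intro mult_left_mono) auto
  finally have "hweight \<alpha> \<beta> (\<theta>, \<phi>) * m \<le> hweight \<alpha> \<beta> (\<theta>, \<phi>) * (N * (2 * d))"
    using hweight_pos[OF q, of \<alpha> \<beta>] by (intro mult_left_mono) auto
  also have "\<dots> = 2 * (hweight \<alpha> \<beta> (\<theta>, \<phi>) * N) * d" by (simp only: mult_ac)
  also have "hweight \<alpha> \<beta> (\<theta>, \<phi>) * N = 8 powr (2 * \<alpha> + 1) * 8 powr (2 * \<beta> + 1)"
  proof -
    have 1: "z powr (- 2 * p - 1) * z powr (2 * p + 1) = 1" if "z > 0" for z p :: real
      using that by (simp flip: powr_add)
    have "hweight \<alpha> \<beta> (\<theta>, \<phi>) * N = (v powr (- 2 * \<alpha> - 1) * v powr (2 * \<alpha> + 1)) * (w powr (- 2 * \<beta> - 1) * w powr (2 * \<beta> + 1))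
        * (8 powr (2 * \<alpha> + 1) * 8 powr (2 * \<beta> + 1))"
      unfolding hweight_def sweight_def N_def v_def w_def fst_conv snd_conv powr_mult by (simp only: mult_ac)
    then show ?thesis unfolding 1[OF vw(1)] 1[OF vw(2)] by simp
  qed
  finally show "hweight \<alpha> \<beta> (\<theta>, \<phi>) / \<bar>\<theta> - \<phi>\<bar> \<le> 2 * (8 powr (2 * \<alpha> + 1) * 8 powr (2 * \<beta> + 1)) / m"
    unfolding d_def[symmetric] using m d by (simp add: pos_divide_le_eq pos_le_divide_eq)
qed

section \<open>Kernels in terms of Bessel integrals\<close>

definition bes_integral :: "real \<Rightarrow> real \<Rightarrow> real \<Rightarrow> real \<Rightarrow> real" where
  "bes_integral A B X Y =
     (LINT s:{0<..}|lborel. 2 * exp (- 2 * s) * s powr (A + B) * (bes A ((s * X)\<^sup>2) * bes B ((s * Y)\<^sup>2)))"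

lemma bes_integral_commute: "bes_integral B A Y X = bes_integral A B X Y"
  unfolding bes_integral_def by (simp add: mult.commute add.commute)

text \<open>Since D + X + Y = 1, the three exponentials recombine to exp (- 2 s); the powers of s X
  and s Y release X powr \<mu> and Y powr \<kappa>.\<close>

lemma wint_eq_bes_integral:
  assumes q: "(\<theta>, \<phi>) \<in> off_diagonal"
  defines "X \<equiv> sin (\<theta> / 2) * sin (\<phi> / 2)" and "Y \<equiv> cos (\<theta> / 2) * cos (\<phi> / 2)"
  shows "wint \<alpha> \<beta> \<mu> \<kappa> (\<theta>, \<phi>) =
    X powr \<mu> * Y powr \<kappa> / sin (\<theta> / 2) * bes_integral (\<alpha> + \<mu>) (\<beta> + \<kappa>) X Y"
proof -
  define c where "c = X powr \<mu> * Y powr \<kappa> / sin (\<theta> / 2)"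
  define k where "k s = 2 * exp (- 2 * s) * s powr (\<alpha> + \<mu> + (\<beta> + \<kappa>)) *
      (bes (\<alpha> + \<mu>) ((s * X)\<^sup>2) * bes (\<beta> + \<kappa>) ((s * Y)\<^sup>2))" for s
  have wf: "wfun \<alpha> \<beta> \<mu> \<kappa> (\<theta>, \<phi>) s = c * (indicator {0<..} s *\<^sub>R k s)" for s
  proof (cases "s > 0")
    case True
    have e: "exp (- 2 * s * chord (sin (\<theta> / 2)) (cos (\<theta> / 2)) (sin (\<phi> / 2)) (cos (\<phi> / 2))) * exp (- 2 * (s * X)) * exp (- 2 * (s * Y)) = exp (- 2 * s)"
      unfolding chord_def X_def Y_def by (simp add: mult_exp_exp algebra_simps)
    have p: "s powr (\<alpha> + \<mu> + (\<beta> + \<kappa>)) = s powr (\<alpha> + \<beta>) * s powr \<mu> * s powr \<kappa>"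
      by (simp add: powr_add)
    have "wfun \<alpha> \<beta> \<mu> \<kappa> (\<theta>, \<phi>) s = 2 * (s powr (\<alpha> + \<beta>) * s powr \<mu> * s powr \<kappa>) *
      (exp (- 2 * s * chord (sin (\<theta> / 2)) (cos (\<theta> / 2)) (sin (\<phi> / 2)) (cos (\<phi> / 2))) * exp (- 2 * (s * X)) * exp (- 2 * (s * Y)))
       * (bes (\<alpha> + \<mu>) ((s * X)\<^sup>2) * bes (\<beta> + \<kappa>) ((s * Y)\<^sup>2)) * c"
      unfolding wfun_def wker_def ebes_def c_def fst_conv snd_conv X_def[symmetric] Y_def[symmetric] powr_mult
      using True by simp
    also have "\<dots> = c * (indicator {0<..} s *\<^sub>R k s)"
      unfolding e p[symmetric] k_def using True by simp
    finally show ?thesis .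
  qed (simp add: wfun_def)
  have "wint \<alpha> \<beta> \<mu> \<kappa> (\<theta>, \<phi>) = (\<integral>s. c * (indicator {0<..} s *\<^sub>R k s) \<partial>lborel)"
    unfolding wint_def wf ..
  also have "\<dots> = c * bes_integral (\<alpha> + \<mu>) (\<beta> + \<kappa>) X Y"
    unfolding bes_integral_def set_lebesgue_integral_def k_def by (rule integral_mult_right_zero)
  finally show ?thesis unfolding c_def .
qed

definition wkern :: "rank_one_space \<Rightarrow> real \<Rightarrow> real \<Rightarrow> real \<Rightarrow> real \<Rightarrow> nat \<Rightarrow> real \<times> real \<Rightarrow> real" where
  "wkern M \<alpha> \<beta> a b j q = u_fun a b j (fst q) * u_fun a b j (snd q) *
     kernel_T M (\<alpha> + a * real j) (\<beta> + b * real j) (fst q) (snd q)"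

text \<open>Off the diagonal X + Y = 1 - D is less than 1, as \<open>integral_jacobi_poisson\<close>
  requires. The factor \<open>sqrt (rho M \<theta>)\<close> is left untouched so that projective
  spaces and sphere share the formula.\<close>

lemma wkern_eq_bes_integral:
  assumes q: "(\<theta>, \<phi>) \<in> off_diagonal" and ab: "\<alpha> + a * real j > -1/2" "\<beta> + b * real j > -1/2"
  defines "X \<equiv> sin (\<theta> / 2) * sin (\<phi> / 2)" and "Y \<equiv> cos (\<theta> / 2) * cos (\<phi> / 2)"
  shows "wkern M \<alpha> \<beta> a b j (\<theta>, \<phi>) = sqrt (rho M \<theta>) *
    (X powr (a * real j) * Y powr (b * real j) * bes_integral (\<alpha> + a * real j) (\<beta> + b * real j) X Y)"
proof -
  have th: "\<theta> \<in> {0<..<pi}" "\<phi> \<in> {0<..<pi}" "\<theta> \<noteq> \<phi>" using q unfolding off_diagonal_def by auto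
  have pos: "X > 0" "Y > 0"
    unfolding X_def Y_def using circle_pair_trig[OF th(1,2)] unfolding circle_pair_def by auto
  have "0 < (\<bar>fst (\<theta>, \<phi>) - snd (\<theta>, \<phi>)\<bar> / 8)\<^sup>2" using th by simp
  then have "hchord (\<theta>, \<phi>) > 0" using hchord_ge[OF q] by linarith
  then have "X + Y < 1" unfolding hchord_def chord_def X_def Y_def by simp
  then have "(LINT t:{0<..}|lborel. jacobi_poisson (\<alpha> + a * real j) (\<beta> + b * real j) t \<theta> \<phi>) =
      bes_integral (\<alpha> + a * real j) (\<beta> + b * real j) X Y"
    unfolding bes_integral_def X_def Y_def using pos unfolding X_def Y_def
    by (intro integral_jacobi_poisson ab)
  moreover have "u_fun a b j \<theta> * u_fun a b j \<phi> = X powr (a * real j) * Y powr (b * real j)"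
    unfolding u_fun_def X_def Y_def powr_mult by (simp only: mult_ac)
  ultimately show ?thesis unfolding wkern_def kernel_T_def fst_conv snd_conv by (simp only: mult_ac)
qed

lemma wkern_projective:
  assumes M: "\<nexists>d. M = Sphere d"
    and q: "(\<theta>, \<phi>) \<in> off_diagonal" and ab: "\<alpha> + a * real j > -1/2" "\<beta> + b * real j > -1/2"
  shows "wkern M \<alpha> \<beta> a b j (\<theta>, \<phi>) = wint \<alpha> \<beta> (a * real j) (b * real j) (\<theta>, \<phi>)"
proof -
  have "sin (\<theta> / 2) > 0" using q unfolding off_diagonal_def by (auto intro!: sin_gt_zero)
  then have "sqrt (rho M \<theta>) = 1 / sin (\<theta> / 2)" using M by (cases M) (auto simp: real_sqrt_divide)
  then show ?thesis unfolding wkern_eq_bes_integral[OF q ab] wint_eq_bes_integral[OF q] by simp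
qed

lemma off_diagonal_reflect: "(\<theta>, \<phi>) \<in> off_diagonal \<Longrightarrow> (pi - \<theta>, pi - \<phi>) \<in> off_diagonal"
  unfolding off_diagonal_def by auto

text \<open>
  On the sphere the factor \<open>1 / sin \<theta> = (y / x + x / y) / 2\<close> with \<open>x = sin (\<theta> / 2)\<close> and
  \<open>y = cos (\<theta> / 2)\<close> splits the kernel into the projective one and its reflection.
\<close>

lemma wkern_sphere:
  assumes q: "(\<theta>, \<phi>) \<in> off_diagonal" and ab: "\<alpha> + a * real j > -1/2" "\<beta> + b * real j > -1/2"
  shows "wkern (Sphere d) \<alpha> \<beta> a b j (\<theta>, \<phi>) =
    cos (\<theta> / 2) / 2 * wint \<alpha> \<beta> (a * real j) (b * real j) (\<theta>, \<phi>) +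
    sin (\<theta> / 2) / 2 * wint \<beta> \<alpha> (b * real j) (a * real j) (pi - \<theta>, pi - \<phi>)"
proof -
  have th: "\<theta> \<in> {0<..<pi}" using q unfolding off_diagonal_def by auto
  define x y where "x = sin (\<theta> / 2)" and "y = cos (\<theta> / 2)"
  have pos: "x > 0" "y > 0" and sq: "x\<^sup>2 + y\<^sup>2 = 1"
    using circle_pair_trig[OF th th] unfolding circle_pair_def x_def y_def by auto
  have "sin \<theta> = 2 * x * y" using sin_double[of "\<theta> / 2"] unfolding x_def y_def by simp
  then have "sqrt (rho (Sphere d) \<theta>) = 1 / (2 * x * y)" using pos by (simp add: real_sqrt_divide)
  also have "\<dots> = (x\<^sup>2 + y\<^sup>2) / (2 * x * y)" using sq by simp
  also have "\<dots> = y / 2 / x + x / 2 / y" using pos by (simp add: field_simps power2_eq_square)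
  finally have s: "sqrt (rho (Sphere d) \<theta>) = y / 2 / x + x / 2 / y" .
  have split: "(y / 2 / x + x / 2 / y) * (P * Q * I) = y / 2 * (P * Q / x * I) + x / 2 * (Q * P / y * I)" for P Q I
    using pos by (simp add: field_simps)
  show ?thesis
    unfolding wkern_eq_bes_integral[OF q ab] wint_eq_bes_integral[OF q] wint_eq_bes_integral[OF off_diagonal_reflect[OF q]] s cos_half_reflect
    unfolding x_def[symmetric] y_def[symmetric]
    by (subst (3) bes_integral_commute) (rule split)
qed

lemma GDERIV_reflect:
  assumes "GDERIV f (c - q) :> g"
  shows "GDERIV (\<lambda>q. f (c - q)) q :> - g"
proof -
  have "(f has_derivative (\<lambda>h. inner h g)) (at (c - q))" using assms unfolding gderiv_def .
  moreover have "((\<lambda>q. c - q) has_derivative (\<lambda>h. - h)) (at q)" by (auto intro!: derivative_eq_intros)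
  ultimately have "((\<lambda>q. f (c - q)) has_derivative (\<lambda>h. inner (- h) g)) (at q)"
    by (rule has_derivative_compose[rotated])
  then show ?thesis unfolding gderiv_def by simp
qed

definition ball_measure :: "real \<Rightarrow> real \<Rightarrow> real \<Rightarrow> real \<Rightarrow> real" where
  "ball_measure \<alpha> \<beta> \<theta> \<phi> = measure (jacobi_measure \<alpha> \<beta>) (ball \<theta> \<bar>\<theta> - \<phi>\<bar> \<inter> {0<..<pi})"

text \<open>Reflection exchanges (\<alpha>, \<mu>) with (\<beta>, \<kappa>) and leaves
  \<open>hweight\<close> invariant. Hence the reflected integral obeys the same bounds with the
  unreflected ball, now with the gain in \<kappa>.\<close>

lemma wint_measure_bounds:
  assumes \<alpha>: "\<alpha> > -1/2" and \<beta>: "\<beta> > -1/2"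
  shows "\<exists>C>0. \<forall>\<mu> \<kappa> \<theta> \<phi>. \<mu> \<ge> 1 \<longrightarrow> \<kappa> = 0 \<or> \<kappa> \<ge> 1 \<longrightarrow> (\<theta>, \<phi>) \<in> off_diagonal \<longrightarrow>
     \<mu> * \<bar>wint \<alpha> \<beta> \<mu> \<kappa> (\<theta>, \<phi>)\<bar> \<le> C / ball_measure \<alpha> \<beta> \<theta> \<phi> \<and>
     (\<mu> = 1 \<or> \<mu> \<ge> 2 \<longrightarrow> (\<exists>g. (GDERIV (wint \<alpha> \<beta> \<mu> \<kappa>) (\<theta>, \<phi>) :> g) \<and>
        \<mu> * norm g \<le> C / (\<bar>\<theta> - \<phi>\<bar> * ball_measure \<alpha> \<beta> \<theta> \<phi>)))" (is ?direct)
    and "\<exists>C>0. \<forall>\<mu> \<kappa> \<theta> \<phi>. \<kappa> \<ge> 1 \<longrightarrow> \<mu> = 0 \<or> \<mu> \<ge> 1 \<longrightarrow> (\<theta>, \<phi>) \<in> off_diagonal \<longrightarrow>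
     \<kappa> * \<bar>wint \<beta> \<alpha> \<kappa> \<mu> (pi - \<theta>, pi - \<phi>)\<bar> \<le> C / ball_measure \<alpha> \<beta> \<theta> \<phi> \<and>
     (\<kappa> = 1 \<or> \<kappa> \<ge> 2 \<longrightarrow> (\<exists>g. (GDERIV (\<lambda>q. wint \<beta> \<alpha> \<kappa> \<mu> ((pi, pi) - q)) (\<theta>, \<phi>) :> g) \<and>
        \<kappa> * norm g \<le> C / (\<bar>\<theta> - \<phi>\<bar> * ball_measure \<alpha> \<beta> \<theta> \<phi>)))" (is ?reflected)
proof -
  define K where "K = 2 * (8 powr (2 * \<alpha> + 1) * 8 powr (2 * \<beta> + 1))"
  have K: "K > 0" unfolding K_def by simp
  have W1: "C * hweight \<alpha> \<beta> (\<theta>, \<phi>) / \<bar>\<theta> - \<phi>\<bar> \<le> C * K / ball_measure \<alpha> \<beta> \<theta> \<phi>"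
    if "C > 0" "(\<theta>, \<phi>) \<in> off_diagonal" for C \<theta> \<phi>
    using mult_left_mono[OF jacobi_measure_ball(2)[OF \<alpha> \<beta> that(2)], of C] that(1)
    unfolding K_def ball_measure_def by simp
  have W2: "C * hweight \<alpha> \<beta> (\<theta>, \<phi>) / (\<theta> - \<phi>)\<^sup>2 \<le> C * K / (\<bar>\<theta> - \<phi>\<bar> * ball_measure \<alpha> \<beta> \<theta> \<phi>)"
    if "C > 0" "(\<theta>, \<phi>) \<in> off_diagonal" for C \<theta> \<phi>
  proof -
    have "C * hweight \<alpha> \<beta> (\<theta>, \<phi>) / \<bar>\<theta> - \<phi>\<bar> / \<bar>\<theta> - \<phi>\<bar> \<le> C * K / ball_measure \<alpha> \<beta> \<theta> \<phi> / \<bar>\<theta> - \<phi>\<bar>"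
      by (rule divide_right_mono[OF W1[OF that]]) simp
    then show ?thesis by (simp add: power2_eq_square mult.commute flip: abs_mult)
  qed
  obtain C where C: "C > 0" "\<And>\<mu> \<kappa> q. \<mu> \<ge> 1 \<Longrightarrow> \<kappa> = 0 \<or> \<kappa> \<ge> 1 \<Longrightarrow> q \<in> off_diagonal \<Longrightarrow>
     \<mu> * \<bar>wint \<alpha> \<beta> \<mu> \<kappa> q\<bar> \<le> C * hweight \<alpha> \<beta> q / \<bar>fst q - snd q\<bar> \<and>
     (\<mu> = 1 \<or> \<mu> \<ge> 2 \<longrightarrow> (\<exists>g. (GDERIV (wint \<alpha> \<beta> \<mu> \<kappa>) q :> g) \<and>
        \<mu> * norm g \<le> C * hweight \<alpha> \<beta> q / (fst q - snd q)\<^sup>2))"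
    using wint_bounds[OF \<alpha> \<beta>] by metis
  show ?direct
  proof (rule exI[of _ "C * K"], intro conjI allI impI)
    show "C * K > 0" using C K by simp
    fix \<mu> \<kappa> \<theta> \<phi> :: real assume h: "\<mu> \<ge> 1" "\<kappa> = 0 \<or> \<kappa> \<ge> 1" "(\<theta>, \<phi>) \<in> off_diagonal"
    note B = C(2)[OF h, unfolded fst_conv snd_conv]
    show "\<mu> * \<bar>wint \<alpha> \<beta> \<mu> \<kappa> (\<theta>, \<phi>)\<bar> \<le> C * K / ball_measure \<alpha> \<beta> \<theta> \<phi>"
      using B W1[OF C(1) h(3)] by linarith
    assume "\<mu> = 1 \<or> \<mu> \<ge> 2"
    then obtain g where "GDERIV (wint \<alpha> \<beta> \<mu> \<kappa>) (\<theta>, \<phi>) :> g" "\<mu> * norm g \<le> C * hweight \<alpha> \<beta> (\<theta>, \<phi>) / (\<theta> - \<phi>)\<^sup>2"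
      using B by blast
    then show "\<exists>g. (GDERIV (wint \<alpha> \<beta> \<mu> \<kappa>) (\<theta>, \<phi>) :> g) \<and> \<mu> * norm g \<le> C * K / (\<bar>\<theta> - \<phi>\<bar> * ball_measure \<alpha> \<beta> \<theta> \<phi>)"
      using W2[OF C(1) h(3)] by (intro exI[of _ g]) auto
  qed
  obtain C' where C': "C' > 0" "\<And>\<mu> \<kappa> q. \<mu> \<ge> 1 \<Longrightarrow> \<kappa> = 0 \<or> \<kappa> \<ge> 1 \<Longrightarrow> q \<in> off_diagonal \<Longrightarrow>
     \<mu> * \<bar>wint \<beta> \<alpha> \<mu> \<kappa> q\<bar> \<le> C' * hweight \<beta> \<alpha> q / \<bar>fst q - snd q\<bar> \<and>
     (\<mu> = 1 \<or> \<mu> \<ge> 2 \<longrightarrow> (\<exists>g. (GDERIV (wint \<beta> \<alpha> \<mu> \<kappa>) q :> g) \<and>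
        \<mu> * norm g \<le> C' * hweight \<beta> \<alpha> q / (fst q - snd q)\<^sup>2))"
    using wint_bounds[OF \<beta> \<alpha>] by metis
  have hr: "hweight \<beta> \<alpha> (pi - \<theta>, pi - \<phi>) = hweight \<alpha> \<beta> (\<theta>, \<phi>)" for \<theta> \<phi>
    unfolding hweight_def sweight_def fst_conv snd_conv cos_half_reflect by (rule mult.commute)
  have d1: "pi - \<theta> - (pi - \<phi>) = - (\<theta> - \<phi>)" for \<theta> \<phi> :: real by simp
  show ?reflected
  proof (rule exI[of _ "C' * K"], intro conjI allI impI)
    show "C' * K > 0" using C' K by simp
    fix \<mu> \<kappa> \<theta> \<phi> :: real assume h: "\<kappa> \<ge> 1" "\<mu> = 0 \<or> \<mu> \<ge> 1" "(\<theta>, \<phi>) \<in> off_diagonal"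
    note B = C'(2)[OF h(1,2) off_diagonal_reflect[OF h(3)], unfolded fst_conv snd_conv hr d1 abs_minus_cancel power2_minus]
    show "\<kappa> * \<bar>wint \<beta> \<alpha> \<kappa> \<mu> (pi - \<theta>, pi - \<phi>)\<bar> \<le> C' * K / ball_measure \<alpha> \<beta> \<theta> \<phi>"
      using B W1[OF C'(1) h(3)] by linarith
    assume "\<kappa> = 1 \<or> \<kappa> \<ge> 2"
    then obtain g where g: "GDERIV (wint \<beta> \<alpha> \<kappa> \<mu>) ((pi, pi) - (\<theta>, \<phi>)) :> g" "\<kappa> * norm g \<le> C' * hweight \<alpha> \<beta> (\<theta>, \<phi>) / (\<theta> - \<phi>)\<^sup>2"
      using B by auto
    show "\<exists>g. (GDERIV (\<lambda>q. wint \<beta> \<alpha> \<kappa> \<mu> ((pi, pi) - q)) (\<theta>, \<phi>) :> g) \<and> \<kappa> * norm g \<le> C' * K / (\<bar>\<theta> - \<phi>\<bar> * ball_measure \<alpha> \<beta> \<theta> \<phi>)"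
      using GDERIV_reflect[OF g(1)] g(2) W2[OF C'(1) h(3)] by (intro exI[of _ "- g"]) auto
  qed
qed

lemma GDERIV_transform:
  assumes "GDERIV f q :> g" "open S" "q \<in> S" "\<And>p. p \<in> S \<Longrightarrow> f p = h p"
  shows "GDERIV h q :> g"
  using assms unfolding gderiv_def by (rule has_derivative_transform_within_open)

text \<open>The alternative "1 or at least 2" is inherited by a j: for a = 1 it holds because j is
  an integer. The gain in \<mu> = a j yields the factor j of the theorem through j \<le> a
  j.\<close>

lemma exponent_cases:
  fixes a :: real and j :: nat
  assumes "j \<ge> 1"
  shows "a = 1 \<or> a \<ge> 2 \<Longrightarrow> a * real j = 1 \<or> a * real j \<ge> 2"
    "a \<ge> 1 \<Longrightarrow> a * real j \<ge> 1" "a \<ge> 1 \<Longrightarrow> real j \<le> a * real j" "a = 0 \<or> a \<ge> 1 \<Longrightarrow> a * real j = 0 \<or> a * real j \<ge> 1"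
proof -
  have j: "real j \<ge> 1" using assms by simp
  have up: "c \<le> a * real j" if "a \<ge> c" "c \<ge> 0" for c using mult_mono[OF that(1) j] that by simp
  show "a * real j = 1 \<or> a * real j \<ge> 2" if "a = 1 \<or> a \<ge> 2"
  proof (cases "a = 1")
    case True
    then show ?thesis using assms by (cases "j = 1") auto
  qed (use that up[of 2] in auto)
  show "a * real j \<ge> 1" if "a \<ge> 1" using up[of 1] that by simp
  show "real j \<le> a * real j" if "a \<ge> 1" using mult_right_mono[OF that, of "real j"] by simp
  show "a * real j = 0 \<or> a * real j \<ge> 1" if "a = 0 \<or> a \<ge> 1" using up[of 1] that by auto
qed

lemma wkern_projective_bounds:
  assumes M: "\<nexists>d. M = Sphere d" and \<alpha>: "\<alpha> > -1/2" and \<beta>: "\<beta> > -1/2"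
    and a: "a = 1 \<or> a \<ge> 2" and b: "b = 0 \<or> b \<ge> 1"
  shows "\<exists>C. \<forall>j\<ge>1. \<forall>\<theta> \<phi>. (\<theta>, \<phi>) \<in> off_diagonal \<longrightarrow>
    real j * \<bar>wkern M \<alpha> \<beta> a b j (\<theta>, \<phi>)\<bar> \<le> C / ball_measure \<alpha> \<beta> \<theta> \<phi> \<and>
    (\<exists>g. (GDERIV (wkern M \<alpha> \<beta> a b j) (\<theta>, \<phi>) :> g) \<and> real j * norm g \<le> C / (\<bar>\<theta> - \<phi>\<bar> * ball_measure \<alpha> \<beta> \<theta> \<phi>))"
proof -
  obtain C where C: "\<And>\<mu> \<kappa> \<theta> \<phi>. \<mu> \<ge> 1 \<Longrightarrow> \<kappa> = 0 \<or> \<kappa> \<ge> 1 \<Longrightarrow> (\<theta>, \<phi>) \<in> off_diagonal \<Longrightarrow>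
     \<mu> * \<bar>wint \<alpha> \<beta> \<mu> \<kappa> (\<theta>, \<phi>)\<bar> \<le> C / ball_measure \<alpha> \<beta> \<theta> \<phi> \<and>
     (\<mu> = 1 \<or> \<mu> \<ge> 2 \<longrightarrow> (\<exists>g. (GDERIV (wint \<alpha> \<beta> \<mu> \<kappa>) (\<theta>, \<phi>) :> g) \<and>
        \<mu> * norm g \<le> C / (\<bar>\<theta> - \<phi>\<bar> * ball_measure \<alpha> \<beta> \<theta> \<phi>)))"
    using wint_measure_bounds(1)[OF \<alpha> \<beta>] by metis
  show ?thesis
  proof (rule exI[of _ C], intro conjI allI impI)
    fix j :: nat and \<theta> \<phi> :: real assume j: "1 \<le> j" and q: "(\<theta>, \<phi>) \<in> off_diagonal"
    have a1: "a \<ge> 1" using a by auto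
    note \<mu> = exponent_cases(1)[OF j a] exponent_cases(2,3)[OF j a1] exponent_cases(4)[OF j b]
    have ab: "\<alpha> + a * real j > -1/2" "\<beta> + b * real j > -1/2" using \<alpha> \<beta> \<mu> by auto
    note B = C[OF \<mu>(2,4) q]
    have "real j * \<bar>wkern M \<alpha> \<beta> a b j (\<theta>, \<phi>)\<bar> \<le> a * real j * \<bar>wint \<alpha> \<beta> (a * real j) (b * real j) (\<theta>, \<phi>)\<bar>"
      unfolding wkern_projective[OF M q ab] using \<mu>(3) by (rule mult_right_mono) simp
    then show "real j * \<bar>wkern M \<alpha> \<beta> a b j (\<theta>, \<phi>)\<bar> \<le> C / ball_measure \<alpha> \<beta> \<theta> \<phi>"
      using B by linarith
    obtain g where g: "GDERIV (wint \<alpha> \<beta> (a * real j) (b * real j)) (\<theta>, \<phi>) :> g"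
      "a * real j * norm g \<le> C / (\<bar>\<theta> - \<phi>\<bar> * ball_measure \<alpha> \<beta> \<theta> \<phi>)" using B \<mu>(1) by blast
    have "GDERIV (wkern M \<alpha> \<beta> a b j) (\<theta>, \<phi>) :> g"
      using GDERIV_transform[OF g(1) open_off_diagonal q, of "wkern M \<alpha> \<beta> a b j"] wkern_projective[OF M _ ab] by force
    moreover have "real j * norm g \<le> a * real j * norm g" using \<mu>(3) by (rule mult_right_mono) simp
    ultimately show "\<exists>g. (GDERIV (wkern M \<alpha> \<beta> a b j) (\<theta>, \<phi>) :> g) \<and> real j * norm g \<le> C / (\<bar>\<theta> - \<phi>\<bar> * ball_measure \<alpha> \<beta> \<theta> \<phi>)"
      using g(2) by (intro exI[of _ g]) auto
  qed
qed

text \<open>Each half of the split kernel carries one singular factor, 1/x or 1/y, and takes its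
  gain from the matching exponent, a j or b j; hence b meets conditions like those on a. The smooth
  factors y / 2 and x / 2 are bounded, and their derivatives only bring in the size bounds.\<close>

lemma wkern_sphere_bounds:
  assumes \<alpha>: "\<alpha> > -1/2" and \<beta>: "\<beta> > -1/2" and a: "a = 1 \<or> a \<ge> 2" and b: "b \<ge> 1"
  shows "\<exists>C. \<forall>j\<ge>1. \<forall>\<theta> \<phi>. (\<theta>, \<phi>) \<in> off_diagonal \<longrightarrow>
    real j * \<bar>wkern (Sphere d) \<alpha> \<beta> a b j (\<theta>, \<phi>)\<bar> \<le> C / ball_measure \<alpha> \<beta> \<theta> \<phi> \<and>
    (b = 1 \<or> b \<ge> 2 \<longrightarrow> (\<exists>g. (GDERIV (wkern (Sphere d) \<alpha> \<beta> a b j) (\<theta>, \<phi>) :> g) \<and>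
       real j * norm g \<le> C / (\<bar>\<theta> - \<phi>\<bar> * ball_measure \<alpha> \<beta> \<theta> \<phi>)))"
proof -
  obtain C where C0: "C > 0" and C: "\<And>\<mu> \<kappa> \<theta> \<phi>. \<mu> \<ge> 1 \<Longrightarrow> \<kappa> = 0 \<or> \<kappa> \<ge> 1 \<Longrightarrow> (\<theta>, \<phi>) \<in> off_diagonal \<Longrightarrow>
     \<mu> * \<bar>wint \<alpha> \<beta> \<mu> \<kappa> (\<theta>, \<phi>)\<bar> \<le> C / ball_measure \<alpha> \<beta> \<theta> \<phi> \<and>
     (\<mu> = 1 \<or> \<mu> \<ge> 2 \<longrightarrow> (\<exists>g. (GDERIV (wint \<alpha> \<beta> \<mu> \<kappa>) (\<theta>, \<phi>) :> g) \<and>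
        \<mu> * norm g \<le> C / (\<bar>\<theta> - \<phi>\<bar> * ball_measure \<alpha> \<beta> \<theta> \<phi>)))"
    using wint_measure_bounds(1)[OF \<alpha> \<beta>] by metis
  obtain C' where C'0: "C' > 0" and C': "\<And>\<mu> \<kappa> \<theta> \<phi>. \<kappa> \<ge> 1 \<Longrightarrow> \<mu> = 0 \<or> \<mu> \<ge> 1 \<Longrightarrow> (\<theta>, \<phi>) \<in> off_diagonal \<Longrightarrow>
     \<kappa> * \<bar>wint \<beta> \<alpha> \<kappa> \<mu> (pi - \<theta>, pi - \<phi>)\<bar> \<le> C' / ball_measure \<alpha> \<beta> \<theta> \<phi> \<and>
     (\<kappa> = 1 \<or> \<kappa> \<ge> 2 \<longrightarrow> (\<exists>g. (GDERIV (\<lambda>q. wint \<beta> \<alpha> \<kappa> \<mu> ((pi, pi) - q)) (\<theta>, \<phi>) :> g) \<and>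
        \<kappa> * norm g \<le> C' / (\<bar>\<theta> - \<phi>\<bar> * ball_measure \<alpha> \<beta> \<theta> \<phi>)))"
    using wint_measure_bounds(2)[OF \<alpha> \<beta>] by metis
  show ?thesis
  proof (rule exI[of _ "2 * (C + C')"], intro conjI allI impI)
    fix j :: nat and \<theta> \<phi> :: real assume j: "1 \<le> j" and q: "(\<theta>, \<phi>) \<in> off_diagonal"
    have a1: "a \<ge> 1" using a by auto
    define \<mu> \<kappa> where "\<mu> = a * real j" and "\<kappa> = b * real j"
    have \<mu>: "\<mu> = 1 \<or> \<mu> \<ge> 2" "\<mu> \<ge> 1" "real j \<le> \<mu>" and \<kappa>: "\<kappa> \<ge> 1" "real j \<le> \<kappa>"
      unfolding \<mu>_def \<kappa>_def using exponent_cases[OF j] a a1 b by auto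
    have ab: "\<alpha> + a * real j > -1/2" "\<beta> + b * real j > -1/2"
      using \<alpha> \<beta> \<mu> \<kappa> unfolding \<mu>_def \<kappa>_def by auto
    have "\<kappa> = 0 \<or> \<kappa> \<ge> 1" "\<mu> = 0 \<or> \<mu> \<ge> 1" using \<mu> \<kappa> by auto
    note B1 = C[OF \<mu>(2) this(1) q] and B2 = C'[OF \<kappa>(1) this(2) q]
    define m where "m = ball_measure \<alpha> \<beta> \<theta> \<phi>"
    have m: "m > 0" unfolding m_def ball_measure_def by (rule jacobi_measure_ball(1)[OF \<alpha> \<beta> q])
    have th: "\<theta> \<in> {0<..<pi}" "\<phi> \<in> {0<..<pi}" "\<theta> \<noteq> \<phi>" using q unfolding off_diagonal_def by auto
    define x y where "x = sin (\<theta> / 2)" and "y = cos (\<theta> / 2)"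
    have xy: "0 \<le> x" "x \<le> 1" "0 \<le> y" "y \<le> 1"
      using circle_pair_trig[OF th(1) th(1)] unfolding circle_pair_def x_def y_def by auto
    define w w' where "w = wint \<alpha> \<beta> \<mu> \<kappa> (\<theta>, \<phi>)" and "w' = wint \<beta> \<alpha> \<kappa> \<mu> (pi - \<theta>, pi - \<phi>)"
    have w: "real j * \<bar>w\<bar> \<le> C / m" "real j * \<bar>w'\<bar> \<le> C' / m"
      using B1 B2 mult_right_mono[OF \<mu>(3), of "\<bar>w\<bar>"] mult_right_mono[OF \<kappa>(2), of "\<bar>w'\<bar>"]
      unfolding w_def w'_def m_def by auto
    have half: "real j * (c * t / 2) \<le> real j * t / 2" if "0 \<le> c" "c \<le> 1" "0 \<le> t" for c t :: real
      using that mult_left_le_one_le[of t c] by (simp add: mult_left_mono)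
    have "real j * \<bar>wkern (Sphere d) \<alpha> \<beta> a b j (\<theta>, \<phi>)\<bar> = real j * \<bar>y / 2 * w + x / 2 * w'\<bar>"
      unfolding wkern_sphere[OF q ab] x_def y_def w_def w'_def \<mu>_def \<kappa>_def ..
    also have "\<dots> \<le> real j * (y * \<bar>w\<bar> / 2 + x * \<bar>w'\<bar> / 2)"
    proof (rule mult_left_mono)
      show "\<bar>y / 2 * w + x / 2 * w'\<bar> \<le> y * \<bar>w\<bar> / 2 + x * \<bar>w'\<bar> / 2"
        using xy abs_triangle_ineq[of "y / 2 * w" "x / 2 * w'"] by (simp add: abs_mult)
    qed simp
    also have "\<dots> \<le> real j * \<bar>w\<bar> / 2 + real j * \<bar>w'\<bar> / 2"
      unfolding distrib_left using xy by (intro add_mono half) auto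
    also have "\<dots> \<le> 2 * (C + C') / m"
    proof -
      have "C / m \<ge> 0" "C' / m \<ge> 0" using C0 C'0 m by auto
      then show ?thesis using w by (simp add: add_divide_distrib)
    qed
    finally show "real j * \<bar>wkern (Sphere d) \<alpha> \<beta> a b j (\<theta>, \<phi>)\<bar> \<le> 2 * (C + C') / ball_measure \<alpha> \<beta> \<theta> \<phi>"
      unfolding m_def .
    assume "b = 1 \<or> b \<ge> 2"
    from exponent_cases(1)[OF j this] have \<kappa>2: "\<kappa> = 1 \<or> \<kappa> \<ge> 2" unfolding \<kappa>_def .
    define D where "D = \<bar>\<theta> - \<phi>\<bar>"
    have D: "D > 0" "D \<le> 4" using th pi_less_4 unfolding D_def by auto
    obtain g where g: "GDERIV (wint \<alpha> \<beta> \<mu> \<kappa>) (\<theta>, \<phi>) :> g" "\<mu> * norm g \<le> C / (D * m)"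
      using B1 \<mu>(1) unfolding D_def m_def by blast
    obtain g' where g': "GDERIV (\<lambda>q. wint \<beta> \<alpha> \<kappa> \<mu> ((pi, pi) - q)) (\<theta>, \<phi>) :> g'" "\<kappa> * norm g' \<le> C' / (D * m)"
      using B2 \<kappa>2 unfolding D_def m_def by blast
    have gj: "real j * norm g \<le> C / (D * m)" "real j * norm g' \<le> C' / (D * m)"
      using g(2) g'(2) mult_right_mono[OF \<mu>(3), of "norm g"] mult_right_mono[OF \<kappa>(2), of "norm g'"] by auto
    have cs: "GDERIV (\<lambda>q::real\<times>real. cos (fst q / 2) / 2) (\<theta>, \<phi>) :> (- x / 4, 0)"
      "GDERIV (\<lambda>q::real\<times>real. sin (fst q / 2) / 2) (\<theta>, \<phi>) :> (y / 4, 0)"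
      unfolding gderiv_def x_def y_def
      by (auto intro!: derivative_eq_intros ext simp: inner_prod_def)
    define G where "G = ((y / 2) *\<^sub>R g + w *\<^sub>R (- x / 4, 0)) + ((x / 2) *\<^sub>R g' + w' *\<^sub>R (y / 4, 0))"
    have "GDERIV (\<lambda>q. cos (fst q / 2) / 2 * wint \<alpha> \<beta> \<mu> \<kappa> q + sin (fst q / 2) / 2 * wint \<beta> \<alpha> \<kappa> \<mu> ((pi, pi) - q)) (\<theta>, \<phi>) :> G"
      using GDERIV_add[OF GDERIV_mult[OF cs(1) g(1)] GDERIV_mult[OF cs(2) g'(1)]]
      unfolding G_def w_def w'_def x_def y_def by simp
    moreover have "cos (fst p / 2) / 2 * wint \<alpha> \<beta> \<mu> \<kappa> p + sin (fst p / 2) / 2 * wint \<beta> \<alpha> \<kappa> \<mu> ((pi, pi) - p) = wkern (Sphere d) \<alpha> \<beta> a b j p"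
      if "p \<in> off_diagonal" for p
      using wkern_sphere[of "fst p" "snd p", OF _ ab, of d] that unfolding \<mu>_def \<kappa>_def by (cases p) simp
    ultimately have GG: "GDERIV (wkern (Sphere d) \<alpha> \<beta> a b j) (\<theta>, \<phi>) :> G"
      using GDERIV_transform[OF _ open_off_diagonal q] by blast
    have "norm G \<le> (y * norm g / 2 + \<bar>w\<bar> * (x / 4)) + (x * norm g' / 2 + \<bar>w'\<bar> * (y / 4))"
      unfolding G_def
      by (intro norm_triangle_le add_mono) (use xy in \<open>simp_all add: norm_Pair abs_mult\<close>)
    also have "\<dots> \<le> (y * norm g / 2 + \<bar>w\<bar> / 4) + (x * norm g' / 2 + \<bar>w'\<bar> / 4)"
      using xy mult_left_mono[of x 1 "\<bar>w\<bar>"] mult_left_mono[of y 1 "\<bar>w'\<bar>"] by simp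
    finally have "real j * norm G \<le> real j * ((y * norm g / 2 + \<bar>w\<bar> / 4) + (x * norm g' / 2 + \<bar>w'\<bar> / 4))"
      by (intro mult_left_mono) auto
    also have "\<dots> = (real j * (y * norm g / 2) + real j * \<bar>w\<bar> / 4) + (real j * (x * norm g' / 2) + real j * \<bar>w'\<bar> / 4)"
      by (simp add: distrib_left)
    also have "\<dots> \<le> (real j * norm g / 2 + real j * \<bar>w\<bar> / 4) + (real j * norm g' / 2 + real j * \<bar>w'\<bar> / 4)"
      using half[OF xy(3,4), of "norm g"] half[OF xy(1,2), of "norm g'"] by simp
    also have "\<dots> \<le> (C / (D * m) / 2 + C / m / 4) + (C' / (D * m) / 2 + C' / m / 4)"
      using gj w by (intro add_mono divide_right_mono) auto
    also have "\<dots> \<le> (C / (D * m) / 2 + 4 * C / (D * m) / 4) + (C' / (D * m) / 2 + 4 * C' / (D * m) / 4)"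
    proof -
      \<comment> \<open>Terms in which a smooth factor was differentiated lack 1 / D; as D \<le> 4
        it may be inserted.\<close>
      have "E / m \<le> 4 * E / (D * m)" if "E > 0" for E
        using D m that by (simp add: pos_divide_le_eq divide_simps)
      from this[OF C0] this[OF C'0] show ?thesis by simp
    qed
    also have "\<dots> \<le> 2 * (C + C') / (D * m)"
    proof -
      have "C / (D * m) \<ge> 0" "C' / (D * m) \<ge> 0" using C0 C'0 m D by auto
      then show ?thesis by (simp add: add_divide_distrib)
    qed
    finally show "\<exists>g. (GDERIV (wkern (Sphere d) \<alpha> \<beta> a b j) (\<theta>, \<phi>) :> g) \<and>
       real j * norm g \<le> 2 * (C + C') / (\<bar>\<theta> - \<phi>\<bar> * ball_measure \<alpha> \<beta> \<theta> \<phi>)"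
      using GG unfolding D_def m_def by blast
  qed
qed

theorem theorem3p5:
  fixes M :: rank_one_space and \<alpha> \<beta> a b :: real
  assumes M: "admissible M"
    and alpha: "\<alpha> > - 1 / 2" and beta: "\<beta> > - 1 / 2"
    and a: "a = 1 \<or> a \<ge> 2"
    and b: "b = 0 \<or> b \<ge> 1"
  shows
    "(((\<exists>d. M = Sphere d) \<longrightarrow> b \<ge> 1) \<longrightarrow>
      (\<exists>C\<^sub>1. \<forall>j\<ge>1. \<forall>\<theta>\<in>{0<..<pi}. \<forall>\<phi>\<in>{0<..<pi}. \<theta> \<noteq> \<phi> \<longrightarrow>
        \<bar>real j * u_fun a b j \<theta> * u_fun a b j \<phi>
            * kernel_T M (\<alpha> + a * real j) (\<beta> + b * real j) \<theta> \<phi>\<bar>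
          \<le> C\<^sub>1 / measure (jacobi_measure \<alpha> \<beta>) (ball \<theta> \<bar>\<theta> - \<phi>\<bar> \<inter> {0<..<pi})))
     \<and>
     (((\<exists>d. M = Sphere d) \<longrightarrow> b = 1 \<or> b \<ge> 2) \<longrightarrow>
      (\<exists>C\<^sub>2. \<forall>j\<ge>1. \<forall>\<theta>\<in>{0<..<pi}. \<forall>\<phi>\<in>{0<..<pi}. \<theta> \<noteq> \<phi> \<longrightarrow>
        (\<exists>g :: real \<times> real.
          (GDERIV (\<lambda>(x, y). u_fun a b j x * u_fun a b j y
              * kernel_T M (\<alpha> + a * real j) (\<beta> + b * real j) x y) (\<theta>, \<phi>) :> g) \<and>
          norm (real j *\<^sub>R g)
            \<le> C\<^sub>2 / (\<bar>\<theta> - \<phi>\<bar>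
                * measure (jacobi_measure \<alpha> \<beta>) (ball \<theta> \<bar>\<theta> - \<phi>\<bar> \<inter> {0<..<pi})))))"
proof -
  have off: "(\<theta>, \<phi>) \<in> off_diagonal" if "\<theta> \<in> {0<..<pi}" "\<phi> \<in> {0<..<pi}" "\<theta> \<noteq> \<phi>" for \<theta> \<phi>
    using that unfolding off_diagonal_def by auto
  have size: "\<bar>real j * u_fun a b j \<theta> * u_fun a b j \<phi> * kernel_T M (\<alpha> + a * real j) (\<beta> + b * real j) \<theta> \<phi>\<bar> =
      real j * \<bar>wkern M \<alpha> \<beta> a b j (\<theta>, \<phi>)\<bar>" for j \<theta> \<phi>
    unfolding wkern_def by (simp add: abs_mult mult.assoc)
  have grad: "(\<lambda>(x, y). u_fun a b j x * u_fun a b j y * kernel_T M (\<alpha> + a * real j) (\<beta> + b * real j) x y) =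
      wkern M \<alpha> \<beta> a b j" for j
    unfolding wkern_def by (auto simp: fun_eq_iff)
  have nm: "norm (real j *\<^sub>R g) = real j * norm g" for j and g :: "real \<times> real" by simp
  show ?thesis
  proof (cases "\<exists>d. M = Sphere d")
    case False
    from wkern_projective_bounds[OF False alpha beta a b]
    obtain C where C: "\<And>j \<theta> \<phi>. j \<ge> 1 \<Longrightarrow> (\<theta>, \<phi>) \<in> off_diagonal \<Longrightarrow>
      real j * \<bar>wkern M \<alpha> \<beta> a b j (\<theta>, \<phi>)\<bar> \<le> C / ball_measure \<alpha> \<beta> \<theta> \<phi> \<and>
      (\<exists>g. (GDERIV (wkern M \<alpha> \<beta> a b j) (\<theta>, \<phi>) :> g) \<and> real j * norm g \<le> C / (\<bar>\<theta> - \<phi>\<bar> * ball_measure \<alpha> \<beta> \<theta> \<phi>))"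
      by metis
    show ?thesis
      unfolding size grad nm ball_measure_def[symmetric]
      by (intro conjI impI exI[of _ C] ballI allI) (use C off in blast)+
  next
    case True
    then obtain d where d: "M = Sphere d" by blast
    show ?thesis
    proof (cases "b \<ge> 1")
      case True
      from wkern_sphere_bounds[OF alpha beta a True, of d]
      obtain C where C: "\<And>j \<theta> \<phi>. j \<ge> 1 \<Longrightarrow> (\<theta>, \<phi>) \<in> off_diagonal \<Longrightarrow>
        real j * \<bar>wkern M \<alpha> \<beta> a b j (\<theta>, \<phi>)\<bar> \<le> C / ball_measure \<alpha> \<beta> \<theta> \<phi> \<and>
        (b = 1 \<or> b \<ge> 2 \<longrightarrow> (\<exists>g. (GDERIV (wkern M \<alpha> \<beta> a b j) (\<theta>, \<phi>) :> g) \<and>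
          real j * norm g \<le> C / (\<bar>\<theta> - \<phi>\<bar> * ball_measure \<alpha> \<beta> \<theta> \<phi>)))"
        unfolding d by metis
      show ?thesis
        unfolding size grad nm ball_measure_def[symmetric]
        by (rule conjI; rule impI; rule exI[of _ C]) (use C off d in blast)+
    next
      \<comment> \<open>Both conjuncts are vacuous: on the sphere either premise forces b \<ge>
        1.\<close>
      case False
      then show ?thesis using d by auto
    qed
  qed
qed

end
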